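(* Let $D=\sum_\rho n_\rho\,\rho$ be a divisor with convergence exponent $d\ge 1$, contained in a left half plane $\{\Re\rho\le\sigma_1\}$, $\sigma_1\in\mathbb{R}$. Suppose that, for the distribution $W(D,\sigma)=\big(\sum_\rho n_\rho e^{\rho t}\big)\mathbf{1}_{\mathbb{R}_+}$ (regularized at some $\sigma\in\mathbb{C}$ outside the support of $D$, as in the context), a Poisson-Newton formula $$\Big(\sum_\rho n_\rho e^{\rho t}\Big)\mathbf{1}_{\mathbb{R}_+}=\sum_{n\ge1}b_n\,\delta_{\mu_n}+\sum_{j=0}^{d-2}c_j\,\delta_0^{(j)}$$ holds in $\mathbb{R}$, as an equality of distributions acting on functions with fast enough exponential decay, where $b_n,c_j\in\mathbb{C}$, $0<\mu_1<\mu_2<\cdots$, the sequence $(\mu_n)$ is finite or $\mu_n\to+\infty$, and $\sum_{n\ge1}|b_n|e^{-\mu_n\bar\sigma}<\infty$ for some $\bar\sigma<\infty$. Then there is a Dirichlet series $f$, meromorphic on $\mathbb{C}$, whose Poisson-Newton formula is the one given.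
   Context: A divisor is a formal sum $\sum n_\rho\,\rho$ with $n_\rho\in\mathbb{Z}\setminus\{0\}$ over a discrete closed set of points of $\mathbb{C}$. Its convergence exponent $d$ is the least integer $d\ge0$ with $\sum_{\rho\ne0}|n_\rho||\rho|^{-d}<\infty$. For $\sigma$ outside the support, put $K_d(t,\sigma)=\sum_\rho\frac{n_\rho}{(\rho-\sigma)^d}e^{(\rho-\sigma)t}\,\mathbf{1}_{\mathbb{R}_+}$ and $$W(D,\sigma)=e^{\sigma t}\frac{D^d}{Dt^d}\big((K_d(t,\sigma)-K_d(0,\sigma))\mathbf{1}_{\mathbb{R}_+}\big)$$ (distributional derivative on $\mathbb{R}$); this is the meaning of $\big(\sum_\rho n_\rho e^{\rho t}\big)\mathbf{1}_{\mathbb{R}_+}$. A Dirichlet series is $f(s)=1+\sum_{n\ge1}a_ne^{-\lambda_ns}$ with $0<\lambda_1<\lambda_2<\cdots$ (finite or tending to $+\infty$), absolutely convergent in some half plane $\Re s\geq \sigma_f$. If it extends meromorphically with finite order to $\mathbb{C}$ with divisor $D$, its Poisson-Newton formula (relative to $\sigma$) is $$W(D,\sigma)=\sum_{j}c_j\,\delta_0^{(j)}+\sum_{\mathbf{k}\in\Lambda}\langle\boldsymbol{\lambda},\mathbf{k}\rangle b_{\mathbf{k}}\,\delta_{\langle\boldsymbol{\lambda},\mathbf{k}\rangle},$$ where: $\sum_jc_js^j$ is the discrepancy polynomial $P_f=G(s)-f'(s)/f(s)$, $G(s)=\sum_\rho n_\rho\frac{(s-\sigma)^{d-1}}{(\rho-\sigma)^{d-1}}\frac1{s-\rho}$;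 $\Lambda$ is the set of non-zero finitely supported sequences $\mathbf{k}=(k_n)$ of non-negative integers; $\langle\boldsymbol{\lambda},\mathbf{k}\rangle=\sum\lambda_nk_n$; and $-\log f(s)=\sum_{\mathbf{k}\in\Lambda}b_{\mathbf{k}}e^{-\langle\boldsymbol{\lambda},\mathbf{k}\rangle s}$ for $\Re s$ large, with $b_{\mathbf{k}}=\frac{(-1)^{\|\mathbf{k}\|}}{\|\mathbf{k}\|}\frac{\|\mathbf{k}\|!}{\prod_jk_j!}\prod_ja_j^{k_j}$, $\|\mathbf{k}\|=\sum k_n$. That this is "the one given" means that $\operatorname{Div} f=D$ and that the terms of the two formulas agree as distributions. *)

theory Defs
  imports "HOL-Complex_Analysis.Complex_Analysis" "HOL-Library.Extended_Nat"
begin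

subsection \<open>Distributions on functions with fast enough exponential decay\<close>

definition nth_vderiv :: "nat \<Rightarrow> (real \<Rightarrow> complex) \<Rightarrow> real \<Rightarrow> complex" where
  "nth_vderiv k \<phi> = ((\<lambda>g t. vector_derivative g (at t)) ^^ k) \<phi>"

text \<open>Smooth functions on the real line that decay, together with all their derivatives,
  like \<open>exp (- A * \<bar>t\<bar>)\<close>. These spaces shrink as \<open>A\<close> grows.\<close>

definition exp_test :: "real \<Rightarrow> (real \<Rightarrow> complex) set" where
  "exp_test A = {\<phi>. \<forall>k. (\<forall>t. nth_vderiv k \<phi> differentiable (at t)) \<and>
                        (\<exists>C. \<forall>t. norm (nth_vderiv k \<phi> t) \<le> C * exp (- A * \<bar>t\<bar>))}"

type_synonym distrib = "(real \<Rightarrow> complex) \<Rightarrow> complex"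

text \<open>Equality of distributions acting on functions with fast enough exponential decay.
  Integrals and infinite sums below converge absolutely on \<^term>\<open>exp_test A\<close> once \<open>A\<close> is large;
  since the spaces shrink, an equality valid for some \<open>A\<close> is valid for every larger one, so the
  default values that divergent integrals and sums take in HOL play no role here.\<close>

definition eq_distrib :: "distrib \<Rightarrow> distrib \<Rightarrow> bool" where
  "eq_distrib T S \<longleftrightarrow> (\<exists>A. \<forall>\<phi>\<in>exp_test A. T \<phi> = S \<phi>)"

definition distrib_of :: "(real \<Rightarrow> complex) \<Rightarrow> distrib" where
  "distrib_of g \<phi> = (LINT t|lborel. g t * \<phi> t)"

definition delta :: "real \<Rightarrow> distrib" where
  "delta x \<phi> = \<phi> x"

definition distrib_deriv :: "nat \<Rightarrow> distrib \<Rightarrow> distrib" where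
  "distrib_deriv k T \<phi> = (-1) ^ k * T (nth_vderiv k \<phi>)"

definition exp_times :: "complex \<Rightarrow> distrib \<Rightarrow> distrib" where
  "exp_times \<sigma> T \<phi> = T (\<lambda>t. exp (\<sigma> * of_real t) * \<phi> t)"


subsection \<open>Divisors\<close>

text \<open>A divisor is given by its coefficient function, which is zero off the support.\<close>

definition div_supp :: "(complex \<Rightarrow> int) \<Rightarrow> complex set" where
  "div_supp D = {\<rho>. D \<rho> \<noteq> 0}"

definition is_divisor :: "(complex \<Rightarrow> int) \<Rightarrow> bool" where
  "is_divisor D \<longleftrightarrow> closed (div_supp D) \<and> discrete (div_supp D)"

definition div_summable :: "(complex \<Rightarrow> int) \<Rightarrow> nat \<Rightarrow> bool" where
  "div_summable D d \<longleftrightarrow>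
     (\<lambda>\<rho>. of_int \<bar>D \<rho>\<bar> / norm \<rho> ^ d) summable_on (div_supp D - {0})"

definition convergence_exponent :: "(complex \<Rightarrow> int) \<Rightarrow> nat \<Rightarrow> bool" where
  "convergence_exponent D d \<longleftrightarrow> div_summable D d \<and> (\<forall>e<d. \<not> div_summable D e)"

definition K_fun :: "(complex \<Rightarrow> int) \<Rightarrow> nat \<Rightarrow> complex \<Rightarrow> real \<Rightarrow> complex" where
  "K_fun D d \<sigma> t = (\<Sum>\<^sub>\<infinity>\<rho>\<in>div_supp D.
     of_int (D \<rho>) / (\<rho> - \<sigma>) ^ d * exp ((\<rho> - \<sigma>) * of_real t)) * indicator {0..} t"

definition W_distrib :: "(complex \<Rightarrow> int) \<Rightarrow> nat \<Rightarrow> complex \<Rightarrow> distrib" where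
  "W_distrib D d \<sigma> = exp_times \<sigma> (distrib_deriv d
     (distrib_of (\<lambda>t. (K_fun D d \<sigma> t - K_fun D d \<sigma> 0) * indicator {0..} t)))"


subsection \<open>Dirichlet series\<close>

text \<open>Finite or infinite sequences are indexed from \<open>0\<close>; their length is an extended natural.\<close>

definition idx :: "enat \<Rightarrow> nat set" where
  "idx N = {n. enat n < N}"

definition frequencies :: "enat \<Rightarrow> (nat \<Rightarrow> real) \<Rightarrow> bool" where
  "frequencies N l \<longleftrightarrow> (\<forall>n\<in>idx N. 0 < l n) \<and> strict_mono_on (idx N) l \<and>
     (N = \<infinity> \<longrightarrow> filterlim l at_top sequentially)"

text \<open>\<open>f\<close> is a function on the whole plane which, in some right half plane, is the sum of the
  absolutely convergent series with frequencies \<open>l\<close> and coefficients \<open>a\<close>.\<close>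

definition dirichlet_series ::
    "enat \<Rightarrow> (nat \<Rightarrow> real) \<Rightarrow> (nat \<Rightarrow> complex) \<Rightarrow> (complex \<Rightarrow> complex) \<Rightarrow> bool" where
  "dirichlet_series N l a f \<longleftrightarrow> frequencies N l \<and>
     (\<exists>\<sigma>\<^sub>f. \<forall>s. Re s \<ge> \<sigma>\<^sub>f \<longrightarrow>
        (\<lambda>n. norm (a n * exp (- of_real (l n) * s))) summable_on idx N \<and>
        f s = 1 + (\<Sum>\<^sub>\<infinity>n\<in>idx N. a n * exp (- of_real (l n) * s)))"

definition entire_finite_order :: "(complex \<Rightarrow> complex) \<Rightarrow> bool" where
  "entire_finite_order g \<longleftrightarrow> g holomorphic_on UNIV \<and>
     (\<exists>\<tau>::real. eventually (\<lambda>z. norm (g z) \<le> exp (norm z powr \<tau>)) at_infinity)"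

text \<open>A meromorphic function has finite order if it is a quotient of two entire functions of
  finite order. Working with \<^const>\<open>nicely_meromorphic_on\<close> excludes wrong values at removable
  singularities, so \<^term>\<open>deriv f s / f s\<close> is the logarithmic derivative at every \<open>s\<close> that is
  neither a zero nor a pole.\<close>

definition meromorphic_finite_order :: "(complex \<Rightarrow> complex) \<Rightarrow> bool" where
  "meromorphic_finite_order f \<longleftrightarrow> f nicely_meromorphic_on UNIV \<and>
     (\<exists>g h. entire_finite_order g \<and> entire_finite_order h \<and> (\<exists>z. h z \<noteq> 0) \<and>
        (\<forall>z. h z \<noteq> 0 \<longrightarrow> f z = g z / h z))"


subsection \<open>The terms of the Poisson-Newton formula of a Dirichlet series\<close>

definition G_fun :: "(complex \<Rightarrow> int) \<Rightarrow> nat \<Rightarrow> complex \<Rightarrow> complex \<Rightarrow> complex" where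
  "G_fun D d \<sigma> s = (\<Sum>\<^sub>\<infinity>\<rho>\<in>div_supp D. of_int (D \<rho>) *
     ((s - \<sigma>) powi (int d - 1) / (\<rho> - \<sigma>) powi (int d - 1)) * (1 / (s - \<rho>)))"

definition discrepancy_poly ::
    "(complex \<Rightarrow> complex) \<Rightarrow> (complex \<Rightarrow> int) \<Rightarrow> nat \<Rightarrow> complex \<Rightarrow> complex poly \<Rightarrow> bool" where
  "discrepancy_poly f D d \<sigma> P \<longleftrightarrow>
     (\<forall>s. s \<notin> div_supp D \<longrightarrow> poly P s = G_fun D d \<sigma> s - deriv f s / f s)"

definition discrepancy_term :: "complex poly \<Rightarrow> distrib" where
  "discrepancy_term P \<phi> = (\<Sum>j\<le>degree P. coeff P j * distrib_deriv j (delta 0) \<phi>)"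

definition Lambda_set :: "enat \<Rightarrow> (nat \<Rightarrow> nat) set" where
  "Lambda_set N = {k. finite {j. k j \<noteq> 0} \<and> {j. k j \<noteq> 0} \<subseteq> idx N \<and> {j. k j \<noteq> 0} \<noteq> {}}"

definition pairing :: "(nat \<Rightarrow> real) \<Rightarrow> (nat \<Rightarrow> nat) \<Rightarrow> real" where
  "pairing l k = (\<Sum>j | k j \<noteq> 0. l j * real (k j))"

definition multi_size :: "(nat \<Rightarrow> nat) \<Rightarrow> nat" where
  "multi_size k = (\<Sum>j | k j \<noteq> 0. k j)"

text \<open>The coefficient of \<open>exp (- pairing l k * s)\<close> in the expansion of \<open>- log f(s)\<close>.\<close>

definition log_coeff :: "(nat \<Rightarrow> complex) \<Rightarrow> (nat \<Rightarrow> nat) \<Rightarrow> complex" where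
  "log_coeff a k = (-1) ^ multi_size k / of_nat (multi_size k) *
     (fact (multi_size k) / (\<Prod>j | k j \<noteq> 0. fact (k j))) * (\<Prod>j | k j \<noteq> 0. a j ^ k j)"

definition frequency_term :: "enat \<Rightarrow> (nat \<Rightarrow> real) \<Rightarrow> (nat \<Rightarrow> complex) \<Rightarrow> distrib" where
  "frequency_term N l a \<phi> = (\<Sum>\<^sub>\<infinity>k\<in>Lambda_set N.
     of_real (pairing l k) * log_coeff a k * delta (pairing l k) \<phi>)"

end

theory Submission
  imports Defs "HOL-Combinatorics.Multiset_Permutations"
begin

text \<open>
  The function \<open>G\<close> in the discrepancy polynomial is the Laplace transform of \<open>W(D, \<sigma>)\<close>. Testing the
  given formula against \<open>exp (- s t)\<close> therefore yields, for \<open>Re s\<close> large,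
  \<open>G(s) = (\<Sum>n. b\<^sub>n exp (- \<mu>\<^sub>n s)) + (\<Sum>j. c\<^sub>j s\<^sup>j)\<close>. Only the values of a test function on the half line
  matter, but \<open>exp (- s t)\<close> does not decay at \<open>-\<infinity>\<close>, so it is approximated by the test functions
  \<open>exp (- s t - \<epsilon> t\<^sup>2)\<close> with \<open>\<epsilon> \<longlonglongrightarrow> 0\<close>, using dominated convergence on every term
  (\<open>poisson_newton_laplace\<close>).

  On the other hand \<open>G\<close> is exactly the logarithmic derivative of the quotient of Weierstrass canonical
  products of genus \<open>d - 1\<close>, centred at \<open>\<sigma>\<close>, with divisor \<open>D\<close> (\<open>product_quotient_logderiv\<close>). That quotient
  is meromorphic on the plane, and of finite order because \<open>\<Sum> |n\<^sub>\<rho>| |\<rho> - \<sigma>|\<^sup>-\<^sup>d\<close> converges. Multiplying it by the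
  exponential of minus a primitive of the polynomial \<open>\<Sum>j. c\<^sub>j s\<^sup>j\<close> and by a constant changes neither fact,
  and gives a function \<open>f\<close> whose discrepancy polynomial is that polynomial. By the first paragraph
  \<open>f' / f = (\<Sum>n. b\<^sub>n exp (- \<mu>\<^sub>n s))\<close> on a right half plane, so with the right constant
  \<open>f = exp (- (\<Sum>n. \<beta>\<^sub>n exp (- \<mu>\<^sub>n s)))\<close> there, where \<open>\<beta>\<^sub>n = b\<^sub>n / \<mu>\<^sub>n\<close>.

  It remains to see that this is a Dirichlet series with the right frequency terms. Expanding the
  exponential gives a sum over the words in the indices of \<open>\<mu>\<close>; the frequencies are the sums of \<open>\<mu>\<close> over
  these words, and below any bound there are only finitely many of them, so the terms can be collected and
  ordered (\<open>exp_minus_dirichlet_series\<close>). Now \<open>- log f\<close> has two expansions as an exponential sum: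
  the given one, and the one with the coefficients of the Poisson-Newton formula of \<open>f\<close>. Exponential sums
  with locally finite frequencies are determined by their values, so the two have the same mass at each
  frequency and agree against every function of enough decay, in particular against \<open>t \<phi>(t)\<close>
  (\<open>frequency_term_of_logarithm\<close>). This last step avoids any termwise differentiation of the expansion
  of \<open>log f\<close>.
\<close>

section \<open>Sums over words\<close>

text \<open>The tool for collecting terms: it groups words by their frequency, and words by their underlying multiset.\<close>

lemma has_sum_fibers:
  fixes f :: "'i \<Rightarrow> 'b :: banach"
  assumes "f summable_on I"
  shows "((\<lambda>z. \<Sum>\<^sub>\<infinity>i\<in>{i\<in>I. x i = z}. f i) has_sum infsum f I) (x ` I)"
proof -
  let ?S = "Sigma (x ` I) (\<lambda>z. {i\<in>I. x i = z})"
  have bij: "bij_betw snd ?S I"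
    by (rule bij_betwI[of _ _ _ "\<lambda>i. (x i, i)"]) auto
  have sS: "((\<lambda>p. f (snd p)) has_sum infsum f I) ?S"
    using has_sum_reindex_bij_betw[OF bij, of f "infsum f I"] assms by simp
  show ?thesis
  proof (rule has_sum_SigmaD)
    show "((\<lambda>p. f (snd p)) has_sum infsum f I) ?S" by (rule sS)
    fix z
    have "f summable_on {i\<in>I. x i = z}"
      by (rule summable_on_subset_banach[OF assms]) auto
    then show "((\<lambda>y. f (snd (z, y))) has_sum (\<Sum>\<^sub>\<infinity>i\<in>{i\<in>I. x i = z}. f i)) {i\<in>I. x i = z}"
      by simp
  qed
qed

text \<open>Induction on the length, splitting off the first letter. The case of nonnegative terms comes first, since
  it supplies the absolute convergence that the complex case needs for its interchange of summations.\<close>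

lemma has_sum_words_length_nonneg:
  fixes g :: "'i \<Rightarrow> real"
  assumes g: "(g has_sum r) X" and nn: "\<And>i. i \<in> X \<Longrightarrow> g i \<ge> 0"
  shows "((\<lambda>w. prod_list (map g w)) has_sum r ^ m) {w\<in>lists X. length w = m}"
proof (induction m)
  case 0
  have "{w\<in>lists X. length w = 0} = {[]}" by auto
  then show ?case by (simp add: has_sum_finite_iff)
next
  case (Suc m)
  let ?W = "{w\<in>lists X. length w = m}"
  have bij: "bij_betw (\<lambda>(i, w). i # w) (X \<times> ?W) {w\<in>lists X. length w = Suc m}"
    by (rule bij_betwI[of _ _ _ "\<lambda>w. (hd w, tl w)"]) (auto simp: length_Suc_conv)
  have nnw: "prod_list (map g w) \<ge> 0" if "w \<in> ?W" for w
    using that by (auto intro!: prod_list_nonneg nn)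
  have inner: "((\<lambda>w. g i * prod_list (map g w)) has_sum g i * r ^ m) ?W" for i
    by (rule has_sum_cmult_right[OF Suc.IH])
  have outer: "((\<lambda>i. g i * r ^ m) has_sum r * r ^ m) X"
    by (rule has_sum_cmult_left[OF g])
  have "((\<lambda>(i,w). g i * prod_list (map g w)) has_sum r * r ^ m) (X \<times> ?W)"
  proof (rule has_sum_SigmaI[OF _ outer])
    show "(\<lambda>(i,w). g i * prod_list (map g w)) summable_on X \<times> ?W"
      by (rule summable_on_SigmaI[where g = "\<lambda>i. g i * r ^ m"])
         (use inner outer nn nnw in \<open>auto simp: summable_on_def\<close>)
  qed (use inner in auto)
  then have "((\<lambda>p. prod_list (map g (case p of (i, w) \<Rightarrow> i # w))) has_sum r * r ^ m) (X \<times> ?W)"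
    by (simp add: case_prod_unfold)
  then show ?case
    using has_sum_reindex_bij_betw[OF bij, of "\<lambda>w. prod_list (map g w)"] by simp
qed

lemma norm_prod_list:
  fixes g :: "'i \<Rightarrow> 'b :: real_normed_field"
  shows "norm (prod_list (map g w)) = prod_list (map (\<lambda>i. norm (g i)) w)"
  by (induction w) (auto simp: norm_mult)

lemma has_sum_words_length:
  fixes g :: "'i \<Rightarrow> complex"
  assumes g: "(\<lambda>i. norm (g i)) summable_on X"
  shows "((\<lambda>w. prod_list (map g w)) has_sum (infsum g X) ^ m) {w\<in>lists X. length w = m}"
proof (induction m)
  case 0
  have "{w\<in>lists X. length w = 0} = {[]}" by auto
  then show ?case by (simp add: has_sum_finite_iff)
next
  case (Suc m)
  let ?W = "\<lambda>m. {w\<in>lists X. length w = m}"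
  have bij: "bij_betw (\<lambda>(i, w). i # w) (X \<times> ?W m) (?W (Suc m))"
    by (rule bij_betwI[of _ _ _ "\<lambda>w. (hd w, tl w)"]) (auto simp: length_Suc_conv)
  have inner: "((\<lambda>w. g i * prod_list (map g w)) has_sum g i * infsum g X ^ m) (?W m)" for i
    by (rule has_sum_cmult_right[OF Suc.IH])
  have outer: "((\<lambda>i. g i * infsum g X ^ m) has_sum infsum g X * infsum g X ^ m) X"
    by (rule has_sum_cmult_left) (simp add: abs_summable_summable[OF g])
  have "(\<lambda>w. norm (prod_list (map g w))) summable_on ?W (Suc m)"
    using has_sum_words_length_nonneg[OF has_sum_infsum[OF g], of "Suc m"]
    by (auto simp: norm_prod_list dest: has_sum_imp_summable)
  then have "(\<lambda>w. prod_list (map g w)) summable_on ?W (Suc m)"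
    by (rule abs_summable_summable)
  then have "(\<lambda>p. prod_list (map g (case p of (i, w) \<Rightarrow> i # w))) summable_on X \<times> ?W m"
    using summable_on_reindex_bij_betw[OF bij, of "\<lambda>w. prod_list (map g w)"] by simp
  then have "(\<lambda>(i,w). g i * prod_list (map g w)) summable_on X \<times> ?W m"
    by (simp add: case_prod_unfold)
  then have "((\<lambda>(i,w). g i * prod_list (map g w)) has_sum infsum g X * infsum g X ^ m) (X \<times> ?W m)"
    by (intro has_sum_SigmaI[OF _ outer]) (use inner in auto)
  then have "((\<lambda>p. prod_list (map g (case p of (i, w) \<Rightarrow> i # w))) has_sum infsum g X * infsum g X ^ m) (X \<times> ?W m)"
    by (simp add: case_prod_unfold)
  then show ?case
    using has_sum_reindex_bij_betw[OF bij, of "\<lambda>w. prod_list (map g w)"] by simp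
qed

text \<open>The \<open>m\<close>-th power of an absolutely convergent sum is the sum over all words of length \<open>m\<close>. Words are
  easier to sum over than multi-indices: multinomial coefficients appear only when words are grouped by
  multiset. The lemma is applied to the series of \<open>exp (- x)\<close> and of \<open>- ln (1 + x)\<close>.\<close>

lemma power_series_over_words:
  fixes g :: "'i \<Rightarrow> complex" and \<gamma> :: "nat \<Rightarrow> complex"
  assumes g: "(\<lambda>i. norm (g i)) summable_on X"
    and \<gamma>: "summable (\<lambda>m. norm (\<gamma> m) * infsum (\<lambda>i. norm (g i)) X ^ m)"
  shows "(\<lambda>w. norm (\<gamma> (length w) * prod_list (map g w))) summable_on lists X"
    and "((\<lambda>w. \<gamma> (length w) * prod_list (map g w)) has_sum (\<Sum>m. \<gamma> m * infsum g X ^ m)) (lists X)"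
proof -
  let ?W = "\<lambda>m. {w\<in>lists X. length w = m}" and ?r = "infsum (\<lambda>i. norm (g i)) X"
  let ?h = "\<lambda>w. \<gamma> (length w) * prod_list (map g w)"
  have bij: "bij_betw snd (Sigma UNIV ?W) (lists X)"
    by (rule bij_betwI[of _ _ _ "\<lambda>w. (length w, w)"]) auto
  have r0: "?r \<ge> 0" by (intro infsum_nonneg) auto
  have "(\<lambda>p. norm (?h (snd p))) summable_on Sigma UNIV ?W"
  proof (rule summable_on_SigmaI[where g = "\<lambda>m. norm (\<gamma> m) * ?r ^ m"])
    fix m :: nat
    have "((\<lambda>w. norm (\<gamma> m) * prod_list (map (\<lambda>i. norm (g i)) w)) has_sum norm (\<gamma> m) * ?r ^ m) (?W m)"
      by (intro has_sum_cmult_right has_sum_words_length_nonneg has_sum_infsum g) auto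
    then show "((\<lambda>w. norm (?h (snd (m, w)))) has_sum norm (\<gamma> m) * ?r ^ m) (?W m)"
      by (rule has_sum_cong[THEN iffD1, rotated]) (auto simp: norm_mult norm_prod_list)
  next
    show "(\<lambda>m. norm (\<gamma> m) * ?r ^ m) summable_on UNIV"
      by (rule summable_nonneg_imp_summable_on[OF \<gamma>]) (use r0 in auto)
  qed auto
  then show sn: "(\<lambda>w. norm (?h w)) summable_on lists X"
    using summable_on_reindex_bij_betw[OF bij, of "\<lambda>w. norm (?h w)"] by simp
  have "?h summable_on lists X" by (rule abs_summable_summable[OF sn])
  then have sS: "(\<lambda>p. ?h (snd p)) summable_on Sigma UNIV ?W"
    using summable_on_reindex_bij_betw[OF bij, of "\<lambda>w. ?h w"] by simp
  have "norm (infsum g X) \<le> ?r"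
    by (rule norm_infsum_bound[OF g])
  then have "summable (\<lambda>m. norm (\<gamma> m * infsum g X ^ m))"
    by (intro summable_comparison_test[OF _ \<gamma>] exI[of _ 0])
       (auto simp: norm_mult norm_power intro!: mult_left_mono power_mono)
  then have outer: "((\<lambda>m. \<gamma> m * infsum g X ^ m) has_sum (\<Sum>m. \<gamma> m * infsum g X ^ m)) UNIV"
    by (metis norm_summable_imp_has_sum summable_norm_cancel summable_sums)
  have "((\<lambda>p. ?h (snd p)) has_sum (\<Sum>m. \<gamma> m * infsum g X ^ m)) (Sigma UNIV ?W)"
  proof (rule has_sum_SigmaI[OF _ outer sS])
    fix m :: nat
    have "((\<lambda>w. \<gamma> m * prod_list (map g w)) has_sum \<gamma> m * infsum g X ^ m) (?W m)"
      by (intro has_sum_cmult_right has_sum_words_length g)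
    then show "((\<lambda>w. ?h (snd (m, w))) has_sum \<gamma> m * infsum g X ^ m) (?W m)"
      by (rule has_sum_cong[THEN iffD1, rotated]) auto
  qed
  then show "(?h has_sum (\<Sum>m. \<gamma> m * infsum g X ^ m)) (lists X)"
    using has_sum_reindex_bij_betw[OF bij, of ?h] by simp
qed

section \<open>Frequencies\<close>

lemma finite_frequencies_below:
  assumes "frequencies N l"
  shows "finite {n \<in> idx N. l n \<le> B}"
proof (cases "N = \<infinity>")
  case True
  then have "eventually (\<lambda>n. l n > B) sequentially"
    using assms by (auto simp: frequencies_def filterlim_at_top_dense)
  then obtain n0 where "\<And>n. n \<ge> n0 \<Longrightarrow> l n > B"
    by (auto simp: eventually_sequentially)
  then have "{n \<in> idx N. l n \<le> B} \<subseteq> {..<n0}"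
    by (force simp: not_le[symmetric])
  then show ?thesis using finite_subset by blast
next
  case False
  then obtain k where "N = enat k" by auto
  then have "{n \<in> idx N. l n \<le> B} \<subseteq> {..<k}" by (auto simp: idx_def)
  then show ?thesis using finite_subset by blast
qed

lemma frequencies_lower_bound:
  assumes "frequencies N l"
  obtains \<delta> where "\<delta> > 0" "\<And>n. n \<in> idx N \<Longrightarrow> l n \<ge> \<delta>"
proof (cases "0 \<in> idx N")
  case True
  have "l n \<ge> l 0" if "n \<in> idx N" for n
  proof (cases "n = 0")
    case False
    then have "l 0 < l n"
      using assms True that unfolding frequencies_def strict_mono_on_def by auto
    then show ?thesis by simp
  qed auto
  then show ?thesis using that[of "l 0"] True assms by (auto simp: frequencies_def)
next
  case False
  then have "idx N = {}" by (auto simp: idx_def zero_enat_def[symmetric])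
  then show ?thesis using that[of 1] by auto
qed

text \<open>Letters have weight at least some \<open>\<delta> > 0\<close>, which bounds the length, and each letter of such a word has weight
  at most \<open>B\<close>, which leaves finitely many letters.\<close>

lemma finite_words_below:
  assumes "frequencies N l"
  shows "finite {w \<in> lists (idx N). sum_list (map l w) \<le> B}"
proof -
  obtain \<delta> where \<delta>: "\<delta> > 0" "\<And>n. n \<in> idx N \<Longrightarrow> l n \<ge> \<delta>"
    using frequencies_lower_bound[OF assms] by blast
  let ?F = "{n \<in> idx N. l n \<le> B}"
  have "{w \<in> lists (idx N). sum_list (map l w) \<le> B} \<subseteq> {w. set w \<subseteq> ?F \<and> length w \<le> nat \<lceil>B / \<delta>\<rceil>}"
  proof (rule subsetI)
    fix w assume "w \<in> {w \<in> lists (idx N). sum_list (map l w) \<le> B}"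
    then have w: "w \<in> lists (idx N)" "sum_list (map l w) \<le> B" by auto
    have "real (length w) * \<delta> \<le> sum_list (map l w)"
      using w(1) by (induction w) (auto simp: algebra_simps intro!: add_mono \<delta>)
    then have "real (length w) \<le> B / \<delta>"
      using w(2) \<delta>(1) by (simp add: field_simps)
    then have len: "length w \<le> nat \<lceil>B / \<delta>\<rceil>" by linarith
    have nn: "sum_list (map l v) \<ge> 0" if "set v \<subseteq> set w" for v
      using that w(1) assms by (intro sum_list_nonneg) (force simp: frequencies_def intro: less_imp_le)
    have "l n \<le> B" if n: "n \<in> set w" for n
    proof -
      obtain u v where w_eq: "w = u @ n # v" using split_list[OF n] by blast
      have "set u \<subseteq> set w" "set v \<subseteq> set w" by (auto simp: w_eq)
      from nn[OF this(1)] nn[OF this(2)] have "l n \<le> sum_list (map l w)" by (simp add: w_eq)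
      then show "l n \<le> B" using w(2) by simp
    qed
    then show "w \<in> {w. set w \<subseteq> ?F \<and> length w \<le> nat \<lceil>B / \<delta>\<rceil>}"
      using len w(1) by auto
  qed
  then show ?thesis
    using finite_lists_length_le[OF finite_frequencies_below[OF assms]] finite_subset by blast
qed

lemma word_weight_pos:
  assumes "frequencies N l" "w \<in> lists (idx N)" "w \<noteq> []"
  shows "sum_list (map l w) > 0"
proof -
  have nn: "sum_list (map l v) \<ge> 0" if "v \<in> lists (idx N)" for v
    using that assms(1) by (intro sum_list_nonneg) (force simp: frequencies_def intro: less_imp_le)
  show ?thesis using assms nn[of "tl w"]
    by (cases w) (auto simp: frequencies_def intro!: add_pos_nonneg)
qed

section \<open>Uniqueness of exponential sums\<close>

text \<open>If all frequencies are at least \<open>\<delta>\<close>, then moving the exponent from \<open>A\<close> to \<open>B\<close> gains a factor \<open>exp (- \<delta> (B - A))\<close>.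
  With \<open>\<delta> = 0\<close> this is the monotonicity of absolute convergence; with \<open>\<delta>\<close> the gap above the smallest
  frequency it shows that the smallest frequency dominates.\<close>

lemma exp_sum_decay:
  fixes \<gamma> :: "'i \<Rightarrow> complex" and x :: "'i \<Rightarrow> real"
  assumes sm: "(\<lambda>i. norm (\<gamma> i) * exp (- x i * A)) summable_on I"
    and \<delta>: "\<And>i. i \<in> I \<Longrightarrow> x i \<ge> \<delta>" and "A \<le> B"
  shows "(\<lambda>i. norm (\<gamma> i) * exp (- x i * B)) summable_on I"
    and "(\<Sum>\<^sub>\<infinity>i\<in>I. norm (\<gamma> i) * exp (- x i * B))
           \<le> exp (- \<delta> * (B - A)) * (\<Sum>\<^sub>\<infinity>i\<in>I. norm (\<gamma> i) * exp (- x i * A))"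
proof -
  have le: "norm (\<gamma> i) * exp (- x i * B) \<le> exp (- \<delta> * (B - A)) * (norm (\<gamma> i) * exp (- x i * A))"
    if "i \<in> I" for i
  proof -
    have "\<delta> * (B - A) \<le> x i * (B - A)"
      using \<delta>[OF that] \<open>A \<le> B\<close> by (intro mult_right_mono) auto
    then have "exp (- x i * B) \<le> exp (- \<delta> * (B - A)) * exp (- x i * A)"
      unfolding exp_add[symmetric] by (simp add: algebra_simps)
    then have "norm (\<gamma> i) * exp (- x i * B) \<le> norm (\<gamma> i) * (exp (- \<delta> * (B - A)) * exp (- x i * A))"
      by (intro mult_left_mono) auto
    then show ?thesis by (simp only: mult_ac)
  qed
  have sm': "(\<lambda>i. exp (- \<delta> * (B - A)) * (norm (\<gamma> i) * exp (- x i * A))) summable_on I"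
    by (intro summable_on_cmult_right sm)
  show *: "(\<lambda>i. norm (\<gamma> i) * exp (- x i * B)) summable_on I"
    by (rule summable_on_comparison_test[OF sm' le]) auto
  have "(\<Sum>\<^sub>\<infinity>i\<in>I. norm (\<gamma> i) * exp (- x i * B))
          \<le> (\<Sum>\<^sub>\<infinity>i\<in>I. exp (- \<delta> * (B - A)) * (norm (\<gamma> i) * exp (- x i * A)))"
    by (rule infsum_mono[OF * sm' le])
  also have "\<dots> = exp (- \<delta> * (B - A)) * (\<Sum>\<^sub>\<infinity>i\<in>I. norm (\<gamma> i) * exp (- x i * A))"
    by (rule infsum_cmult_right) (use sm in auto)
  finally show "(\<Sum>\<^sub>\<infinity>i\<in>I. norm (\<gamma> i) * exp (- x i * B))
           \<le> exp (- \<delta> * (B - A)) * (\<Sum>\<^sub>\<infinity>i\<in>I. norm (\<gamma> i) * exp (- x i * A))" .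
qed

text \<open>If some collected coefficient \<open>c y\<close> is non-zero, then there is a smallest such frequency \<open>y\<^sub>0\<close>, because the
  frequencies are locally finite. After multiplication by \<open>exp (y\<^sub>0 s)\<close>, the remaining frequencies exceed
  \<open>0\<close> by a fixed gap, so their contribution decays as \<open>s\<close> grows, while the term of \<open>y\<^sub>0\<close> stays equal to \<open>c y\<^sub>0\<close>.\<close>

lemma exp_sum_unique:
  fixes \<gamma> :: "'i \<Rightarrow> complex" and x :: "'i \<Rightarrow> real"
  assumes sm: "(\<lambda>i. norm (\<gamma> i) * exp (- x i * A)) summable_on I"
    and pos: "\<And>i. i \<in> I \<Longrightarrow> x i \<ge> 0"
    and fin: "\<And>B. finite (x ` I \<inter> {..B})"
    and zero: "\<And>s. s \<ge> A \<Longrightarrow> (\<Sum>\<^sub>\<infinity>i\<in>I. \<gamma> i * of_real (exp (- x i * s))) = 0"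
  shows "(\<Sum>\<^sub>\<infinity>i\<in>{i\<in>I. x i = y}. \<gamma> i) = 0"
proof (rule ccontr)
  define c where "c z = (\<Sum>\<^sub>\<infinity>i\<in>{i\<in>I. x i = z}. \<gamma> i)" for z
  let ?Z = "x ` I"
  assume "(\<Sum>\<^sub>\<infinity>i\<in>{i\<in>I. x i = y}. \<gamma> i) \<noteq> 0"
  then have y: "c y \<noteq> 0" by (simp add: c_def)
  then have "y \<in> ?Z" unfolding c_def using infsum_cong_neutral[of "{}" "{i\<in>I. x i = y}" \<gamma> \<gamma>] by fastforce
  let ?M = "{z \<in> ?Z \<inter> {..y}. c z \<noteq> 0}"
  have M: "finite ?M" "?M \<noteq> {}" using y \<open>y \<in> ?Z\<close> by (auto intro: finite_subset[OF _ fin[of y]])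
  define y0 where "y0 = Min ?M"
  have y0: "y0 \<in> ?Z" "c y0 \<noteq> 0" using Min_in[OF M] by (auto simp: y0_def)
  have small: "c z = 0" if "z \<in> ?Z" "z < y0" for z
  proof (rule ccontr)
    assume "c z \<noteq> 0"
    have "y0 \<le> y" using Min_in[OF M] by (auto simp: y0_def)
    then have "z \<in> ?M" using that \<open>c z \<noteq> 0\<close> by auto
    then have "y0 \<le> z" using Min_le[OF M(1)] by (simp add: y0_def)
    then show False using that by simp
  qed
  have sms: "(\<lambda>i. norm (\<gamma> i) * exp (- x i * s)) summable_on I" if "s \<ge> A" for s
    using exp_sum_decay(1)[OF sm pos that] .
  have sms': "(\<lambda>i. \<gamma> i * of_real (exp (- x i * s))) summable_on I" if "s \<ge> A" for s
    by (rule abs_summable_summable) (use sms[OF that] in \<open>simp add: norm_mult\<close>)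
  have fiber: "(\<Sum>\<^sub>\<infinity>i\<in>{i\<in>I. x i = z}. \<gamma> i * of_real (exp (- x i * s))) = c z * of_real (exp (- z * s))" for z s
  proof -
    have "(\<Sum>\<^sub>\<infinity>i\<in>{i\<in>I. x i = z}. \<gamma> i * of_real (exp (- x i * s)))
        = (\<Sum>\<^sub>\<infinity>i\<in>{i\<in>I. x i = z}. \<gamma> i * of_real (exp (- z * s)))"
      by (intro infsum_cong) auto
    also have "\<dots> = c z * of_real (exp (- z * s))"
      unfolding c_def by (rule infsum_cmult_left')
    finally show ?thesis .
  qed
  have cs: "((\<lambda>z. c z * of_real (exp (- z * s))) has_sum 0) ?Z" if "s \<ge> A" for s
    using has_sum_fibers[OF sms'[OF that], of x] unfolding fiber zero[OF that] .
  have cA: "(\<lambda>z. norm (c z) * exp (- z * A)) summable_on ?Z"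
    using has_sum_imp_summable[OF cs[OF order.refl], unfolded summable_on_iff_abs_summable_on_complex]
    by (simp add: norm_mult)
  define R where "R = ?Z \<inter> {y0<..}"
  obtain \<delta> where \<delta>: "\<delta> > 0" "\<And>z. z \<in> R \<Longrightarrow> z \<ge> y0 + \<delta>"
  proof -
    let ?R1 = "insert (y0 + 1) (?Z \<inter> {..y0 + 1} \<inter> {y0<..})"
    have f1: "finite ?R1" "?R1 \<noteq> {}" using fin[of "y0 + 1"] by auto
    show ?thesis
    proof (rule that)
      show "Min ?R1 - y0 > 0" using f1 by (subst diff_gt_0_iff_gt, subst Min_gr_iff) auto
      fix z assume "z \<in> R"
      then have "Min ?R1 \<le> min z (y0 + 1)"
        unfolding R_def using f1 by (cases "z \<le> y0 + 1") (auto intro!: Min_le simp: min_def)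
      then show "z \<ge> y0 + (Min ?R1 - y0)" by simp
    qed
  qed
  have RA: "(\<lambda>z. norm (c z) * exp (- (z - y0) * A)) summable_on R"
  proof -
    have "(\<lambda>z. norm (c z) * exp (- z * A) * exp (y0 * A)) summable_on R"
      by (intro summable_on_cmult_left summable_on_subset[OF cA]) (auto simp: R_def)
    then show ?thesis
      by (rule summable_on_cong[THEN iffD1, rotated]) (simp add: exp_add[symmetric] algebra_simps)
  qed
  define K where "K = (\<Sum>\<^sub>\<infinity>z\<in>R. norm (c z) * exp (- (z - y0) * A))"
  have "K \<ge> 0" unfolding K_def by (intro infsum_nonneg) auto
  have bound: "norm (c y0) \<le> exp (- \<delta> * (s - A)) * K" if s: "s \<ge> A" for s
  proof -
    have d: "z - y0 \<ge> \<delta>" if "z \<in> R" for z using \<delta>(2)[OF that] by simp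
    note dec = exp_sum_decay[OF RA d s]
    have "((\<lambda>z. c z * of_real (exp (- z * s)) * of_real (exp (y0 * s))) has_sum 0 * of_real (exp (y0 * s))) ?Z"
      by (rule has_sum_cmult_left[OF cs[OF s]])
    moreover have "c z * of_real (exp (- z * s)) * of_real (exp (y0 * s)) = c z * of_real (exp (- (z - y0) * s))" for z
      by (simp add: left_diff_distrib exp_add[symmetric] flip: of_real_mult exp_of_real)
    ultimately have "((\<lambda>z. c z * of_real (exp (- (z - y0) * s))) has_sum 0) ?Z"
      by (simp only: mult_zero_left)
    also have "?this \<longleftrightarrow> ((\<lambda>z. c z * of_real (exp (- (z - y0) * s))) has_sum 0) (insert y0 R)"
      by (rule has_sum_cong_neutral) (use small y0 in \<open>auto simp: R_def\<close>)
    finally have 1: "((\<lambda>z. c z * of_real (exp (- (z - y0) * s))) has_sum 0) (insert y0 R)" .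
    have abs: "(\<lambda>z. norm (c z * of_real (exp (- (z - y0) * s)))) summable_on R"
      using dec(1) by (simp add: norm_mult)
    have "(\<Sum>\<^sub>\<infinity>z\<in>insert y0 R. c z * of_real (exp (- (z - y0) * s)))
        = c y0 * of_real (exp (- (y0 - y0) * s)) + (\<Sum>\<^sub>\<infinity>z\<in>R. c z * of_real (exp (- (z - y0) * s)))"
      by (rule infsum_insert) (use abs_summable_summable[OF abs] in \<open>auto simp: R_def\<close>)
    then have "c y0 = - (\<Sum>\<^sub>\<infinity>z\<in>R. c z * of_real (exp (- (z - y0) * s)))"
      using infsumI[OF 1] by (simp add: eq_neg_iff_add_eq_0)
    then have "norm (c y0) = norm (\<Sum>\<^sub>\<infinity>z\<in>R. c z * of_real (exp (- (z - y0) * s)))" by simp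
    also have "\<dots> \<le> (\<Sum>\<^sub>\<infinity>z\<in>R. norm (c z * of_real (exp (- (z - y0) * s))))"
      by (rule norm_infsum_bound[OF abs])
    also have "\<dots> = (\<Sum>\<^sub>\<infinity>z\<in>R. norm (c z) * exp (- (z - y0) * s))"
      by (simp add: norm_mult)
    also have "\<dots> \<le> exp (- \<delta> * (s - A)) * K"
      using dec(2) by (simp add: K_def)
    finally show ?thesis .
  qed
  \<comment> \<open>At \<open>s = A + u / \<delta>\<close> the bound reads \<open>exp u \<le> u\<close>, which is impossible.\<close>
  define u where "u = K / norm (c y0)"
  have "u \<ge> 0" using \<open>K \<ge> 0\<close> by (simp add: u_def)
  have "norm (c y0) \<le> exp (- \<delta> * ((A + u / \<delta>) - A)) * K"
    by (rule bound) (use \<open>u \<ge> 0\<close> \<delta>(1) in auto)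
  also have "\<dots> = exp (- u) * (u * norm (c y0))" using \<delta>(1) y0(2) by (simp add: u_def)
  finally have "1 * norm (c y0) \<le> exp (- u) * u * norm (c y0)" by simp
  then have "1 \<le> exp (- u) * u"
    using y0(2) by (subst (asm) mult_le_cancel_right) auto
  then have "exp u \<le> u" by (simp add: exp_minus field_simps)
  then show False using exp_ge_add_one_self[of u] by simp
qed

lemma has_sum_Plus:
  fixes f :: "'i + 'j \<Rightarrow> 'b :: topological_comm_monoid_add"
  assumes "((\<lambda>i. f (Inl i)) has_sum a) I" "((\<lambda>j. f (Inr j)) has_sum b) J"
  shows "(f has_sum (a + b)) (I <+> J)"
  unfolding Plus_def
  by (intro has_sum_Un_disjoint)
     (use assms in \<open>auto simp: has_sum_reindex o_def\<close>)

text \<open>By uniqueness, the difference of the two sums, indexed by a disjoint union, has mass \<open>0\<close> at every frequency;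
  it therefore vanishes against any function for which the sums converge absolutely.\<close>

lemma exp_sums_agree:
  fixes \<gamma> :: "'i \<Rightarrow> complex" and x :: "'i \<Rightarrow> real" and \<eta> :: "'j \<Rightarrow> complex" and y :: "'j \<Rightarrow> real"
  assumes sm1: "(\<lambda>i. norm (\<gamma> i) * exp (- x i * A)) summable_on I"
    and sm2: "(\<lambda>j. norm (\<eta> j) * exp (- y j * A)) summable_on J"
    and pos1: "\<And>i. i \<in> I \<Longrightarrow> x i \<ge> 0" and pos2: "\<And>j. j \<in> J \<Longrightarrow> y j \<ge> 0"
    and fin1: "\<And>B. finite (x ` I \<inter> {..B})" and fin2: "\<And>B. finite (y ` J \<inter> {..B})"
    and eq: "\<And>s. s \<ge> A \<Longrightarrow> (\<Sum>\<^sub>\<infinity>i\<in>I. \<gamma> i * of_real (exp (- x i * s)))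
                          = (\<Sum>\<^sub>\<infinity>j\<in>J. \<eta> j * of_real (exp (- y j * s)))"
    and \<phi>: "\<And>t. t \<ge> 0 \<Longrightarrow> norm (\<phi> t) \<le> C * exp (- A * t)"
  shows "(\<Sum>\<^sub>\<infinity>i\<in>I. \<gamma> i * \<phi> (x i)) = (\<Sum>\<^sub>\<infinity>j\<in>J. \<eta> j * \<phi> (y j))"
proof -
  define g where "g = case_sum \<gamma> (\<lambda>j. - \<eta> j)"
  define z where "z = case_sum x y"
  let ?K = "I <+> J"
  have zpos: "z k \<ge> 0" if "k \<in> ?K" for k
    using that pos1 pos2 by (auto simp: z_def)
  have smK: "(\<lambda>k. norm (g k) * exp (- z k * A)) summable_on ?K"
    unfolding summable_on_def
    by (rule exI, rule has_sum_Plus[OF has_sum_infsum has_sum_infsum])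
       (use sm1 sm2 in \<open>auto simp: g_def z_def\<close>)
  have comb: "(\<Sum>\<^sub>\<infinity>k\<in>?K. g k * \<psi> (z k)) = (\<Sum>\<^sub>\<infinity>i\<in>I. \<gamma> i * \<psi> (x i)) - (\<Sum>\<^sub>\<infinity>j\<in>J. \<eta> j * \<psi> (y j))"
    if \<psi>: "\<And>t. t \<ge> 0 \<Longrightarrow> norm (\<psi> t) \<le> C * exp (- A * t)" for \<psi> C
  proof -
    have 1: "(\<lambda>i. \<gamma> i * \<psi> (x i)) summable_on I"
    proof (rule abs_summable_summable, rule Infinite_Sum.abs_summable_on_comparison_test')
      show "(\<lambda>i. C * (norm (\<gamma> i) * exp (- x i * A))) summable_on I"
        by (intro summable_on_cmult_right sm1)
      show "norm (\<gamma> i * \<psi> (x i)) \<le> C * (norm (\<gamma> i) * exp (- x i * A))" if "i \<in> I" for i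
        using mult_left_mono[OF \<psi>[OF pos1[OF that]], of "norm (\<gamma> i)"] by (simp add: norm_mult mult_ac)
    qed
    have 2: "(\<lambda>j. \<eta> j * \<psi> (y j)) summable_on J"
    proof (rule abs_summable_summable, rule Infinite_Sum.abs_summable_on_comparison_test')
      show "(\<lambda>j. C * (norm (\<eta> j) * exp (- y j * A))) summable_on J"
        by (intro summable_on_cmult_right sm2)
      show "norm (\<eta> j * \<psi> (y j)) \<le> C * (norm (\<eta> j) * exp (- y j * A))" if "j \<in> J" for j
        using mult_left_mono[OF \<psi>[OF pos2[OF that]], of "norm (\<eta> j)"] by (simp add: norm_mult mult_ac)
    qed
    have "((\<lambda>k. g k * \<psi> (z k)) has_sum ((\<Sum>\<^sub>\<infinity>i\<in>I. \<gamma> i * \<psi> (x i)) + - (\<Sum>\<^sub>\<infinity>j\<in>J. \<eta> j * \<psi> (y j)))) ?K"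
      by (rule has_sum_Plus) (use 1 2 in \<open>auto simp: g_def z_def has_sum_uminus\<close>)
    then show ?thesis by (simp add: infsumI)
  qed
  have fib0: "(\<Sum>\<^sub>\<infinity>k\<in>{k\<in>?K. z k = t}. g k) = 0" for t
  proof (rule exp_sum_unique[OF smK zpos])
    fix B
    have "z ` ?K \<inter> {..B} = (x ` I \<inter> {..B}) \<union> (y ` J \<inter> {..B})"
      by (auto simp: z_def Plus_def image_Un image_image)
    then show "finite (z ` ?K \<inter> {..B})" using fin1 fin2 by simp
  next
    fix s assume s: "s \<ge> A"
    have "(\<Sum>\<^sub>\<infinity>k\<in>?K. g k * of_real (exp (- z k * s)))
        = (\<Sum>\<^sub>\<infinity>i\<in>I. \<gamma> i * of_real (exp (- x i * s))) - (\<Sum>\<^sub>\<infinity>j\<in>J. \<eta> j * of_real (exp (- y j * s)))"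
    proof (rule comb[where C = 1])
      fix t :: real assume "t \<ge> 0"
      then have "A * t \<le> s * t" using s by (intro mult_right_mono)
      then show "norm (complex_of_real (exp (- t * s))) \<le> 1 * exp (- A * t)"
        by (simp add: mult.commute)
    qed
    then show "(\<Sum>\<^sub>\<infinity>k\<in>?K. g k * of_real (exp (- z k * s))) = 0" using eq[OF s] by simp
  qed
  have smphi: "(\<lambda>k. g k * \<phi> (z k)) summable_on ?K"
  proof (rule abs_summable_summable, rule Infinite_Sum.abs_summable_on_comparison_test')
    show "(\<lambda>k. C * (norm (g k) * exp (- z k * A))) summable_on ?K"
      by (intro summable_on_cmult_right smK)
    show "norm (g k * \<phi> (z k)) \<le> C * (norm (g k) * exp (- z k * A))" if "k \<in> ?K" for k
      using mult_left_mono[OF \<phi>[OF zpos[OF that]], of "norm (g k)"] by (simp add: norm_mult mult_ac)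
  qed
  have "(\<Sum>\<^sub>\<infinity>k\<in>{k\<in>?K. z k = t}. g k * \<phi> (z k)) = 0" for t
  proof -
    have "(\<Sum>\<^sub>\<infinity>k\<in>{k\<in>?K. z k = t}. g k * \<phi> (z k)) = (\<Sum>\<^sub>\<infinity>k\<in>{k\<in>?K. z k = t}. g k * \<phi> t)"
      by (intro infsum_cong) auto
    also have "\<dots> = 0" using fib0[of t] by (simp add: infsum_cmult_left')
    finally show ?thesis .
  qed
  then have "(\<Sum>\<^sub>\<infinity>k\<in>?K. g k * \<phi> (z k)) = 0"
    using has_sum_fibers[OF smphi, of z] by (auto dest: has_sum_unique[OF has_sum_0_simp])
  then show ?thesis using comb[OF \<phi>] by simp
qed

section \<open>Exponentials and logarithms of Dirichlet series\<close>

text \<open>The enumeration is the inverse of the rank function \<open>x \<mapsto> card (S \<inter> {..<x})\<close>, whose image is an initial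
  segment of the natural numbers.\<close>

lemma increasing_enumeration:
  fixes S :: "real set"
  assumes fin: "\<And>B. finite (S \<inter> {..B})" and pos: "\<And>x. x \<in> S \<Longrightarrow> x > 0"
  obtains N l where "frequencies N l" "bij_betw l (idx N) S"
proof -
  define r where "r x = card (S \<inter> {..<x})" for x
  have finl: "finite (S \<inter> {..<x})" for x
    by (rule finite_subset[OF _ fin[of x]]) auto
  have mono: "r x < r y" if "x \<in> S" "x < y" for x y
    unfolding r_def using that by (intro psubset_card_mono finl) auto
  then have inj: "inj_on r S"
    by (metis inj_onI less_irrefl linorder_neq_iff)
  have down: "m \<in> r ` S" if "y \<in> S" "m < r y" for y m
    using that
  proof (induction "r y" arbitrary: y rule: less_induct)
    case less
    let ?T = "S \<inter> {..<y}"
    have T: "finite ?T" "?T \<noteq> {}" using finl less.prems(2) by (auto simp: r_def card_gt_0_iff)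
    define x where "x = Max ?T"
    have x: "x \<in> S" "x < y" using Max_in[OF T] by (auto simp: x_def)
    have "?T = insert x (S \<inter> {..<x})"
      using x Max_ge[OF T(1)] by (auto simp: x_def[symmetric] less_le)
    then have "r y = Suc (r x)" using finl by (simp add: r_def)
    then show ?case using less.hyps[OF _ x(1), of] less.prems(2) x(1) by (cases "m = r x") auto
  qed
  obtain N where N: "r ` S = idx N"
  proof (cases "r ` S = UNIV")
    case True
    then show ?thesis using that[of \<infinity>] by (simp add: idx_def)
  next
    case False
    define k where "k = (LEAST n. n \<notin> r ` S)"
    have k: "k \<notin> r ` S" using False LeastI_ex[of "\<lambda>n. n \<notin> r ` S"] by (auto simp: k_def)
    have "n \<in> r ` S \<longleftrightarrow> n < k" for n
    proof
      assume n: "n \<in> r ` S"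
      show "n < k"
      proof (rule ccontr)
        assume "\<not> n < k"
        then have "k = n \<or> k < n" by auto
        then show False using n k down by auto
      qed
    next
      assume "n < k" then show "n \<in> r ` S" using not_less_Least[of n "\<lambda>n. n \<notin> r ` S"] by (auto simp: k_def)
    qed
    then show ?thesis using that[of "enat k"] by (auto simp: idx_def)
  qed
  define l where "l = the_inv_into S r"
  have bij: "bij_betw l (idx N) S"
    unfolding l_def N[symmetric] by (intro bij_betw_the_inv_into inj_on_imp_bij_betw inj)
  have rl: "r (l n) = n" if "n \<in> idx N" for n
    using that f_the_inv_into_f[OF inj, of n] N by (simp add: l_def)
  have lS: "l n \<in> S" if "n \<in> idx N" for n using bij that by (auto simp: bij_betw_def)
  have "strict_mono_on (idx N) l"
  proof (rule strict_mono_onI)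
    fix m n assume mn: "m \<in> idx N" "n \<in> idx N" "m < n"
    show "l m < l n"
    proof (rule ccontr)
      assume "\<not> l m < l n"
      then have "l n = l m \<or> l n < l m" by auto
      then have "r (l n) = r (l m) \<or> r (l n) < r (l m)"
        using mono[OF lS[OF mn(2)], of "l m"] by auto
      then show False using mn(3) by (simp add: rl mn(1,2))
    qed
  qed
  moreover have "filterlim l at_top sequentially" if "N = \<infinity>"
    unfolding filterlim_at_top_dense
  proof
    fix B
    have id: "idx N = UNIV" using that by (simp add: idx_def)
    have "finite {n. l n \<le> B}"
    proof (rule inj_on_finite[OF _ _ fin[of B]])
      show "inj_on l {n. l n \<le> B}" using bij id by (auto simp: bij_betw_def intro: inj_on_subset)
      show "l ` {n. l n \<le> B} \<subseteq> S \<inter> {..B}" using lS id by auto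
    qed
    then show "eventually (\<lambda>n. B < l n) sequentially"
      unfolding cofinite_eq_sequentially[symmetric] eventually_cofinite by (simp add: not_less)
  qed
  ultimately have "frequencies N l"
    unfolding frequencies_def using lS pos by auto
  then show ?thesis using that bij by blast
qed

lemma sum_list_map_count:
  fixes l :: "'i \<Rightarrow> real"
  assumes "finite S" "set w \<subseteq> S"
  shows "sum_list (map l w) = (\<Sum>j\<in>S. l j * real (count (mset w) j))"
  using assms(2)
proof (induction w)
  case (Cons i w)
  have "(\<Sum>j\<in>S. l j * real (count (mset (i # w)) j))
      = (\<Sum>j\<in>S. l j * real (count (mset w) j) + (if j = i then l j else 0))"
    by (intro sum.cong) (auto simp: algebra_simps)
  also have "\<dots> = (\<Sum>j\<in>S. l j * real (count (mset w) j)) + l i"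
    using Cons.prems \<open>finite S\<close> by (simp add: sum.distrib)
  finally show ?case using Cons by simp
qed auto

lemma prod_list_map_count:
  fixes a :: "'i \<Rightarrow> 'b :: comm_monoid_mult"
  shows "prod_list (map a w) = (\<Prod>j\<in>set w. a j ^ count (mset w) j)"
proof -
  have "prod_list (map a w) = prod_mset (image_mset a (mset w))"
    by (simp flip: prod_mset_prod_list)
  then show ?thesis by (simp add: image_prod_mset_multiplicity)
qed

text \<open>Non-zero finitely supported sequences are the nonempty multisets of indices, and these are the words up to
  permutation of their letters.\<close>

lemma bij_count_Lambda_set:
  "bij_betw count {M. set_mset M \<subseteq> idx N \<and> M \<noteq> {#}} (Lambda_set N)"
  unfolding bij_betw_def
proof
  show "inj_on count {M. set_mset M \<subseteq> idx N \<and> M \<noteq> {#}}"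
    by (auto intro!: inj_onI simp: multiset_eq_iff)
  show "count ` {M. set_mset M \<subseteq> idx N \<and> M \<noteq> {#}} = Lambda_set N"
  proof (intro equalityI subsetI)
    fix k assume "k \<in> count ` {M. set_mset M \<subseteq> idx N \<and> M \<noteq> {#}}"
    then obtain M where M: "k = count M" "set_mset M \<subseteq> idx N" "M \<noteq> {#}" by auto
    have "{j. k j \<noteq> 0} = set_mset M" by (auto simp: M(1))
    moreover have "set_mset M \<noteq> {}" using M(3) by simp
    ultimately show "k \<in> Lambda_set N" unfolding Lambda_set_def mem_Collect_eq using M(2) by (metis finite_set_mset)
  next
    fix k assume k: "k \<in> Lambda_set N"
    then have fin: "finite {j. 0 < k j}" by (simp add: Lambda_set_def)
    have c: "count (Abs_multiset k) = k" using fin by (simp add: count_Abs_multiset)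
    then have "set_mset (Abs_multiset k) = {j. k j \<noteq> 0}"
      by (auto simp: set_mset_def)
    then have "Abs_multiset k \<in> {M. set_mset M \<subseteq> idx N \<and> M \<noteq> {#}}"
      using k by (auto simp: Lambda_set_def)
    then show "k \<in> count ` {M. set_mset M \<subseteq> idx N \<and> M \<noteq> {#}}"
      using c by (metis imageI)
  qed
qed

text \<open>A multiset \<open>M\<close> is the multiset of letters of \<open>fact (size M) / (\<Prod>j. fact (count M j))\<close> words, which is the
  multinomial coefficient in \<^const>\<open>log_coeff\<close>. Hence the sum over multi-indices equals a sum over words
  with the plain coefficients of the logarithm.\<close>

lemma frequency_term_over_words:
  fixes a :: "nat \<Rightarrow> complex" and l :: "nat \<Rightarrow> real"
  defines "F \<equiv> \<lambda>\<phi> w. (-1) ^ length w / of_nat (length w) * prod_list (map a w)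
                 * (of_real (sum_list (map l w)) * \<phi> (sum_list (map l w)) :: complex)"
  assumes sm: "F \<phi> summable_on lists (idx N) - {[]}"
  shows "frequency_term N l a \<phi> = (\<Sum>\<^sub>\<infinity>w\<in>lists (idx N) - {[]}. F \<phi> w)"
proof -
  let ?W = "lists (idx N) - {[]}" and ?Ms = "{M. set_mset M \<subseteq> idx N \<and> M \<noteq> {#}}"
  have im: "mset ` ?W = ?Ms"
  proof (intro equalityI subsetI)
    fix M assume M: "M \<in> ?Ms"
    obtain w where "M = mset w" using ex_mset by metis
    then show "M \<in> mset ` ?W" using M by auto
  qed auto
  have fib: "(\<Sum>\<^sub>\<infinity>w\<in>{w\<in>?W. mset w = M}. F \<phi> w)
      = of_real (pairing l (count M)) * log_coeff a (count M) * delta (pairing l (count M)) \<phi>"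
    if "M \<in> ?Ms" for M
  proof -
    have eq: "{w\<in>?W. mset w = M} = permutations_of_multiset M"
      using that by (auto simp: permutations_of_multiset_def)
    have supp: "{j. count M j \<noteq> 0} = set_mset M" by auto
    define c where "c = (-1) ^ size M / of_nat (size M) * (\<Prod>j\<in>set_mset M. a j ^ count M j)
        * (of_real (pairing l (count M)) * \<phi> (pairing l (count M)))"
    have Fc: "F \<phi> w = c" if "w \<in> permutations_of_multiset M" for w
    proof -
      have w: "mset w = M" using that by (simp add: permutations_of_multiset_def)
      then have "length w = size M" "set w = set_mset M" by auto
      moreover have "sum_list (map l w) = pairing l (count M)"
        using sum_list_map_count[of "set_mset M" w l] w by (simp add: pairing_def supp \<open>set w = set_mset M\<close>)
      ultimately show ?thesis
        by (simp add: F_def c_def prod_list_map_count w)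
    qed
    have size: "multi_size (count M) = size M"
      by (simp add: multi_size_def supp size_multiset_overloaded_eq)
    have "of_nat (card (permutations_of_multiset M)) * (\<Prod>j\<in>set_mset M. fact (count M j))
        = (fact (size M) :: complex)"
      using arg_cong[OF card_permutations_of_multiset_aux[of M], of "of_nat :: nat \<Rightarrow> complex"] by simp
    moreover have "(\<Prod>j\<in>set_mset M. fact (count M j)) \<noteq> (0::complex)" by simp
    ultimately have card: "of_nat (card (permutations_of_multiset M))
        = (fact (size M) :: complex) / (\<Prod>j\<in>set_mset M. fact (count M j))"
      by (simp add: field_simps)
    have "(\<Sum>\<^sub>\<infinity>w\<in>{w\<in>?W. mset w = M}. F \<phi> w) = (\<Sum>w\<in>permutations_of_multiset M. F \<phi> w)"
      unfolding eq by (rule infsum_finite) simp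
    also have "\<dots> = of_nat (card (permutations_of_multiset M)) * c"
      by (simp add: Fc)
    also have "\<dots> = of_real (pairing l (count M)) * log_coeff a (count M) * delta (pairing l (count M)) \<phi>"
      unfolding card c_def log_coeff_def size supp delta_def by (simp only: divide_inverse mult_ac)
    finally show ?thesis .
  qed
  have "(\<Sum>\<^sub>\<infinity>w\<in>?W. F \<phi> w) = (\<Sum>\<^sub>\<infinity>M\<in>?Ms. \<Sum>\<^sub>\<infinity>w\<in>{w\<in>?W. mset w = M}. F \<phi> w)"
    using infsumI[OF has_sum_fibers[OF sm, of mset]] by (simp only: im)
  also have "\<dots> = (\<Sum>\<^sub>\<infinity>M\<in>?Ms. of_real (pairing l (count M)) * log_coeff a (count M) * delta (pairing l (count M)) \<phi>)"
    by (intro infsum_cong fib)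
  also have "\<dots> = frequency_term N l a \<phi>"
    unfolding frequency_term_def by (rule infsum_reindex_bij_betw[OF bij_count_Lambda_set])
  finally show ?thesis by simp
qed

lemma exp_sum_small:
  fixes \<gamma> :: "nat \<Rightarrow> complex" and l :: "nat \<Rightarrow> real"
  assumes fr: "frequencies N l"
    and sm: "(\<lambda>n. norm (\<gamma> n) * exp (- l n * A)) summable_on idx N" and "\<epsilon> > 0"
  shows "eventually (\<lambda>s. (\<Sum>\<^sub>\<infinity>n\<in>idx N. norm (\<gamma> n) * exp (- l n * s)) < \<epsilon>) at_top"
proof -
  obtain \<delta> where \<delta>: "\<delta> > 0" "\<And>n. n \<in> idx N \<Longrightarrow> l n \<ge> \<delta>"
    using frequencies_lower_bound[OF fr] by blast
  define K where "K = (\<Sum>\<^sub>\<infinity>n\<in>idx N. norm (\<gamma> n) * exp (- l n * A))"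
  have "filterlim (\<lambda>s. - \<delta> * (s - A)) at_bot at_top"
  proof -
    have "filterlim (\<lambda>s. \<delta> * (- A + s)) at_top at_top"
      by (intro filterlim_tendsto_pos_mult_at_top[OF tendsto_const \<delta>(1)]
            filterlim_tendsto_add_at_top[OF tendsto_const filterlim_ident])
    then show ?thesis by (simp add: filterlim_uminus_at_bot)
  qed
  then have "((\<lambda>s. exp (- \<delta> * (s - A))) \<longlongrightarrow> 0) at_top"
    by (rule filterlim_compose[OF exp_at_bot])
  then have "((\<lambda>s. exp (- \<delta> * (s - A)) * K) \<longlongrightarrow> 0 * K) at_top"
    by (intro tendsto_mult tendsto_const)
  then have "eventually (\<lambda>s. exp (- \<delta> * (s - A)) * K < \<epsilon>) at_top"
    using \<open>\<epsilon> > 0\<close> by (intro order_tendstoD) auto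
  then show ?thesis
    using eventually_ge_at_top[of A]
  proof eventually_elim
    case (elim s)
    then show ?case using exp_sum_decay(2)[OF sm \<delta>(2), of s] by (simp add: K_def)
  qed
qed

lemma prod_list_exp_weights:
  fixes \<beta> :: "'i \<Rightarrow> complex" and l :: "'i \<Rightarrow> real"
  shows "prod_list (map (\<lambda>n. \<beta> n * exp (- of_real (l n) * s)) w)
       = prod_list (map \<beta> w) * exp (- of_real (sum_list (map l w)) * s)"
  by (induction w) (auto simp: exp_add[symmetric] algebra_simps)

text \<open>The exponential is a sum over all words; the empty word contributes the constant term \<open>1\<close>, and the others are
  collected by frequency. Absolute convergence of the collected series is inherited from the sum over words.\<close>

lemma exp_minus_dirichlet_series:
  fixes \<beta> :: "nat \<Rightarrow> complex" and f :: "complex \<Rightarrow> complex"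
  assumes fr: "frequencies N \<mu>"
    and sm: "(\<lambda>n. norm (\<beta> n) * exp (- \<mu> n * A)) summable_on idx N"
    and f: "\<And>s. Re s \<ge> A \<Longrightarrow> f s = exp (- (\<Sum>\<^sub>\<infinity>n\<in>idx N. \<beta> n * exp (- of_real (\<mu> n) * s)))"
  obtains N' l a where "dirichlet_series N' l a f"
proof -
  let ?W = "lists (idx N) - {[]}"
  define wt where "wt w = sum_list (map \<mu> w)" for w
  define \<kappa> where "\<kappa> w = (-1) ^ length w / fact (length w) * prod_list (map \<beta> w)" for w
  have pos: "\<mu> n \<ge> 0" if "n \<in> idx N" for n using fr that by (auto simp: frequencies_def intro: less_imp_le)
  have all: "(\<lambda>w. norm (\<kappa> w * exp (- of_real (wt w) * s))) summable_on ?W"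
       "((\<lambda>w. \<kappa> w * exp (- of_real (wt w) * s)) has_sum (f s - 1)) ?W" if s: "Re s \<ge> A" for s
  proof -
    let ?g = "\<lambda>n. \<beta> n * exp (- of_real (\<mu> n) * s)" and ?\<gamma> = "\<lambda>m. (-1) ^ m / fact m :: complex"
    have g: "(\<lambda>n. norm (?g n)) summable_on idx N"
      using exp_sum_decay(1)[OF sm pos s] by (simp add: norm_mult)
    have "summable (\<lambda>m. norm (?\<gamma> m) * infsum (\<lambda>n. norm (?g n)) (idx N) ^ m)"
      using summable_exp[of "infsum (\<lambda>n. norm (?g n)) (idx N)"]
      by (simp add: norm_mult norm_inverse norm_power divide_inverse)
    note ps = power_series_over_words[OF g this]
    have eq: "?\<gamma> (length w) * prod_list (map ?g w) = \<kappa> w * exp (- of_real (wt w) * s)" for w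
      unfolding \<kappa>_def wt_def prod_list_exp_weights by simp
    have "(\<lambda>m. ?\<gamma> m * z ^ m) sums exp (- z)" for z
      using exp_converges[of "- z"]
      by (simp add: scaleR_conv_of_real power_minus[of z] divide_inverse mult_ac)
    from this[of "infsum ?g (idx N)"] have "(\<Sum>m. ?\<gamma> m * infsum ?g (idx N) ^ m) = f s"
      using f[OF s] by (simp add: sums_iff)
    then have full: "((\<lambda>w. \<kappa> w * exp (- of_real (wt w) * s)) has_sum f s) (lists (idx N))"
      using ps(2) unfolding eq by simp
    have ins: "lists (idx N) = insert [] ?W" by auto
    show "(\<lambda>w. norm (\<kappa> w * exp (- of_real (wt w) * s))) summable_on ?W"
      using ps(1) unfolding eq by (rule summable_on_subset) auto
    then have S: "(\<lambda>w. \<kappa> w * exp (- of_real (wt w) * s)) summable_on ?W"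
      by (rule abs_summable_summable)
    have "f s = \<kappa> [] * exp (- of_real (wt []) * s) + (\<Sum>\<^sub>\<infinity>w\<in>?W. \<kappa> w * exp (- of_real (wt w) * s))"
      using infsum_insert[OF S, of "[]"] infsumI[OF full] ins by simp
    then have "(\<Sum>\<^sub>\<infinity>w\<in>?W. \<kappa> w * exp (- of_real (wt w) * s)) = f s - 1"
      by (simp add: \<kappa>_def wt_def)
    then show "((\<lambda>w. \<kappa> w * exp (- of_real (wt w) * s)) has_sum (f s - 1)) ?W"
      using S by (simp add: has_sum_iff)
  qed
  have fin: "finite (wt ` ?W \<inter> {..B})" for B
  proof -
    have "wt ` ?W \<inter> {..B} \<subseteq> wt ` {w \<in> lists (idx N). sum_list (map \<mu> w) \<le> B}"
      by (auto simp: wt_def)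
    then show ?thesis using finite_words_below[OF fr] finite_subset by blast
  qed
  have wpos: "x > 0" if "x \<in> wt ` ?W" for x
    using that word_weight_pos[OF fr] by (auto simp: wt_def)
  obtain N' l where l: "frequencies N' l" "bij_betw l (idx N') (wt ` ?W)"
    using increasing_enumeration[OF fin wpos] by blast
  define c where "c z = (\<Sum>\<^sub>\<infinity>w\<in>{w\<in>?W. wt w = z}. \<kappa> w)" for z
  have series: "((\<lambda>n. c (l n) * exp (- of_real (l n) * s)) has_sum (f s - 1)) (idx N')" if s: "Re s \<ge> A" for s
  proof -
    have "(\<Sum>\<^sub>\<infinity>w\<in>{w\<in>?W. wt w = z}. \<kappa> w * exp (- of_real (wt w) * s)) = c z * exp (- of_real z * s)" for z
    proof -
      have "(\<Sum>\<^sub>\<infinity>w\<in>{w\<in>?W. wt w = z}. \<kappa> w * exp (- of_real (wt w) * s))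
          = (\<Sum>\<^sub>\<infinity>w\<in>{w\<in>?W. wt w = z}. \<kappa> w * exp (- of_real z * s))"
        by (intro infsum_cong) auto
      then show ?thesis unfolding c_def by (simp add: infsum_cmult_left')
    qed
    then have "((\<lambda>z. c z * exp (- of_real z * s)) has_sum (f s - 1)) (wt ` ?W)"
      using has_sum_fibers[OF has_sum_imp_summable[OF all(2)[OF s]], of wt] infsumI[OF all(2)[OF s]] by simp
    then show ?thesis
      using has_sum_reindex_bij_betw[OF l(2), of "\<lambda>z. c z * exp (- of_real z * s)"] by simp
  qed
  have nsm: "(\<lambda>n. norm (c (l n) * exp (- of_real (l n) * s))) summable_on idx N'" if s: "Re s \<ge> A" for s
    using has_sum_imp_summable[OF series[OF s]] unfolding summable_on_iff_abs_summable_on_complex .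
  show ?thesis
  proof (rule that[of N' l "\<lambda>n. c (l n)"])
    show "dirichlet_series N' l (\<lambda>n. c (l n)) f"
      unfolding dirichlet_series_def
      using l(1) nsm infsumI[OF series] by (intro conjI exI[of _ A]) auto
  qed
qed

text \<open>The logarithmic series converges since the sum of absolute values is below \<open>1\<close>. The coefficient of the empty
  word is \<open>1 / 0 = 0\<close>, so leaving it out does not change the sum.\<close>

lemma log_dirichlet_series_over_words:
  fixes a :: "nat \<Rightarrow> complex" and l :: "nat \<Rightarrow> real"
  assumes sm: "(\<lambda>n. norm (a n) * exp (- l n * Re s)) summable_on idx N"
    and small: "(\<Sum>\<^sub>\<infinity>n\<in>idx N. norm (a n) * exp (- l n * Re s)) < 1"
  defines "\<kappa> \<equiv> \<lambda>w. (-1) ^ length w / of_nat (length w) * prod_list (map a w)"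
  shows "(\<lambda>w. norm (\<kappa> w) * exp (- sum_list (map l w) * Re s)) summable_on lists (idx N) - {[]}"
    and "((\<lambda>w. \<kappa> w * exp (- of_real (sum_list (map l w)) * s)) has_sum
            - ln (1 + (\<Sum>\<^sub>\<infinity>n\<in>idx N. a n * exp (- of_real (l n) * s)))) (lists (idx N) - {[]})"
proof -
  let ?g = "\<lambda>n. a n * exp (- of_real (l n) * s)" and ?\<gamma> = "\<lambda>m. (-1) ^ m / of_nat m :: complex"
  have g: "(\<lambda>n. norm (?g n)) summable_on idx N" using sm by (simp add: norm_mult)
  define r where "r = infsum (\<lambda>n. norm (?g n)) (idx N)"
  have r: "r < 1" "r \<ge> 0" using small by (auto simp: r_def norm_mult intro: infsum_nonneg)
  have sr: "summable (\<lambda>m. norm (?\<gamma> m) * r ^ m)"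
  proof (rule summable_comparison_test[OF _ summable_geometric[of r]])
    show "\<exists>N. \<forall>n\<ge>N. norm (norm (?\<gamma> n) * r ^ n) \<le> r ^ n"
    proof (intro exI allI impI)
      fix n :: nat
      have "norm (?\<gamma> n) \<le> 1"
        by (cases "n = 0") (auto simp: norm_divide norm_power)
      then show "norm (norm (?\<gamma> n) * r ^ n) \<le> r ^ n"
        using mult_right_mono[of "norm (?\<gamma> n)" 1 "r ^ n"] r by (simp add: norm_mult)
    qed
  qed (use r in auto)
  note ps = power_series_over_words[OF g sr[unfolded r_def]]
  have eq: "?\<gamma> (length w) * prod_list (map ?g w) = \<kappa> w * exp (- of_real (sum_list (map l w)) * s)" for w
    unfolding \<kappa>_def prod_list_exp_weights by simp
  let ?u = "infsum ?g (idx N)"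
  have "norm ?u < 1" using norm_infsum_bound[OF g] r by (simp add: r_def)
  from sums_minus[OF Ln_series[OF this]]
  have "(\<Sum>m. ?\<gamma> m * ?u ^ m) = - ln (1 + ?u)" by (simp add: sums_iff)
  then have full: "((\<lambda>w. \<kappa> w * exp (- of_real (sum_list (map l w)) * s)) has_sum - ln (1 + ?u)) (lists (idx N))"
    using ps(2) unfolding eq by simp
  show "((\<lambda>w. \<kappa> w * exp (- of_real (sum_list (map l w)) * s)) has_sum - ln (1 + ?u)) (lists (idx N) - {[]})"
    by (rule has_sum_cong_neutral[THEN iffD1, OF _ _ _ full]) (auto simp: \<kappa>_def)
  have "(\<lambda>w. norm (\<kappa> w * exp (- of_real (sum_list (map l w)) * s))) summable_on lists (idx N) - {[]}"
    using ps(1) unfolding eq by (rule summable_on_subset) auto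
  then show "(\<lambda>w. norm (\<kappa> w) * exp (- sum_list (map l w) * Re s)) summable_on lists (idx N) - {[]}"
    by (simp add: norm_mult)
qed

text \<open>Far enough to the right both \<open>|f - 1| < 1\<close> and \<open>|\<Sum>n. \<beta>\<^sub>n exp (- \<mu>\<^sub>n s)| < \<pi>\<close>, so that the principal branch of
  \<open>ln\<close> inverts the exponential and both exponential sums represent \<open>- ln f\<close>. They then agree against the
  function \<open>t \<phi>(t)\<close>, whose additional factor \<open>t\<close> costs one unit of exponential decay.\<close>

lemma frequency_term_of_logarithm:
  fixes a \<beta> :: "nat \<Rightarrow> complex" and f :: "complex \<Rightarrow> complex"
  assumes ds: "dirichlet_series N' l a f"
    and fr: "frequencies N \<mu>"
    and sm: "(\<lambda>n. norm (\<beta> n) * exp (- \<mu> n * A)) summable_on idx N"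
    and f: "\<And>s. Re s \<ge> A \<Longrightarrow> f s = exp (- (\<Sum>\<^sub>\<infinity>n\<in>idx N. \<beta> n * exp (- of_real (\<mu> n) * s)))"
  shows "eq_distrib (frequency_term N' l a) (\<lambda>\<phi>. \<Sum>\<^sub>\<infinity>n\<in>idx N. of_real (\<mu> n) * \<beta> n * delta (\<mu> n) \<phi>)"
proof -
  have frl: "frequencies N' l" using ds by (simp add: dirichlet_series_def)
  obtain \<sigma> where \<sigma>: "\<And>s. Re s \<ge> \<sigma> \<Longrightarrow> (\<lambda>n. norm (a n * exp (- of_real (l n) * s))) summable_on idx N'"
      "\<And>s. Re s \<ge> \<sigma> \<Longrightarrow> f s = 1 + (\<Sum>\<^sub>\<infinity>n\<in>idx N'. a n * exp (- of_real (l n) * s))"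
    using ds by (auto simp: dirichlet_series_def)
  have sma: "(\<lambda>n. norm (a n) * exp (- l n * s)) summable_on idx N'" if "s \<ge> \<sigma>" for s
    using \<sigma>(1)[of "of_real s"] that by (simp add: norm_mult)
  have pos: "\<mu> n > 0" if "n \<in> idx N" for n using fr that by (auto simp: frequencies_def)
  have smb: "(\<lambda>n. norm (\<beta> n) * exp (- \<mu> n * s)) summable_on idx N" if "s \<ge> A" for s
    by (rule exp_sum_decay(1)[OF sm _ that, of 0]) (use pos in \<open>auto intro: less_imp_le\<close>)
  have "eventually (\<lambda>s. (\<Sum>\<^sub>\<infinity>n\<in>idx N'. norm (a n) * exp (- l n * s)) < 1
      \<and> (\<Sum>\<^sub>\<infinity>n\<in>idx N. norm (\<beta> n) * exp (- \<mu> n * s)) < pi \<and> s \<ge> A \<and> s \<ge> \<sigma>) at_top"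
    by (intro eventually_conj exp_sum_small[OF frl sma[OF order.refl]] exp_sum_small[OF fr sm] eventually_ge_at_top)
       auto
  then obtain A1 where A1: "\<And>s. s \<ge> A1 \<Longrightarrow> (\<Sum>\<^sub>\<infinity>n\<in>idx N'. norm (a n) * exp (- l n * s)) < 1"
      "\<And>s. s \<ge> A1 \<Longrightarrow> (\<Sum>\<^sub>\<infinity>n\<in>idx N. norm (\<beta> n) * exp (- \<mu> n * s)) < pi"
      "\<And>s. s \<ge> A1 \<Longrightarrow> s \<ge> A \<and> s \<ge> \<sigma>"
    unfolding eventually_at_top_linorder by blast
  let ?W = "lists (idx N') - {[]}"
  define \<kappa> where "\<kappa> w = (-1) ^ length w / of_nat (length w) * prod_list (map a w)" for w
  define wt where "wt w = sum_list (map l w)" for w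
  have log: "(\<Sum>\<^sub>\<infinity>w\<in>?W. \<kappa> w * of_real (exp (- wt w * s))) = (\<Sum>\<^sub>\<infinity>n\<in>idx N. \<beta> n * of_real (exp (- \<mu> n * s)))"
    if s: "s \<ge> A1" for s
  proof -
    let ?v = "\<Sum>\<^sub>\<infinity>n\<in>idx N. \<beta> n * exp (- of_real (\<mu> n) * of_real s)"
    have "norm ?v \<le> (\<Sum>\<^sub>\<infinity>n\<in>idx N. norm (\<beta> n * exp (- of_real (\<mu> n) * of_real s)))"
      by (rule norm_infsum_bound) (use smb[of s] A1(3)[OF s] in \<open>simp add: norm_mult\<close>)
    then have "norm ?v < pi" using A1(2)[OF s] by (simp add: norm_mult)
    then have "\<bar>Im ?v\<bar> < pi" using abs_Im_le_cmod[of ?v] by linarith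
    then have "ln (exp (- ?v)) = - ?v" by (intro Ln_exp) auto
    then have lnf: "- ln (f (of_real s)) = ?v" using f[of "of_real s"] A1(3)[OF s] by simp
    have "((\<lambda>w. \<kappa> w * exp (- of_real (wt w) * of_real s)) has_sum - ln (f (of_real s))) ?W"
      using log_dirichlet_series_over_words(2)[where N = N' and a = a and l = l and s = "of_real s"] sma[of s] A1(1)[OF s] A1(3)[OF s] \<sigma>(2)[of "of_real s"]
      by (simp add: \<kappa>_def wt_def)
    then show ?thesis unfolding lnf by (simp add: infsumI exp_of_real[symmetric])
  qed
  have smk: "(\<lambda>w. norm (\<kappa> w) * exp (- wt w * A1)) summable_on ?W"
    using log_dirichlet_series_over_words(1)[where N = N' and a = a and l = l and s = "of_real A1"] sma[of A1] A1(1)[of A1] A1(3)[of A1]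
    by (simp add: \<kappa>_def wt_def)
  have wpos: "wt w \<ge> 0" if "w \<in> ?W" for w
    using word_weight_pos[OF frl, of w] that by (auto simp: wt_def intro: less_imp_le)
  have fin1: "finite (wt ` ?W \<inter> {..B})" for B
  proof -
    have "wt ` ?W \<inter> {..B} \<subseteq> wt ` {w \<in> lists (idx N'). sum_list (map l w) \<le> B}"
      by (auto simp: wt_def)
    then show ?thesis using finite_words_below[OF frl] finite_subset by blast
  qed
  have fin2: "finite (\<mu> ` idx N \<inter> {..B})" for B
  proof -
    have "\<mu> ` idx N \<inter> {..B} \<subseteq> \<mu> ` {n \<in> idx N. \<mu> n \<le> B}" by auto
    then show ?thesis using finite_frequencies_below[OF fr] finite_subset by blast
  qed
  have "frequency_term N' l a \<phi> = (\<Sum>\<^sub>\<infinity>n\<in>idx N. of_real (\<mu> n) * \<beta> n * delta (\<mu> n) \<phi>)"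
    if \<phi>: "\<phi> \<in> exp_test (A1 + 1)" for \<phi>
  proof -
    obtain C where C: "\<And>t. norm (\<phi> t) \<le> C * exp (- (A1 + 1) * \<bar>t\<bar>)"
      using \<phi>[unfolded exp_test_def, simplified, rule_format, of 0] by (auto simp: nth_vderiv_def)
    have bd: "norm (of_real t * \<phi> t) \<le> C * exp (- A1 * t)" if "t \<ge> 0" for t
    proof -
      have "norm (of_real t * \<phi> t) \<le> exp t * (C * exp (- (A1 + 1) * t))"
        unfolding norm_mult
      proof (rule mult_mono)
        have "t \<le> exp t" using exp_ge_add_one_self[of t] by linarith
        then show "norm (complex_of_real t) \<le> exp t" using that by simp
        show "norm (\<phi> t) \<le> C * exp (- (A1 + 1) * t)" using C[of t] that by simp
      qed auto
      also have "\<dots> = C * exp (- A1 * t)"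
        by (simp add: algebra_simps exp_add exp_diff exp_minus)
      finally show ?thesis .
    qed
    have "(\<Sum>\<^sub>\<infinity>w\<in>?W. \<kappa> w * (of_real (wt w) * \<phi> (wt w))) = (\<Sum>\<^sub>\<infinity>n\<in>idx N. \<beta> n * (of_real (\<mu> n) * \<phi> (\<mu> n)))"
      by (rule exp_sums_agree[where \<phi> = "\<lambda>t. of_real t * \<phi> t", OF smk smb wpos _ fin1 fin2 log bd])
         (use A1(3)[of A1] pos in \<open>auto intro: less_imp_le\<close>)
    moreover have "frequency_term N' l a \<phi> = (\<Sum>\<^sub>\<infinity>w\<in>?W. \<kappa> w * (of_real (wt w) * \<phi> (wt w)))"
      unfolding \<kappa>_def wt_def
    proof (rule frequency_term_over_words, fold \<kappa>_def wt_def, rule abs_summable_summable,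
        rule Infinite_Sum.abs_summable_on_comparison_test')
      show "(\<lambda>w. C * (norm (\<kappa> w) * exp (- wt w * A1))) summable_on ?W"
        by (intro summable_on_cmult_right smk)
      show "norm (\<kappa> w * (of_real (wt w) * \<phi> (wt w))) \<le> C * (norm (\<kappa> w) * exp (- wt w * A1))" if "w \<in> ?W" for w
        using mult_left_mono[OF bd[OF wpos[OF that]], of "norm (\<kappa> w)"] by (simp add: norm_mult mult_ac)
    qed
    ultimately show ?thesis by (simp add: delta_def mult_ac)
  qed
  then show ?thesis unfolding eq_distrib_def by blast
qed

section \<open>Canonical products\<close>

text \<open>The factor is \<open>1 + O(z\<^sup>p\<^sup>+\<^sup>1)\<close> near \<open>0\<close>, and away from \<open>0\<close> the power \<open>z\<^sup>p\<^sup>+\<^sup>1\<close> dominates \<open>ln |1 - z|\<close> and the exponent. This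
  global bound is what makes canonical products of finite order.\<close>

lemma norm_weierstrass_factor_le:
  "norm (weierstrass_factor p z) \<le> exp ((real p + 3) * 2 ^ Suc p * norm z ^ Suc p)"
proof (cases "norm z \<le> 1/2")
  case True
  have "norm (weierstrass_factor p z) \<le> 1 + norm (weierstrass_factor p z - 1)"
    using norm_triangle_ineq[of 1 "weierstrass_factor p z - 1"] by simp
  also have "\<dots> \<le> 1 + 3 * norm z ^ Suc p"
    using weierstrass_factor_bound[OF True] by simp
  also have "\<dots> \<le> 1 + (real p + 3) * 2 ^ Suc p * norm z ^ Suc p"
  proof -
    have "3 * 1 \<le> (real p + 3) * 2 ^ Suc p" by (intro mult_mono one_le_power) auto
    then show ?thesis by (intro add_left_mono mult_right_mono) auto
  qed
  also have "\<dots> \<le> exp ((real p + 3) * 2 ^ Suc p * norm z ^ Suc p)"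
    by (rule exp_ge_add_one_self)
  finally show ?thesis .
next
  case False
  then have z: "2 * norm z \<ge> 1" by simp
  have le: "norm z ^ k \<le> 2 ^ Suc p * norm z ^ Suc p" if "k \<le> Suc p" for k
  proof -
    have "norm z ^ k \<le> (2 * norm z) ^ k" by (intro power_mono) auto
    also have "\<dots> \<le> (2 * norm z) ^ Suc p" using z that by (intro power_increasing)
    finally show ?thesis by (simp only: power_mult_distrib)
  qed
  have "norm (\<Sum>k=1..p. z ^ k / of_nat k) \<le> (\<Sum>k=1..p. norm z ^ k)"
  proof (rule sum_norm_le)
    fix k assume "k \<in> {1..p}"
    then have "norm z ^ k * 1 \<le> norm z ^ k * real k" by (intro mult_left_mono) auto
    then show "norm (z ^ k / of_nat k) \<le> norm z ^ k"
      using \<open>k \<in> {1..p}\<close> by (simp add: norm_divide norm_power divide_le_eq)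
  qed
  also have "\<dots> \<le> (\<Sum>k=1..p. 2 ^ Suc p * norm z ^ Suc p)"
    by (intro sum_mono le) auto
  finally have S: "norm (\<Sum>k=1..p. z ^ k / of_nat k) \<le> real p * (2 ^ Suc p * norm z ^ Suc p)" by simp
  have "norm (1 - z) \<le> 1 + norm z" using norm_triangle_ineq4[of 1 z] by simp
  also have "\<dots> \<le> exp (norm z)" by (rule exp_ge_add_one_self)
  finally have "norm (weierstrass_factor p z) \<le> exp (norm z) * exp (norm (\<Sum>k=1..p. z ^ k / of_nat k))"
    unfolding weierstrass_factor_def norm_mult by (intro mult_mono norm_exp) auto
  also have "\<dots> = exp (norm z + norm (\<Sum>k=1..p. z ^ k / of_nat k))" by (simp add: exp_add)
  also have "\<dots> \<le> exp ((real p + 3) * (2 ^ Suc p * norm z ^ Suc p))"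
  proof -
    define B where "B = 2 ^ Suc p * norm z ^ Suc p"
    have "B \<ge> 0" "norm z \<le> B" using le[of 1] by (auto simp: B_def)
    then show ?thesis using S unfolding exp_le_cancel_iff distrib_right B_def[symmetric] by linarith
  qed
  finally show ?thesis by (simp only: mult.assoc)
qed

text \<open>Multiplicities are handled as exponents: the estimate is linear in \<open>m\<close>, so the convergence of a product with
  multiplicities is governed by the sum of \<open>m |z|\<^sup>p\<^sup>+\<^sup>1\<close>. For \<open>m > 0\<close> the hypothesis forces \<open>|z| \<le> 1/2\<close>, where the estimate of a
  single factor is valid, and it keeps \<open>3 m |z|\<^sup>p\<^sup>+\<^sup>1\<close> small enough to linearize the exponential.\<close>

lemma weierstrass_factor_power_bound:
  assumes "real m * norm z ^ Suc p \<le> (1/2) ^ Suc p / 6"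
  shows "norm (weierstrass_factor p z ^ m - 1) \<le> 5 * (real m * norm z ^ Suc p)"
proof (cases "m = 0")
  case False
  define x where "x = weierstrass_factor p z - 1"
  have "1 * norm z ^ Suc p \<le> real m * norm z ^ Suc p" using False by (intro mult_right_mono) auto
  also have "\<dots> \<le> (1/2) ^ Suc p" using assms by (rule order.trans) simp
  finally have "norm z \<le> 1/2" by (intro power_le_imp_le_base[of "norm z" p "1/2"]) auto
  then have x: "norm x \<le> 3 * norm z ^ Suc p" unfolding x_def by (rule weierstrass_factor_bound)
  have "norm (weierstrass_factor p z ^ m - 1) = norm ((\<Prod>i<m. 1 + x) - 1)" by (simp add: x_def)
  also have "\<dots> \<le> (\<Prod>i<m. 1 + norm x) - 1" by (rule norm_prod_minus1_le_prod_minus1)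
  also have "\<dots> \<le> exp (\<Sum>i<m. norm x) - 1" by (intro diff_mono prod_le_exp_sum) auto
  also have "\<dots> \<le> exp (3 * (real m * norm z ^ Suc p)) - 1"
    using mult_left_mono[OF x, of "real m"] by simp
  also have "\<dots> \<le> norm (exp (3 * (real m * norm z ^ Suc p)) - 1)" by simp
  also have "\<dots> \<le> 3 / 2 * norm (3 * (real m * norm z ^ Suc p))"
  proof (rule norm_exp_bounds)
    have "(1/2::real) ^ Suc p \<le> 1" by (rule power_le_one) auto
    then show "norm (3 * (real m * norm z ^ Suc p)) \<le> 1/2" using assms by simp
  qed
  also have "\<dots> = 9 / 2 * (real m * norm z ^ Suc p)" by simp
  also have "\<dots> \<le> 5 * (real m * norm z ^ Suc p)" by (intro mult_right_mono) auto
  finally show ?thesis .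
qed auto

text \<open>The polynomial in the exponent is a truncation of \<open>- ln (1 - u)\<close>, so its derivative is a finite geometric sum
  which cancels all of \<open>- 1 / (1 - u)\<close> but the term \<open>- u\<^sup>p / (1 - u)\<close>. Up to multiplicity this is the summand
  of \<^const>\<open>G_fun\<close>.\<close>

lemma logderiv_weierstrass_factor:
  assumes "w \<noteq> 0" "z \<noteq> w"
  shows "deriv (\<lambda>z. weierstrass_factor p (z / w) ^ m) z / weierstrass_factor p (z / w) ^ m
       = of_nat m * (z / w) ^ p / (z - w)"
proof -
  define S where "S u = (\<Sum>k=1..p. u ^ k / of_nat k)" for u :: complex
  let ?u = "z / w"
  have u: "?u \<noteq> 1" using assms by simp
  have dS: "(S has_field_derivative (\<Sum>k=1..p. u ^ (k - 1))) (at u)" for u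
    unfolding S_def by (auto intro!: derivative_eq_intros sum.cong)
  have geo: "(\<Sum>k=1..p. ?u ^ (k - 1)) = (1 - ?u ^ p) / (1 - ?u)"
  proof -
    have "(\<Sum>k=1..p. ?u ^ (k - 1)) = (\<Sum>k<p. ?u ^ k)"
      by (rule sum.reindex_bij_witness[of _ Suc "\<lambda>k. k - 1"]) auto
    then show ?thesis using u sum_gp_strict[of ?u p] assms by simp
  qed
  have dE: "(weierstrass_factor p has_field_derivative
      (- 1 * exp (S u) + (1 - u) * (exp (S u) * (\<Sum>k=1..p. u ^ (k - 1))))) (at u)" for u
    unfolding weierstrass_factor_def[abs_def] S_def[symmetric]
    by (auto intro!: derivative_eq_intros dS)
  have E: "weierstrass_factor p ?u = (1 - ?u) * exp (S ?u)" by (simp add: weierstrass_factor_def S_def)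
  have val: "- 1 * exp (S ?u) + (1 - ?u) * (exp (S ?u) * (\<Sum>k=1..p. ?u ^ (k - 1)))
           = weierstrass_factor p ?u * (- (?u ^ p) / (1 - ?u))"
    unfolding geo E using u by (simp add: field_simps)
  have "((\<lambda>z. weierstrass_factor p (z / w)) has_field_derivative
      weierstrass_factor p ?u * (- (?u ^ p) / (1 - ?u)) * (1 / w)) (at z)"
    by (rule DERIV_chain2[where f = "weierstrass_factor p" and g = "\<lambda>z. z / w", OF dE[of ?u, unfolded val]])
       (auto intro!: derivative_eq_intros simp: assms)
  then have "((\<lambda>z. weierstrass_factor p (z / w) ^ m) has_field_derivative
      of_nat m * (weierstrass_factor p ?u * (- (?u ^ p) / (1 - ?u)) * (1 / w)) * weierstrass_factor p ?u ^ (m - 1)) (at z)"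
    by (rule DERIV_power[THEN DERIV_cong]) (simp add: mult_ac)
  then have "deriv (\<lambda>z. weierstrass_factor p (z / w) ^ m) z
     = of_nat m * (weierstrass_factor p ?u * (- (?u ^ p) / (1 - ?u)) * (1 / w)) * weierstrass_factor p ?u ^ (m - 1)"
    by (rule DERIV_imp_deriv)
  also have "\<dots> = of_nat m * (- (?u ^ p) / (1 - ?u) * (1 / w)) * weierstrass_factor p ?u ^ m"
    by (cases m) (auto simp: mult_ac)
  also have "- (?u ^ p) / (1 - ?u) * (1 / w) = ?u ^ p / (z - w)"
    using assms u by (simp add: field_simps)
  finally have "deriv (\<lambda>z. weierstrass_factor p (z / w) ^ m) z = of_nat m * ?u ^ p / (z - w) * weierstrass_factor p ?u ^ m"
    by simp
  moreover have "weierstrass_factor p ?u \<noteq> 0" using u by simp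
  ultimately show ?thesis by simp
qed

text \<open>A sequence of non-zero points \<open>w n\<close> with multiplicities \<open>m n\<close>, possibly \<open>0\<close>. Allowing the multiplicity \<open>0\<close> lets a
  finite set of zeros be treated as an infinite sequence, and lets a single point be removed from the sequence
  without renumbering it.\<close>

locale canonical_product =
  fixes p :: nat and w :: "nat \<Rightarrow> complex" and m :: "nat \<Rightarrow> nat"
  assumes w_nonzero: "\<And>n. w n \<noteq> 0"
    and summable_mw: "summable (\<lambda>n. real (m n) / norm (w n) ^ Suc p)"
begin

definition factor :: "nat \<Rightarrow> complex \<Rightarrow> complex" where
  "factor n z = weierstrass_factor p (z / w n) ^ m n"

definition product :: "complex \<Rightarrow> complex" where
  "product z = (\<Prod>n. factor n z)"

lemma factor_eq_0_iff: "factor n z = 0 \<longleftrightarrow> m n > 0 \<and> z = w n"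
  by (auto simp: factor_def w_nonzero)

lemma summable_majorant: "summable (\<lambda>n. 5 * (real (m n) * (R / norm (w n)) ^ Suc p))"
proof -
  have "summable (\<lambda>n. 5 * R ^ Suc p * (real (m n) / norm (w n) ^ Suc p))"
    by (rule summable_mult[OF summable_mw])
  then show ?thesis by (simp only: power_divide mult.assoc times_divide_eq_right mult.commute mult.left_commute)
qed

lemma eventually_factor_bound:
  "\<forall>\<^sub>F n in sequentially. \<forall>z\<in>cball 0 R. norm (norm (factor n z - 1)) \<le> 5 * (real (m n) * (R / norm (w n)) ^ Suc p)"
proof -
  have "(\<lambda>n. 5 * (real (m n) * (R / norm (w n)) ^ Suc p)) \<longlonglongrightarrow> 0"
    by (rule summable_LIMSEQ_zero[OF summable_majorant])
  then have "\<forall>\<^sub>F n in sequentially. 5 * (real (m n) * (R / norm (w n)) ^ Suc p) < (1/2) ^ Suc p / 6"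
    by (rule order_tendstoD) simp
  then show ?thesis
  proof eventually_elim
    case (elim n)
    show ?case
    proof
      fix z :: complex assume z: "z \<in> cball 0 R"
      have "norm (z / w n) ^ Suc p \<le> (R / norm (w n)) ^ Suc p"
        using z by (intro power_mono) (auto simp: norm_divide intro!: divide_right_mono)
      then have le: "real (m n) * norm (z / w n) ^ Suc p \<le> real (m n) * (R / norm (w n)) ^ Suc p"
        by (intro mult_left_mono) auto
      have "0 \<le> real (m n) * norm (z / w n) ^ Suc p" by simp
      then have "real (m n) * norm (z / w n) ^ Suc p \<le> (1/2) ^ Suc p / 6"
        using le elim by linarith
      then have "norm (factor n z - 1) \<le> 5 * (real (m n) * norm (z / w n) ^ Suc p)"
        unfolding factor_def by (rule weierstrass_factor_power_bound)
      then show "norm (norm (factor n z - 1)) \<le> 5 * (real (m n) * (R / norm (w n)) ^ Suc p)"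
        using le by simp
    qed
  qed
qed

lemma convergent: "convergent_prod (\<lambda>n. factor n z)"
proof -
  have "summable (\<lambda>n. norm (factor n z - 1))"
  proof (rule summable_comparison_test_ev[OF _ summable_majorant[of "norm z"]])
    show "\<forall>\<^sub>F n in sequentially. norm (norm (factor n z - 1)) \<le> 5 * (real (m n) * (norm z / norm (w n)) ^ Suc p)"
      using eventually_factor_bound[of "norm z"] by eventually_elim auto
  qed
  then show ?thesis
    by (intro abs_convergent_prod_imp_convergent_prod) (simp add: abs_convergent_prod_conv_summable)
qed

lemma has_prod: "(\<lambda>n. factor n z) has_prod product z"
  using convergent[of z] unfolding product_def by auto

lemma product_eq_0_iff: "product z = 0 \<longleftrightarrow> (\<exists>n. m n > 0 \<and> z = w n)"
  using has_prod_eq_0_iff[OF has_prod, of z] by (auto simp: factor_eq_0_iff image_def)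

lemma factor_holomorphic [holomorphic_intros]: "factor n holomorphic_on A"
  unfolding factor_def[abs_def] by (intro holomorphic_intros) (simp add: w_nonzero)

lemma LIMSEQ_product: "(\<lambda>N. \<Prod>n<N. factor n z) \<longlonglongrightarrow> product z"
proof -
  have "(\<lambda>N. \<Prod>n<Suc N. factor n z) \<longlonglongrightarrow> product z"
    using convergent_prod_LIMSEQ[OF convergent[of z]] by (simp only: lessThan_Suc_atMost product_def)
  then show ?thesis by (rule filterlim_sequentially_Suc[THEN iffD1])
qed

lemma uniform_limit_product:
  "uniform_limit (cball 0 R) (\<lambda>N z. \<Prod>n<N. factor n z) product sequentially"
proof -
  have "uniformly_convergent_on (cball 0 R) (\<lambda>N z. \<Prod>n<N. factor n z)"
  proof (rule uniformly_convergent_on_prod')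
    show "uniformly_convergent_on (cball 0 R) (\<lambda>N z. \<Sum>n<N. norm (factor n z - 1))"
      by (rule Weierstrass_m_test'_ev[OF eventually_factor_bound summable_majorant])
    show "continuous_on (cball 0 R) (factor n)" for n
      by (intro holomorphic_on_imp_continuous_on holomorphic_intros)
  qed auto
  then obtain g where g: "uniform_limit (cball 0 R) (\<lambda>N z. \<Prod>n<N. factor n z) g sequentially"
    by (auto simp: uniformly_convergent_on_def)
  moreover have "g z = product z" if "z \<in> cball 0 R" for z
    using LIMSEQ_unique[OF tendsto_uniform_limitI[OF g that] LIMSEQ_product] .
  ultimately show ?thesis
    using uniform_limit_cong'[of "cball 0 R" "\<lambda>N z. \<Prod>n<N. factor n z" "\<lambda>N z. \<Prod>n<N. factor n z" g product] by auto
qed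

lemma product_holomorphic: "product holomorphic_on UNIV"
proof (rule holomorphic_uniform_sequence)
  fix z :: complex
  have "uniform_limit (cball z 1) (\<lambda>N z. \<Prod>n<N. factor n z) product sequentially"
    by (rule uniform_limit_on_subset[OF uniform_limit_product[of "norm z + 1"]])
       (simp add: cball_subset_cball_iff)
  then show "\<exists>d>0. cball z d \<subseteq> UNIV \<and> uniform_limit (cball z d) (\<lambda>N z. \<Prod>n<N. factor n z) product sequentially"
    by (intro exI[of _ 1]) auto
qed (auto intro!: holomorphic_intros)

text \<open>The exponents of the factors add up to a convergent series.\<close>

lemma product_growth: "\<exists>C\<ge>0. \<forall>z. norm (product z) \<le> exp (C * norm z ^ Suc p)"
proof -
  define C where "C = (real p + 3) * 2 ^ Suc p"
  define T where "T = (\<Sum>n. real (m n) / norm (w n) ^ Suc p)"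
  have "C \<ge> 0" by (simp add: C_def)
  have "T \<ge> 0" unfolding T_def by (intro suminf_nonneg summable_mw) auto
  have "norm (product z) \<le> exp (C * T * norm z ^ Suc p)" for z
  proof (rule Lim_bounded)
    show "(\<lambda>N. norm (\<Prod>n<N. factor n z)) \<longlonglongrightarrow> norm (product z)"
      by (intro tendsto_norm LIMSEQ_product)
    have "norm (\<Prod>n<N. factor n z) \<le> exp (C * T * norm z ^ Suc p)" for N
    proof -
      have "norm (\<Prod>n<N. factor n z) = (\<Prod>n<N. norm (factor n z))" by (rule prod_norm[symmetric])
      also have "\<dots> \<le> (\<Prod>n<N. exp (C * norm z ^ Suc p * (real (m n) / norm (w n) ^ Suc p)))"
      proof (intro prod_mono conjI)
        fix n
        have "norm (factor n z) \<le> exp (C * norm (z / w n) ^ Suc p) ^ m n"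
          unfolding factor_def norm_power C_def by (intro power_mono norm_weierstrass_factor_le) auto
        also have "\<dots> = exp (C * norm z ^ Suc p * (real (m n) / norm (w n) ^ Suc p))"
          by (simp add: exp_of_nat_mult[symmetric] norm_divide power_divide mult_ac)
        finally show "norm (factor n z) \<le> exp (C * norm z ^ Suc p * (real (m n) / norm (w n) ^ Suc p))" .
      qed auto
      also have "\<dots> = exp (C * norm z ^ Suc p * (\<Sum>n<N. real (m n) / norm (w n) ^ Suc p))"
        by (simp add: exp_sum[symmetric] sum_distrib_left)
      also have "\<dots> \<le> exp (C * norm z ^ Suc p * T)"
        unfolding exp_le_cancel_iff T_def
        by (intro mult_left_mono sum_le_suminf summable_mw) (auto simp: C_def)
      finally show ?thesis by (simp add: mult_ac)
    qed
    then show "\<forall>N\<ge>0. norm (\<Prod>n<N. factor n z) \<le> exp (C * T * norm z ^ Suc p)" by blast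
  qed
  then show ?thesis using \<open>C \<ge> 0\<close> \<open>T \<ge> 0\<close> by (intro exI[of _ "C * T"]) auto
qed

lemma logderiv_product:
  assumes "product z \<noteq> 0"
  shows "(\<lambda>n. of_nat (m n) * (z / w n) ^ p / (z - w n)) sums (deriv product z / product z)"
proof -
  have "(\<lambda>n. deriv (factor n) z / factor n z) sums (deriv product z / product z)"
  proof (rule logderiv_prodinf_complex_uniform_limit[where A = "ball 0 (norm z + 1)"])
    show "uniform_limit (ball 0 (norm z + 1)) (\<lambda>n x. \<Prod>k<n. factor k x) product sequentially"
      by (rule uniform_limit_on_subset[OF uniform_limit_product[of "norm z + 1"]]) auto
  qed (use assms in \<open>auto intro: holomorphic_intros\<close>)
  also have "(\<lambda>n. deriv (factor n) z / factor n z) = (\<lambda>n. of_nat (m n) * (z / w n) ^ p / (z - w n))"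
  proof
    fix n
    show "deriv (factor n) z / factor n z = of_nat (m n) * (z / w n) ^ p / (z - w n)"
    proof (cases "m n = 0")
      case True
      then have "factor n = (\<lambda>z. 1)" by (auto simp: factor_def)
      then show ?thesis using True by simp
    next
      case False
      then have "z \<noteq> w n" using assms product_eq_0_iff[of z] by blast
      then show ?thesis unfolding factor_def[abs_def]
        by (rule logderiv_weierstrass_factor[OF w_nonzero])
    qed
  qed
  finally show ?thesis .
qed

text \<open>Setting the multiplicity of the point \<open>w k\<close> to \<open>0\<close> leaves a canonical product that does not vanish there.\<close>

lemma product_at_zero:
  assumes inj: "\<And>n. m n > 0 \<Longrightarrow> n \<noteq> k \<Longrightarrow> w n \<noteq> w k"
  obtains h where "h holomorphic_on UNIV" "h (w k) \<noteq> 0" "\<And>z. product z = h z * (z - w k) ^ m k"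
proof -
  interpret rest: canonical_product p w "m(k := 0)"
  proof
    show "w n \<noteq> 0" for n by (rule w_nonzero)
    show "summable (\<lambda>n. real ((m(k := 0)) n) / norm (w n) ^ Suc p)"
      by (rule summable_comparison_test[OF _ summable_mw]) auto
  qed
  define E where "E z = - exp (\<Sum>j=1..p. (z / w k) ^ j / of_nat j) / w k" for z
  define h where "h z = E z ^ m k * rest.product z" for z
  show ?thesis
  proof (rule that[of h])
    show "h holomorphic_on UNIV" unfolding h_def[abs_def] E_def[abs_def]
      by (intro holomorphic_intros rest.product_holomorphic) (auto simp: w_nonzero)
    have "rest.product (w k) \<noteq> 0"
      unfolding rest.product_eq_0_iff using inj by (metis fun_upd_apply less_irrefl)
    then show "h (w k) \<noteq> 0" by (simp add: h_def E_def w_nonzero)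
    fix z
    have "weierstrass_factor p (z / w k) = E z * (z - w k)"
      using w_nonzero[of k] by (simp add: weierstrass_factor_def E_def field_simps)
    then have k: "factor k z = E z ^ m k * (z - w k) ^ m k"
      by (simp add: factor_def power_mult_distrib)
    have s: "(\<lambda>n. if n = k then factor n z else 1) has_prod factor k z"
      by (rule has_prod_single)
    have "product z = (\<Prod>n. (if n = k then factor n z else 1) * rest.factor n z)"
      unfolding product_def by (rule prodinf_cong) (auto simp: factor_def rest.factor_def)
    also have "\<dots> = (\<Prod>n. if n = k then factor n z else 1) * (\<Prod>n. rest.factor n z)"
      by (rule prodinf_mult[symmetric]) (use s rest.convergent in \<open>auto simp: has_prod_iff\<close>)
    also have "\<dots> = factor k z * rest.product z"
      using s by (simp add: has_prod_iff rest.product_def)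
    finally show "product z = h z * (z - w k) ^ m k" by (simp add: h_def k mult_ac)
  qed
qed

end

section \<open>Laplace transforms of exponential sums\<close>

lemma integrable_exp_decay:
  fixes a :: real
  assumes "a > 0"
  shows "integrable lborel (\<lambda>t. exp (- a * t) * indicator {0..} t)"
proof (rule integrableI_nonneg)
  have "((\<lambda>t. - exp (- a * t) / a) \<longlongrightarrow> - 0 / a) at_top"
  proof (intro tendsto_divide tendsto_minus tendsto_const)
    show "((\<lambda>t. exp (- a * t)) \<longlongrightarrow> 0) at_top"
      by (rule filterlim_compose[OF exp_at_bot])
         (use assms in \<open>simp add: filterlim_uminus_at_bot filterlim_tendsto_pos_mult_at_top[OF tendsto_const _ filterlim_ident]\<close>)
  qed (use assms in auto)
  then have "(\<integral>\<^sup>+t. ennreal (exp (- a * t)) * indicator {0..} t \<partial>lborel) = ennreal (- 0 / a - (- exp (- a * 0) / a))"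
    by (intro nn_integral_FTC_atLeast) (use assms in \<open>auto intro!: derivative_eq_intros\<close>)
  then show "(\<integral>\<^sup>+t. ennreal (exp (- a * t) * indicator {0..} t) \<partial>lborel) < \<infinity>"
    by (simp add: ennreal_mult'' ennreal_indicator)
qed auto

text \<open>Integration over \<open>{0..n}\<close> by the fundamental theorem of calculus, and dominated convergence for \<open>n \<longlonglongrightarrow> \<infinity>\<close>.\<close>

lemma laplace_exp:
  fixes z :: complex
  assumes "Re z > 0"
  shows "integrable lborel (\<lambda>t. exp (- z * of_real t) * indicator {0..} t)"
    and "(LINT t|lborel. exp (- z * of_real t) * indicator {0..} t) = 1 / z"
proof -
  let ?f = "\<lambda>t. exp (- z * of_real t) * indicator {0..} t"
  show "integrable lborel ?f"
    by (rule Bochner_Integration.integrable_bound[OF integrable_exp_decay[OF assms]])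
       (auto simp: norm_mult split: split_indicator)
  have z: "z \<noteq> 0" using assms by auto
  have part: "(LINT t|lborel. indicator {0..real n} t *\<^sub>R exp (- z * of_real t)) = - exp (- z * of_real n) / z - (- exp (- z * 0) / z)" for n
  proof -
    have "(LINT t|lborel. indicator {0..real n} t *\<^sub>R exp (- z * of_real t)) = - exp (- z * of_real (real n)) / z - (- exp (- z * of_real 0) / z)"
    proof (rule integral_FTC_atLeastAtMost)
      show "((\<lambda>t. - exp (- z * of_real t) / z) has_vector_derivative exp (- z * of_real x)) (at x within {0..real n})" for x
        using z by (auto intro!: derivative_eq_intros has_vector_derivative_real_field)
    qed (auto intro!: continuous_intros)
    then show ?thesis by simp
  qed
  have "(\<lambda>n. LINT t|lborel. indicator {0..real n} t *\<^sub>R exp (- z * of_real t)) \<longlonglongrightarrow> (LINT t|lborel. ?f t)"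
  proof (rule integral_dominated_convergence[OF _ _ integrable_exp_decay[OF assms]])
    have "(\<lambda>n. indicator {0..real n} t *\<^sub>R exp (- z * of_real t)) \<longlonglongrightarrow> ?f t" for t
    proof (rule tendsto_eventually)
      have "\<forall>\<^sub>F n in sequentially. real n \<ge> t"
        using filterlim_real_sequentially by (simp add: filterlim_at_top)
      then show "\<forall>\<^sub>F n in sequentially. indicator {0..real n} t *\<^sub>R exp (- z * of_real t) = ?f t"
        by eventually_elim (auto split: split_indicator)
    qed
    then show "AE t in lborel. (\<lambda>n. indicator {0..real n} t *\<^sub>R exp (- z * of_real t)) \<longlonglongrightarrow> ?f t" by simp
    show "AE t in lborel. norm (indicator {0..real n} t *\<^sub>R exp (- z * of_real t)) \<le> exp (- Re z * t) * indicator {0..} t" for n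
      by (auto split: split_indicator)
  qed auto
  moreover have "(\<lambda>n. - exp (- z * of_real n) / z - (- exp (- z * 0) / z)) \<longlonglongrightarrow> - 0 / z - (- exp (- z * 0) / z)"
  proof (intro tendsto_diff tendsto_divide tendsto_minus tendsto_const z)
    have "(\<lambda>n. exp (- (Re z * real n))) \<longlonglongrightarrow> 0"
      by (rule filterlim_compose[OF exp_at_bot])
         (use assms in \<open>simp add: filterlim_uminus_at_bot filterlim_tendsto_pos_mult_at_top[OF tendsto_const _ filterlim_real_sequentially]\<close>)
    then show "(\<lambda>n. exp (- z * of_real (real n))) \<longlonglongrightarrow> 0"
      by (intro tendsto_norm_zero_cancel[of "\<lambda>n. exp (- z * of_real (real n))"]) simp
  qed
  ultimately show "(LINT t|lborel. ?f t) = 1 / z"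
    unfolding part using LIMSEQ_unique by fastforce
qed

text \<open>The constant \<open>c\<close> bounds the real parts from above only, hence the estimates hold just for \<open>t \<ge> 0\<close>. They are
  the majorants for the dominated convergence arguments below.\<close>

lemma exp_minus_one_series:
  fixes \<kappa> \<tau> :: "nat \<Rightarrow> complex"
  assumes \<kappa>: "summable (\<lambda>n. norm (\<kappa> n))"
    and \<tau>: "\<And>n. \<kappa> n \<noteq> 0 \<Longrightarrow> Re (\<tau> n) \<le> c" and "c \<ge> 0" and t: "t \<ge> 0"
  shows "norm (\<kappa> n * (exp (\<tau> n * of_real t) - 1)) \<le> norm (\<kappa> n) * (2 * exp (c * t))"
    and "summable (\<lambda>n. norm (\<kappa> n * (exp (\<tau> n * of_real t) - 1)))"
    and "summable (\<lambda>n. norm (\<kappa> n * exp (\<tau> n * of_real t)))"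
    and "norm (\<Sum>n. \<kappa> n * (exp (\<tau> n * of_real t) - 1)) \<le> (\<Sum>n. norm (\<kappa> n)) * (2 * exp (c * t))"
proof -
  have ex: "norm (exp (\<tau> n * of_real t)) \<le> exp (c * t)" if "\<kappa> n \<noteq> 0" for n
    using mult_right_mono[OF \<tau>[OF that] t] by simp
  have bd: "norm (\<kappa> n * (exp (\<tau> n * of_real t) - 1)) \<le> norm (\<kappa> n) * (2 * exp (c * t))" for n
  proof (cases "\<kappa> n = 0")
    case False
    have "norm (exp (\<tau> n * of_real t) - 1) \<le> norm (exp (\<tau> n * of_real t)) + 1"
      using norm_triangle_ineq4[of "exp (\<tau> n * of_real t)" 1] by simp
    also have "\<dots> \<le> exp (c * t) + 1" using ex[OF False] by simp
    also have "\<dots> \<le> 2 * exp (c * t)" using t \<open>c \<ge> 0\<close> by simp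
    finally show ?thesis unfolding norm_mult by (intro mult_left_mono) auto
  qed auto
  then show "norm (\<kappa> n * (exp (\<tau> n * of_real t) - 1)) \<le> norm (\<kappa> n) * (2 * exp (c * t))" .
  have sm: "summable (\<lambda>n. norm (\<kappa> n) * (2 * exp (c * t)))"
    by (intro summable_mult2 \<kappa>)
  show smn: "summable (\<lambda>n. norm (\<kappa> n * (exp (\<tau> n * of_real t) - 1)))"
    by (rule summable_comparison_test[OF _ sm]) (use bd in auto)
  show "summable (\<lambda>n. norm (\<kappa> n * exp (\<tau> n * of_real t)))"
  proof (rule summable_comparison_test[OF _ summable_mult2[OF \<kappa>, of "exp (c * t)"]], intro exI allI impI)
    show "norm (norm (\<kappa> n * exp (\<tau> n * of_real t))) \<le> norm (\<kappa> n) * exp (c * t)" for n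
      using ex[of n] by (cases "\<kappa> n = 0") (auto simp: norm_mult)
  qed
  have "norm (\<Sum>n. \<kappa> n * (exp (\<tau> n * of_real t) - 1)) \<le> (\<Sum>n. norm (\<kappa> n * (exp (\<tau> n * of_real t) - 1)))"
    by (rule summable_norm[OF smn])
  also have "\<dots> \<le> (\<Sum>n. norm (\<kappa> n) * (2 * exp (c * t)))"
    by (rule suminf_le[OF bd smn sm])
  also have "\<dots> = (\<Sum>n. norm (\<kappa> n)) * (2 * exp (c * t))"
    by (rule suminf_mult2[OF \<kappa>, symmetric])
  finally show "norm (\<Sum>n. \<kappa> n * (exp (\<tau> n * of_real t) - 1)) \<le> (\<Sum>n. norm (\<kappa> n)) * (2 * exp (c * t))" .
qed

lemma laplace_exp_series:
  fixes \<kappa> \<tau> :: "nat \<Rightarrow> complex" and z :: complex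
  assumes \<kappa>: "summable (\<lambda>n. norm (\<kappa> n))"
    and \<tau>: "\<And>n. \<kappa> n \<noteq> 0 \<Longrightarrow> Re (\<tau> n) \<le> c" and "c \<ge> 0" and z: "Re z > c"
  shows "(LINT t|lborel. (\<Sum>n. \<kappa> n * (exp (\<tau> n * of_real t) - 1)) * indicator {0..} t * exp (- z * of_real t))
       = (\<Sum>n. \<kappa> n * (1 / (z - \<tau> n) - 1 / z))"
proof -
  define M where "M = (\<Sum>n. norm (\<kappa> n))"
  let ?g = "\<lambda>n t. \<kappa> n * (exp (\<tau> n * of_real t) - 1) * indicator {0..} t * exp (- z * of_real t)"
  have bd: "norm (\<kappa> n * (exp (\<tau> n * of_real t) - 1)) \<le> norm (\<kappa> n) * (2 * exp (c * t))" if "t \<ge> 0" for n t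
    by (rule exp_minus_one_series(1)[OF \<kappa> _ \<open>c \<ge> 0\<close> that]) (rule \<tau>)
  have smn: "summable (\<lambda>n. \<kappa> n * (exp (\<tau> n * of_real t) - 1))" if "t \<ge> 0" for t
    by (rule summable_norm_cancel, rule exp_minus_one_series(2)[OF \<kappa> _ \<open>c \<ge> 0\<close> that]) (rule \<tau>)
  let ?dom = "\<lambda>t. 2 * M * (exp (- (Re z - c) * t) * indicator {0..} t)"
  have dom: "integrable lborel ?dom"
    by (intro integrable_mult_right integrable_exp_decay) (use z in auto)
  have term_int: "integrable lborel (?g n) \<and> (LINT t|lborel. ?g n t) = \<kappa> n * (1 / (z - \<tau> n) - 1 / z)" for n
  proof (cases "\<kappa> n = 0")
    case False
    have 1: "Re (z - \<tau> n) > 0" and 2: "Re z > 0" using \<tau>[OF False] z \<open>c \<ge> 0\<close> by auto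
    have eq: "?g n = (\<lambda>t. \<kappa> n * (exp (- (z - \<tau> n) * of_real t) * indicator {0..} t - exp (- z * of_real t) * indicator {0..} t))"
      by (rule ext) (auto simp: algebra_simps exp_diff exp_minus exp_add divide_inverse)
    show ?thesis unfolding eq using laplace_exp[OF 1] laplace_exp[OF 2]
      by (auto intro!: integrable_mult_right Bochner_Integration.integrable_diff)
  qed auto
  have "(\<lambda>N. LINT t|lborel. (\<Sum>n<N. ?g n t)) \<longlonglongrightarrow> (LINT t|lborel. (\<Sum>n. \<kappa> n * (exp (\<tau> n * of_real t) - 1)) * indicator {0..} t * exp (- z * of_real t))"
  proof (rule integral_dominated_convergence[OF _ _ dom])
    have "(\<lambda>N. \<Sum>n<N. ?g n t) \<longlonglongrightarrow> (\<Sum>n. \<kappa> n * (exp (\<tau> n * of_real t) - 1)) * indicator {0..} t * exp (- z * of_real t)" for t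
    proof (cases "t \<ge> 0")
      case True
      have "(\<lambda>N. (\<Sum>n<N. \<kappa> n * (exp (\<tau> n * of_real t) - 1)) * exp (- z * of_real t))
            \<longlonglongrightarrow> (\<Sum>n. \<kappa> n * (exp (\<tau> n * of_real t) - 1)) * exp (- z * of_real t)"
        by (intro tendsto_mult summable_LIMSEQ smn[OF True] tendsto_const)
      then show ?thesis using True by (simp add: sum_distrib_right)
    qed auto
    then show "AE t in lborel. (\<lambda>N. \<Sum>n<N. ?g n t) \<longlonglongrightarrow> (\<Sum>n. \<kappa> n * (exp (\<tau> n * of_real t) - 1)) * indicator {0..} t * exp (- z * of_real t)"
      by simp
    have "norm (\<Sum>n<N. ?g n t) \<le> ?dom t" for N t
    proof (cases "t \<ge> 0")
      case True
      have "norm (\<Sum>n<N. ?g n t) \<le> (\<Sum>n<N. norm (?g n t))" by (rule norm_sum)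
      also have "\<dots> \<le> (\<Sum>n<N. norm (\<kappa> n) * (2 * exp (c * t)) * exp (- Re z * t))"
        using True by (intro sum_mono) (simp add: norm_mult[of "_ * (_ - _)"] bd[OF True])
      also have "\<dots> = (\<Sum>n<N. norm (\<kappa> n)) * (2 * exp (- (Re z - c) * t))"
        by (simp add: sum_distrib_right sum_distrib_left exp_add[symmetric] algebra_simps)
      also have "\<dots> \<le> M * (2 * exp (- (Re z - c) * t))"
        unfolding M_def by (intro mult_right_mono sum_le_suminf \<kappa>) auto
      finally show ?thesis using True by (simp add: mult_ac)
    qed auto
    then show "AE t in lborel. norm (\<Sum>n<N. ?g n t) \<le> ?dom t" for N by simp
  qed measurable
  moreover have "(LINT t|lborel. (\<Sum>n<N. ?g n t)) = (\<Sum>n<N. \<kappa> n * (1 / (z - \<tau> n) - 1 / z))" for N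
    using term_int by (subst Bochner_Integration.integral_sum) auto
  ultimately have "(\<lambda>n. \<kappa> n * (1 / (z - \<tau> n) - 1 / z)) sums
      (LINT t|lborel. (\<Sum>n. \<kappa> n * (exp (\<tau> n * of_real t) - 1)) * indicator {0..} t * exp (- z * of_real t))"
    by (simp add: sums_def)
  then show ?thesis by (rule sums_unique)
qed

section \<open>Gaussian test functions\<close>

text \<open>For \<open>\<epsilon> > 0\<close> Gaussian decay makes this a test function for every rate of exponential decay, whatever \<open>z\<close> is.\<close>

definition gauss_test :: "real \<Rightarrow> complex \<Rightarrow> real \<Rightarrow> complex" where
  "gauss_test \<epsilon> z t = exp (- z * of_real t - of_real \<epsilon> * of_real t ^ 2)"

text \<open>The Hermite-type polynomial factor of the \<open>k\<close>-th derivative of the Gaussian test function.\<close>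

primrec gauss_poly :: "real \<Rightarrow> complex \<Rightarrow> nat \<Rightarrow> complex poly" where
  "gauss_poly \<epsilon> z 0 = 1"
| "gauss_poly \<epsilon> z (Suc k) = pderiv (gauss_poly \<epsilon> z k) + [: - z, - 2 * of_real \<epsilon> :] * gauss_poly \<epsilon> z k"

lemma gauss_test_has_vector_derivative:
  "((\<lambda>t. poly q (of_real t) * gauss_test \<epsilon> z t) has_vector_derivative
     poly (pderiv q + [: - z, - 2 * of_real \<epsilon> :] * q) (of_real t) * gauss_test \<epsilon> z t) (at t)"
proof -
  have "((\<lambda>u. poly q u * exp (- z * u - of_real \<epsilon> * u ^ 2)) has_field_derivative
      poly (pderiv q + [: - z, - 2 * of_real \<epsilon> :] * q) (of_real t) * exp (- z * of_real t - of_real \<epsilon> * of_real t ^ 2)) (at (of_real t))"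
    by (auto intro!: derivative_eq_intros simp: algebra_simps)
  then show ?thesis
    unfolding gauss_test_def by (rule has_vector_derivative_real_field)
qed

lemma nth_vderiv_gauss_test:
  "nth_vderiv k (gauss_test \<epsilon> z) = (\<lambda>t. poly (gauss_poly \<epsilon> z k) (of_real t) * gauss_test \<epsilon> z t)"
proof (induction k)
  case (Suc k)
  have "nth_vderiv (Suc k) (gauss_test \<epsilon> z) = (\<lambda>t. vector_derivative (nth_vderiv k (gauss_test \<epsilon> z)) (at t))"
    by (simp add: nth_vderiv_def)
  then show ?case unfolding Suc.IH
    using vector_derivative_at[OF gauss_test_has_vector_derivative] by simp
qed (simp add: nth_vderiv_def)

lemma norm_gauss_test: "norm (gauss_test \<epsilon> z t) = exp (- Re z * t - \<epsilon> * t\<^sup>2)"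
  by (simp add: gauss_test_def flip: of_real_power)

lemma poly_eq_sum_atMost:
  fixes q :: "complex poly"
  assumes "degree q \<le> k"
  shows "poly q x = (\<Sum>i\<le>k. coeff q i * x ^ i)"
  unfolding poly_altdef by (rule sum.mono_neutral_left) (use assms in \<open>auto simp: coeff_eq_0\<close>)

lemma norm_poly_le_exp:
  fixes q :: "complex poly"
  assumes "\<And>i. i \<le> k \<Longrightarrow> norm (coeff q i) \<le> B i" "degree q \<le> k"
  shows "norm (poly q (of_real t)) \<le> (\<Sum>i\<le>k. B i * fact i) * exp \<bar>t\<bar>"
proof -
  have pw: "\<bar>t\<bar> ^ i \<le> fact i * exp \<bar>t\<bar>" for i
  proof -
    have "(\<Sum>n\<in>{i}. \<bar>t\<bar> ^ n /\<^sub>R fact n) \<le> (\<Sum>n. \<bar>t\<bar> ^ n /\<^sub>R fact n)"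
      by (rule sum_le_suminf[OF summable_exp_generic]) auto
    then show ?thesis by (simp add: exp_def field_simps)
  qed
  have "poly q (of_real t) = (\<Sum>i\<le>k. coeff q i * of_real t ^ i)"
    by (rule poly_eq_sum_atMost)  (use assms in auto)
  also have "norm \<dots> \<le> (\<Sum>i\<le>k. B i * (fact i * exp \<bar>t\<bar>))"
  proof (rule sum_norm_le)
    fix i assume i: "i \<in> {..k}"
    have "norm (coeff q i) * \<bar>t\<bar> ^ i \<le> B i * (fact i * exp \<bar>t\<bar>)"
      using assms(1)[of i] i pw by (intro mult_mono) (auto intro: order.trans[OF norm_ge_zero])
    then show "norm (coeff q i * of_real t ^ i) \<le> B i * (fact i * exp \<bar>t\<bar>)"
      by (simp add: norm_mult norm_power)
  qed
  finally show ?thesis by (simp add: sum_distrib_right mult.assoc)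
qed

text \<open>Completing the square: \<open>R |t| - \<epsilon> t\<^sup>2 \<le> R\<^sup>2 / (4 \<epsilon>)\<close> for every \<open>R\<close>.\<close>

lemma gauss_test_exp_test:
  assumes "\<epsilon> > 0"
  shows "gauss_test \<epsilon> z \<in> exp_test A"
  unfolding exp_test_def
proof (intro CollectI allI conjI)
  fix k t
  show "nth_vderiv k (gauss_test \<epsilon> z) differentiable at t"
    unfolding nth_vderiv_gauss_test
    using gauss_test_has_vector_derivative by (rule differentiableI_vector)
next
  fix k
  let ?q = "gauss_poly \<epsilon> z k"
  define C where "C = (\<Sum>i\<le>degree ?q. norm (coeff ?q i) * fact i)"
  define R where "R = 1 + norm z + A"
  have "C \<ge> 0" by (auto simp: C_def intro!: sum_nonneg)
  have "norm (nth_vderiv k (gauss_test \<epsilon> z) t) \<le> C * exp (R\<^sup>2 / (4 * \<epsilon>)) * exp (- A * \<bar>t\<bar>)" for t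
  proof -
    have "norm (nth_vderiv k (gauss_test \<epsilon> z) t) \<le> (C * exp \<bar>t\<bar>) * exp (- Re z * t - \<epsilon> * t\<^sup>2)"
      unfolding nth_vderiv_gauss_test norm_mult norm_gauss_test C_def
      by (intro mult_right_mono norm_poly_le_exp) auto
    also have "\<dots> = C * exp (\<bar>t\<bar> - Re z * t - \<epsilon> * t\<^sup>2)"
      by (simp add: exp_add[symmetric] algebra_simps)
    also have "\<dots> \<le> C * exp (R\<^sup>2 / (4 * \<epsilon>) - A * \<bar>t\<bar>)"
    proof -
      have "- Re z * t \<le> norm z * \<bar>t\<bar>"
        using abs_ge_minus_self[of "Re z * t"] mult_right_mono[OF abs_Re_le_cmod[of z], of "\<bar>t\<bar>"]
        by (simp add: abs_mult)
      moreover have "R * \<bar>t\<bar> - \<epsilon> * t\<^sup>2 \<le> R\<^sup>2 / (4 * \<epsilon>)"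
      proof -
        have "0 \<le> (R - 2 * \<epsilon> * \<bar>t\<bar>)\<^sup>2" by simp
        then have "4 * \<epsilon> * (R * \<bar>t\<bar> - \<epsilon> * t\<^sup>2) \<le> R\<^sup>2"
          by (simp add: power2_eq_square algebra_simps)
        then show ?thesis using assms by (simp add: field_simps)
      qed
      ultimately have "\<bar>t\<bar> - Re z * t - \<epsilon> * t\<^sup>2 \<le> R\<^sup>2 / (4 * \<epsilon>) - A * \<bar>t\<bar>"
        by (simp add: R_def algebra_simps)
      then show ?thesis using \<open>C \<ge> 0\<close> by (intro mult_left_mono) auto
    qed
    also have "\<dots> = C * exp (R\<^sup>2 / (4 * \<epsilon>)) * exp (- A * \<bar>t\<bar>)"
      by (simp add: exp_diff exp_minus field_simps)
    finally show ?thesis .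
  qed
  then show "\<exists>C. \<forall>t. norm (nth_vderiv k (gauss_test \<epsilon> z) t) \<le> C * exp (- A * \<bar>t\<bar>)" by blast
qed

lemma degree_gauss_poly: "degree (gauss_poly \<epsilon> z k) \<le> k"
proof (induction k)
  case (Suc k)
  have "degree (pderiv (gauss_poly \<epsilon> z k)) \<le> Suc k" using Suc by (simp add: degree_pderiv)
  moreover have "degree ([: - z, - 2 * of_real \<epsilon> :] * gauss_poly \<epsilon> z k) \<le> 1 + k"
    using degree_mult_le[of "[: - z, - 2 * of_real \<epsilon> :]" "gauss_poly \<epsilon> z k"] Suc
      degree_pCons_le[of "-z" "[:- 2 * of_real \<epsilon>:]"] by (simp split: if_splits)
  ultimately show ?case by (simp add: degree_add_le)
qed auto

text \<open>At \<open>\<epsilon> = 0\<close> the recursion only multiplies by \<open>- z\<close>. Coefficients are used because convergence of polynomials of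
  bounded degree is inherited by their derivatives coefficientwise.\<close>

lemma coeff_gauss_poly_tendsto:
  assumes "\<epsilon> \<longlonglongrightarrow> 0"
  shows "(\<lambda>j. coeff (gauss_poly (\<epsilon> j) z k) i) \<longlonglongrightarrow> (if i = 0 then (- z) ^ k else 0)"
proof (induction k arbitrary: i)
  case (Suc k)
  have eq: "coeff (gauss_poly (\<epsilon> j) z (Suc k)) i = of_nat (Suc i) * coeff (gauss_poly (\<epsilon> j) z k) (Suc i)
      + (- z * coeff (gauss_poly (\<epsilon> j) z k) i
         + (- 2 * of_real (\<epsilon> j)) * (if i = 0 then 0 else coeff (gauss_poly (\<epsilon> j) z k) (i - 1)))" for j
    by (cases i) (auto simp: coeff_pderiv coeff_pCons split: nat.split)
  have "(\<lambda>j. coeff (gauss_poly (\<epsilon> j) z (Suc k)) i) \<longlonglongrightarrow> of_nat (Suc i) * 0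
      + (- z * (if i = 0 then (- z) ^ k else 0)
         + (- 2 * of_real 0) * (if i = 0 then 0 else (if i - 1 = 0 then (- z) ^ k else 0)))"
    unfolding eq
  proof (intro tendsto_add tendsto_mult tendsto_const tendsto_of_real assms Suc.IH)
    show "(\<lambda>j. coeff (gauss_poly (\<epsilon> j) z k) (Suc i)) \<longlonglongrightarrow> 0" using Suc.IH[of "Suc i"] by simp
    show "(\<lambda>j. if i = 0 then 0 else coeff (gauss_poly (\<epsilon> j) z k) (i - 1)) \<longlonglongrightarrow> (if i = 0 then 0 else (if i - 1 = 0 then (- z) ^ k else 0))"
      using Suc.IH[of "i - 1"] by (cases "i = 0") auto
  qed
  then show ?case by (cases "i = 0") auto
qed auto

lemma nth_vderiv_gauss_test_tendsto:
  assumes "\<epsilon> \<longlonglongrightarrow> 0"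
  shows "(\<lambda>j. nth_vderiv k (gauss_test (\<epsilon> j) z) t) \<longlonglongrightarrow> (- z) ^ k * exp (- z * of_real t)"
proof -
  have "poly (gauss_poly (\<epsilon> j) z k) (of_real t) = (\<Sum>i\<le>k. coeff (gauss_poly (\<epsilon> j) z k) i * of_real t ^ i)" for j
    by (rule poly_eq_sum_atMost) (rule degree_gauss_poly)
  moreover have "(\<lambda>j. \<Sum>i\<le>k. coeff (gauss_poly (\<epsilon> j) z k) i * of_real t ^ i) \<longlonglongrightarrow> (\<Sum>i\<le>k. (if i = 0 then (- z) ^ k else 0) * of_real t ^ i)"
    by (intro tendsto_intros coeff_gauss_poly_tendsto assms)
  moreover have "(\<Sum>i\<le>k. (if i = 0 then (- z) ^ k else 0) * of_real t ^ i) = (- z) ^ k"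
    by (simp add: if_distrib[of "\<lambda>x. x * _"] sum.delta' cong: if_cong)
  ultimately have p: "(\<lambda>j. poly (gauss_poly (\<epsilon> j) z k) (of_real t)) \<longlonglongrightarrow> (- z) ^ k" by simp
  have "(\<lambda>j. gauss_test (\<epsilon> j) z t) \<longlonglongrightarrow> exp (- z * of_real t - of_real 0 * of_real t ^ 2)"
    unfolding gauss_test_def by (intro tendsto_exp tendsto_diff tendsto_mult tendsto_const tendsto_of_real assms)
  then show ?thesis unfolding nth_vderiv_gauss_test using tendsto_mult[OF p] by simp
qed

text \<open>A bound uniform in \<open>\<epsilon>\<close> on the half line: the coefficients converge, hence are bounded, and the polynomial growth
  is absorbed by one additional factor \<open>exp t\<close>.\<close>

lemma nth_vderiv_gauss_test_bound:
  assumes "\<epsilon> \<longlonglongrightarrow> 0" and nn: "\<And>j. \<epsilon> j \<ge> 0"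
  obtains C where "C \<ge> 0" "\<And>j t. t \<ge> 0 \<Longrightarrow> norm (nth_vderiv k (gauss_test (\<epsilon> j) z) t) \<le> C * exp ((1 - Re z) * t)"
proof -
  have "\<exists>B. \<forall>j. norm (coeff (gauss_poly (\<epsilon> j) z k) i) \<le> B" for i
    using convergent_imp_Bseq[OF convergentI[OF coeff_gauss_poly_tendsto[OF assms(1), of z k i]]]
    by (auto simp: Bseq_def)
  then obtain B where B: "\<And>i j. norm (coeff (gauss_poly (\<epsilon> j) z k) i) \<le> B i" by metis
  have "B i \<ge> 0" for i using B[where i=i] norm_ge_zero order.trans by blast
  define C where "C = (\<Sum>i\<le>k. B i * fact i)"
  have "C \<ge> 0" using \<open>\<And>i. B i \<ge> 0\<close> by (auto simp: C_def intro!: sum_nonneg)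
  moreover have "norm (nth_vderiv k (gauss_test (\<epsilon> j) z) t) \<le> C * exp ((1 - Re z) * t)" if "t \<ge> 0" for j t
  proof -
    have "norm (nth_vderiv k (gauss_test (\<epsilon> j) z) t) \<le> (C * exp \<bar>t\<bar>) * exp (- Re z * t)"
      unfolding nth_vderiv_gauss_test norm_mult norm_gauss_test C_def
    proof (rule mult_mono)
      show "norm (poly (gauss_poly (\<epsilon> j) z k) (of_real t)) \<le> (\<Sum>i\<le>k. B i * fact i) * exp \<bar>t\<bar>"
        by (intro norm_poly_le_exp B degree_gauss_poly)
      show "exp (- Re z * t - \<epsilon> j * t\<^sup>2) \<le> exp (- Re z * t)" using nn[of j] by simp
      show "0 \<le> (\<Sum>i\<le>k. B i * fact i) * exp \<bar>t\<bar>" using \<open>C \<ge> 0\<close> by (simp add: C_def)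
    qed auto
    also have "\<dots> = C * exp ((1 - Re z) * t)"
      using that by (simp add: exp_add[symmetric] algebra_simps)
    finally show ?thesis .
  qed
  ultimately show ?thesis using that by blast
qed

text \<open>The factor \<open>exp (\<sigma> t)\<close> in the regularization only shifts the parameter of the test function.\<close>

lemma exp_times_gauss_test:
  "(\<lambda>t. exp (\<sigma> * of_real t) * gauss_test \<epsilon> s t) = gauss_test \<epsilon> (s - \<sigma>)"
  by (rule ext) (simp add: gauss_test_def exp_add[symmetric] algebra_simps)

section \<open>Enumerating a divisor\<close>

lemma infsum_enumerate:
  fixes F :: "'i \<Rightarrow> 'b :: banach"
  assumes bij: "bij_betw e J S" and abs: "summable (\<lambda>n::nat. norm (if n \<in> J then F (e n) else 0))"
  shows "infsum F S = (\<Sum>n. if n \<in> J then F (e n) else 0)"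
proof -
  have "((\<lambda>n. if n \<in> J then F (e n) else 0) has_sum (\<Sum>n. if n \<in> J then F (e n) else 0)) UNIV"
    by (rule norm_summable_imp_has_sum[OF abs summable_sums[OF summable_norm_cancel[OF abs]]])
  then have "((\<lambda>n. F (e n)) has_sum (\<Sum>n. if n \<in> J then F (e n) else 0)) J"
    by (rule has_sum_cong_neutral[THEN iffD1, rotated -1]) auto
  then show ?thesis
    using has_sum_reindex_bij_betw[OF bij, of F] by (auto intro: infsumI)
qed

text \<open>A divisor listed by a sequence, its points being taken relative to \<open>\<sigma>\<close>: the point \<open>\<sigma> + \<tau> n\<close> has multiplicity \<open>m n\<close>.
  Indices that do not enumerate anything have \<open>m n = 0\<close> and an arbitrary \<open>\<tau> n \<noteq> 0\<close>. The last condition turns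
  sums over the support into series, for which the tools on integrals and infinite products are available.\<close>

locale enumerated_divisor =
  fixes D :: "complex \<Rightarrow> int" and d :: nat and \<sigma> :: complex
    and \<tau> :: "nat \<Rightarrow> complex" and m :: "nat \<Rightarrow> int"
  assumes d_pos: "d \<ge> 1"
    and \<tau>_nonzero: "\<And>n. \<tau> n \<noteq> 0"
    and m_summable: "summable (\<lambda>n. real_of_int \<bar>m n\<bar> / norm (\<tau> n) ^ d)"
    and D_at: "\<And>n. m n \<noteq> 0 \<Longrightarrow> D (\<sigma> + \<tau> n) = m n"
    and \<tau>_inj: "\<And>n k. m n \<noteq> 0 \<Longrightarrow> m k \<noteq> 0 \<Longrightarrow> \<tau> n = \<tau> k \<Longrightarrow> n = k"
    and D_enumerated: "\<And>\<rho>. D \<rho> \<noteq> 0 \<Longrightarrow> \<exists>n. m n = D \<rho> \<and> \<tau> n = \<rho> - \<sigma>"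
    and infsum_eq: "\<And>g :: complex \<Rightarrow> complex. summable (\<lambda>n. norm (of_int (m n) * g (\<sigma> + \<tau> n))) \<Longrightarrow>
        (\<Sum>\<^sub>\<infinity>\<rho>\<in>div_supp D. of_int (D \<rho>) * g \<rho>) = (\<Sum>n. of_int (m n) * g (\<sigma> + \<tau> n))"

text \<open>The support is countable because a summable family has only countably many non-zero terms. As it is closed, it
  stays away from \<open>\<sigma>\<close>, so that \<open>|\<rho>| \<le> B |\<rho> - \<sigma>|\<close> on it and the convergence of the sum of \<open>|n\<^sub>\<rho>| |\<rho>|\<^sup>-\<^sup>d\<close> carries over
  from \<open>\<rho>\<close> to \<open>\<rho> - \<sigma>\<close>.\<close>

lemma enumerated_divisor_exists:
  assumes D: "is_divisor D" and sm: "div_summable D d" and d: "d \<ge> 1" and \<sigma>: "\<sigma> \<notin> div_supp D"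
  obtains \<tau> m where "enumerated_divisor D d \<sigma> \<tau> m"
proof -
  let ?S = "div_supp D"
  have S: "D \<rho> \<noteq> 0 \<longleftrightarrow> \<rho> \<in> ?S" for \<rho> by (simp add: div_supp_def)
  have "(\<lambda>\<rho>. norm (real_of_int \<bar>D \<rho>\<bar> / norm \<rho> ^ d)) summable_on (?S - {0})"
    using sm unfolding div_summable_def by simp
  then have "countable {\<rho>\<in>?S - {0}. real_of_int \<bar>D \<rho>\<bar> / norm \<rho> ^ d \<noteq> 0}"
    by (rule abs_summable_countable)
  also have "{\<rho>\<in>?S - {0}. real_of_int \<bar>D \<rho>\<bar> / norm \<rho> ^ d \<noteq> 0} = ?S - {0}"
    by (auto simp: div_supp_def)
  finally have cnt: "countable ?S" by (simp add: countable_Diff_eq)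
  have "open (- ?S)" using D by (simp add: is_divisor_def open_closed)
  then obtain \<delta> where \<delta>: "\<delta> > 0" "ball \<sigma> \<delta> \<subseteq> - ?S"
    using \<sigma> open_contains_ball[of "- ?S"] by auto
  have far: "norm (\<rho> - \<sigma>) \<ge> \<delta>" if "\<rho> \<in> ?S" for \<rho>
  proof (rule ccontr)
    assume "\<not> \<delta> \<le> norm (\<rho> - \<sigma>)"
    then have "\<rho> \<in> ball \<sigma> \<delta>" by (simp add: dist_norm norm_minus_commute)
    then show False using \<delta>(2) that by auto
  qed
  define B where "B = 1 + norm \<sigma> / \<delta>"
  have "(\<lambda>\<rho>. real_of_int \<bar>D \<rho>\<bar> / norm (\<rho> - \<sigma>) ^ d) summable_on (?S - {0})"
  proof (rule summable_on_comparison_test)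
    show "(\<lambda>\<rho>. B ^ d * (real_of_int \<bar>D \<rho>\<bar> / norm \<rho> ^ d)) summable_on (?S - {0})"
      using sm unfolding div_summable_def by (intro summable_on_cmult_right) auto
    fix \<rho> assume \<rho>: "\<rho> \<in> ?S - {0}"
    have "norm \<sigma> \<le> norm \<sigma> / \<delta> * norm (\<rho> - \<sigma>)"
      using mult_left_mono[OF far[of \<rho>], of "norm \<sigma> / \<delta>"] \<rho> \<delta>(1) by simp
    then have "norm \<rho> \<le> B * norm (\<rho> - \<sigma>)"
      using norm_triangle_ineq[of "\<rho> - \<sigma>" \<sigma>] by (simp add: B_def algebra_simps)
    then have "norm \<rho> ^ d \<le> B ^ d * norm (\<rho> - \<sigma>) ^ d"
      by (metis norm_ge_zero power_mono power_mult_distrib)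
    moreover have "norm (\<rho> - \<sigma>) > 0" using far[of \<rho>] \<rho> \<delta>(1) by auto
    ultimately have "1 / norm (\<rho> - \<sigma>) ^ d \<le> B ^ d / norm \<rho> ^ d"
      using \<rho> by (simp add: field_simps)
    then show "real_of_int \<bar>D \<rho>\<bar> / norm (\<rho> - \<sigma>) ^ d \<le> B ^ d * (real_of_int \<bar>D \<rho>\<bar> / norm \<rho> ^ d)"
      using mult_left_mono[of "1 / norm (\<rho> - \<sigma>) ^ d" "B ^ d / norm \<rho> ^ d" "real_of_int \<bar>D \<rho>\<bar>"]
      by (simp add: mult_ac)
  qed auto
  then have "(\<lambda>\<rho>. real_of_int \<bar>D \<rho>\<bar> / norm (\<rho> - \<sigma>) ^ d) summable_on (insert 0 (?S - {0}))"
    by (rule summable_on_insert_iff[THEN iffD2])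
  then have smS: "(\<lambda>\<rho>. real_of_int \<bar>D \<rho>\<bar> / norm (\<rho> - \<sigma>) ^ d) summable_on ?S"
    by (rule summable_on_subset) auto
  define J where "J = to_nat_on ?S ` ?S"
  define e where "e = from_nat_into ?S"
  have bij: "bij_betw e J ?S"
    by (rule bij_betwI[of _ _ _ "to_nat_on ?S"]) (use cnt in \<open>auto simp: e_def J_def\<close>)
  have eS: "e n \<in> ?S" if "n \<in> J" for n using bij that by (auto simp: bij_betw_def)
  define \<tau> where "\<tau> n = (if n \<in> J then e n - \<sigma> else 1)" for n
  define m where "m n = (if n \<in> J then D (e n) else 0)" for n
  have mJ: "m n \<noteq> 0 \<longleftrightarrow> n \<in> J" for n using eS[of n] by (auto simp: m_def div_supp_def)
  show ?thesis
  proof (rule that[of \<tau> m], unfold_locales)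
    show "d \<ge> 1" by (rule d)
    show "\<tau> n \<noteq> 0" for n using eS[of n] \<sigma> by (auto simp: \<tau>_def)
    have "(\<lambda>n. real_of_int \<bar>D (e n)\<bar> / norm (e n - \<sigma>) ^ d) summable_on J"
      using smS summable_on_reindex_bij_betw[OF bij, of "\<lambda>\<rho>. real_of_int \<bar>D \<rho>\<bar> / norm (\<rho> - \<sigma>) ^ d"] by simp
    also have "?this \<longleftrightarrow> (\<lambda>n. real_of_int \<bar>m n\<bar> / norm (\<tau> n) ^ d) summable_on UNIV"
      by (rule summable_on_cong_neutral) (auto simp: m_def \<tau>_def)
    finally show "summable (\<lambda>n. real_of_int \<bar>m n\<bar> / norm (\<tau> n) ^ d)"
      by (rule summable_on_imp_summable)
    show "D (\<sigma> + \<tau> n) = m n" if "m n \<noteq> 0" for n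
      using that by (auto simp: m_def \<tau>_def split: if_splits)
    show "n = k" if "m n \<noteq> 0" "m k \<noteq> 0" "\<tau> n = \<tau> k" for n k
      using that bij unfolding mJ by (auto simp: \<tau>_def bij_betw_def dest: inj_onD)
    show "\<exists>n. m n = D \<rho> \<and> \<tau> n = \<rho> - \<sigma>" if "D \<rho> \<noteq> 0" for \<rho>
    proof -
      have "\<rho> \<in> e ` J" using that bij by (simp add: S bij_betw_def)
      then obtain n where "n \<in> J" "\<rho> = e n" by auto
      then show ?thesis by (intro exI[of _ n]) (simp add: m_def \<tau>_def)
    qed
    fix g :: "complex \<Rightarrow> complex"
    assume "summable (\<lambda>n. norm (of_int (m n) * g (\<sigma> + \<tau> n)))"
    moreover have eq: "of_int (m n) * g (\<sigma> + \<tau> n) = (if n \<in> J then of_int (D (e n)) * g (e n) else 0)" for n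
      by (simp add: m_def \<tau>_def)
    ultimately show "(\<Sum>\<^sub>\<infinity>\<rho>\<in>?S. of_int (D \<rho>) * g \<rho>) = (\<Sum>n. of_int (m n) * g (\<sigma> + \<tau> n))"
      using infsum_enumerate[OF bij, of "\<lambda>\<rho>. of_int (D \<rho>) * g \<rho>"] unfolding eq by blast
  qed
qed

text \<open>Since the majorant tends to \<open>0\<close> and non-zero multiplicities are at least \<open>1\<close> in absolute value, \<open>|\<tau> n| > 2 |z|\<close>
  for almost all \<open>n\<close> with \<open>m n \<noteq> 0\<close>; then \<open>|z - \<tau> n| \<ge> |\<tau> n| / 2\<close>.\<close>

lemma summable_partial_fractions:
  fixes \<tau> :: "nat \<Rightarrow> complex" and m :: "nat \<Rightarrow> int"
  assumes \<tau>: "\<And>n. \<tau> n \<noteq> 0" and sm: "summable (\<lambda>n. real_of_int \<bar>m n\<bar> / norm (\<tau> n) ^ Suc p)"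
  shows "summable (\<lambda>n. norm (of_int (m n) * ((z / \<tau> n) ^ p * (1 / (z - \<tau> n)))))"
proof (rule summable_comparison_test_ev)
  show "summable (\<lambda>n. 2 * norm z ^ p * (real_of_int \<bar>m n\<bar> / norm (\<tau> n) ^ Suc p))"
    by (rule summable_mult[OF sm])
  have "\<forall>\<^sub>F n in sequentially. real_of_int \<bar>m n\<bar> / norm (\<tau> n) ^ Suc p < 1 / (2 * norm z + 1) ^ Suc p"
    by (intro order_tendstoD[OF summable_LIMSEQ_zero[OF sm]] divide_pos_pos zero_less_power)
       (auto simp: add_nonneg_pos)
  then show "\<forall>\<^sub>F n in sequentially. norm (norm (of_int (m n) * ((z / \<tau> n) ^ p * (1 / (z - \<tau> n)))))
      \<le> 2 * norm z ^ p * (real_of_int \<bar>m n\<bar> / norm (\<tau> n) ^ Suc p)"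
  proof eventually_elim
    case (elim n)
    show ?case
    proof (cases "m n = 0")
      case False
      then have "1 \<le> real_of_int \<bar>m n\<bar>" by linarith
      then have "1 / norm (\<tau> n) ^ Suc p \<le> real_of_int \<bar>m n\<bar> / norm (\<tau> n) ^ Suc p"
        by (intro divide_right_mono) auto
      then have "1 / norm (\<tau> n) ^ Suc p < 1 / (2 * norm z + 1) ^ Suc p" using elim by linarith
      moreover have "norm (\<tau> n) ^ Suc p > 0" "(2 * norm z + 1) ^ Suc p > 0"
        using \<tau>[of n] by (auto intro!: mult_pos_pos zero_less_power simp: add_nonneg_pos)
      ultimately have "(2 * norm z + 1) ^ Suc p < norm (\<tau> n) ^ Suc p"
        by (simp add: frac_less2 divide_less_eq less_divide_eq del: power_Suc)
      then have "2 * norm z + 1 < norm (\<tau> n)"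
        by (rule power_less_imp_less_base) simp
      then have ge: "norm (\<tau> n) / 2 \<le> norm (z - \<tau> n)"
        using norm_triangle_ineq2[of "\<tau> n" z] by (simp add: norm_minus_commute)
      have "1 / norm (z - \<tau> n) \<le> 2 / norm (\<tau> n)"
        using frac_le[OF _ _ _ ge, of 1 1] \<tau>[of n] by simp
      then have "real_of_int \<bar>m n\<bar> * ((norm z / norm (\<tau> n)) ^ p * (1 / norm (z - \<tau> n)))
          \<le> real_of_int \<bar>m n\<bar> * ((norm z / norm (\<tau> n)) ^ p * (2 / norm (\<tau> n)))"
        by (intro mult_left_mono) auto
      also have "\<dots> = 2 * norm z ^ p * (real_of_int \<bar>m n\<bar> / norm (\<tau> n) ^ Suc p)"
        by (simp add: power_divide field_simps)
      finally show ?thesis by (simp add: norm_mult norm_divide norm_power)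
    qed auto
  qed
qed

section \<open>The Laplace transform of a Poisson-Newton formula\<close>

text \<open>Tannery's theorem: the Gaussian factor only decreases the terms.\<close>

lemma exp_decay_sum_gauss_tendsto:
  fixes b :: "nat \<Rightarrow> complex"
  assumes fr: "frequencies N \<mu>" and sm: "(\<lambda>n. norm (b n) * exp (- \<mu> n * A)) summable_on idx N"
    and s: "Re s \<ge> A" and \<epsilon>: "\<epsilon> \<longlonglongrightarrow> 0" "\<And>j. \<epsilon> j \<ge> 0"
  shows "(\<lambda>j. \<Sum>\<^sub>\<infinity>n\<in>idx N. b n * gauss_test (\<epsilon> j) s (\<mu> n)) \<longlonglongrightarrow> (\<Sum>\<^sub>\<infinity>n\<in>idx N. b n * exp (- of_real (\<mu> n) * s))"
proof -
  let ?I = "\<lambda>f n. if n \<in> idx N then f n else (0::complex)"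
  have bij: "bij_betw (\<lambda>n. n) (idx N) (idx N)" by (simp add: bij_betw_def)
  have pos: "\<mu> n \<ge> 0" if "n \<in> idx N" for n using fr that by (auto simp: frequencies_def intro: less_imp_le)
  define h where "h n = (if n \<in> idx N then norm (b n) * exp (- \<mu> n * A) else 0)" for n
  have "h summable_on UNIV"
    by (rule summable_on_cong_neutral[THEN iffD1, OF _ _ _ sm]) (auto simp: h_def)
  then have h: "summable h" by (rule summable_on_imp_summable)
  have ge: "norm (?I (\<lambda>n. b n * gauss_test e s (\<mu> n)) n) \<le> h n" if "e \<ge> 0" for e n
  proof (cases "n \<in> idx N")
    case True
    have "A * \<mu> n \<le> Re s * \<mu> n" using s pos[OF True] by (intro mult_right_mono)
    moreover have "e * (\<mu> n)\<^sup>2 \<ge> 0" using that by simp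
    ultimately have "- Re s * \<mu> n - e * (\<mu> n)\<^sup>2 \<le> - \<mu> n * A" by (simp add: mult.commute)
    then show ?thesis using True by (auto simp: h_def norm_mult norm_gauss_test intro!: mult_left_mono)
  qed (auto simp: h_def)
  have abs: "summable (\<lambda>n. norm (?I (\<lambda>n. b n * gauss_test e s (\<mu> n)) n))" if "e \<ge> 0" for e
    by (rule summable_comparison_test[OF _ h]) (use ge[OF that] in auto)
  have eq: "(\<Sum>\<^sub>\<infinity>n\<in>idx N. b n * gauss_test e s (\<mu> n)) = (\<Sum>n. ?I (\<lambda>n. b n * gauss_test e s (\<mu> n)) n)" if "e \<ge> 0" for e
    by (rule infsum_enumerate[OF bij abs[OF that]])
  have "(\<lambda>j. \<Sum>n. ?I (\<lambda>n. b n * gauss_test (\<epsilon> j) s (\<mu> n)) n) \<longlonglongrightarrow> (\<Sum>n. ?I (\<lambda>n. b n * gauss_test 0 s (\<mu> n)) n)"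
  proof (rule tannerys_theorem[THEN conjunct2, THEN conjunct2, OF _ _ h])
    show "(\<lambda>j. ?I (\<lambda>n. b n * gauss_test (\<epsilon> j) s (\<mu> n)) k) \<longlonglongrightarrow> ?I (\<lambda>n. b n * gauss_test 0 s (\<mu> n)) k" for k
    proof (cases "k \<in> idx N")
      case True
      have "(\<lambda>j. b k * gauss_test (\<epsilon> j) s (\<mu> k)) \<longlonglongrightarrow> b k * gauss_test 0 s (\<mu> k)"
        unfolding gauss_test_def
        by (intro tendsto_exp tendsto_diff tendsto_mult tendsto_const tendsto_of_real \<epsilon>)
      then show ?thesis using True by simp
    qed auto
    show "\<forall>\<^sub>F (k, n) in sequentially \<times>\<^sub>F sequentially. norm (?I (\<lambda>i. b i * gauss_test (\<epsilon> n) s (\<mu> i)) k) \<le> h k"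
      using ge \<epsilon>(2) by (intro always_eventually) auto
  qed auto
  then have "(\<lambda>j. \<Sum>\<^sub>\<infinity>n\<in>idx N. b n * gauss_test (\<epsilon> j) s (\<mu> n)) \<longlonglongrightarrow> (\<Sum>\<^sub>\<infinity>n\<in>idx N. b n * gauss_test 0 s (\<mu> n))"
    using eq \<epsilon>(2) eq[of 0] by simp
  then show ?thesis by (simp add: gauss_test_def mult.commute)
qed

context enumerated_divisor
begin

lemma G_fun_series:
  "G_fun D d \<sigma> s = (\<Sum>n. of_int (m n) * (((s - \<sigma>) / \<tau> n) ^ (d - 1) * (1 / (s - \<sigma> - \<tau> n))))"
proof -
  obtain p where p: "d = Suc p" using d_pos by (cases d) auto
  define g where "g \<rho> = (s - \<sigma>) powi (int d - 1) / (\<rho> - \<sigma>) powi (int d - 1) * (1 / (s - \<rho>))" for \<rho>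
  have g: "g (\<sigma> + \<tau> n) = ((s - \<sigma>) / \<tau> n) ^ (d - 1) * (1 / (s - \<sigma> - \<tau> n))" for n
    by (simp add: g_def p power_divide diff_diff_eq)
  have "summable (\<lambda>n. norm (of_int (m n) * g (\<sigma> + \<tau> n)))"
    unfolding g using summable_partial_fractions[OF \<tau>_nonzero m_summable[unfolded p], of "s - \<sigma>"] by (simp add: p)
  from infsum_eq[OF this] show ?thesis
    unfolding G_fun_def g[symmetric] by (simp add: g_def mult.assoc)
qed

text \<open>In the limit the \<open>d\<close>-th derivative of the test function becomes \<open>(- z)\<^sup>d exp (- z t)\<close> with \<open>z = s - \<sigma>\<close>. Integrating
  termwise leaves \<open>z\<^sup>d n\<^sub>\<rho> \<tau>\<^sup>-\<^sup>d (1 / (z - \<tau>) - 1 / z)\<close>, where \<open>- 1 / z\<close> stems from the subtraction of \<open>K(0)\<close>; since the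
  bracket equals \<open>\<tau> / (z (z - \<tau>))\<close>, this is the summand of \<^const>\<open>G_fun\<close>.\<close>

lemma regularized_distribution_laplace:
  assumes c: "\<And>n. m n \<noteq> 0 \<Longrightarrow> Re (\<tau> n) \<le> c" "c \<ge> 0" and s: "Re (s - \<sigma>) \<ge> c + 2"
    and \<epsilon>: "\<epsilon> \<longlonglongrightarrow> 0" "\<And>j. \<epsilon> j \<ge> 0"
  shows "(\<lambda>j. W_distrib D d \<sigma> (gauss_test (\<epsilon> j) s)) \<longlonglongrightarrow> G_fun D d \<sigma> s"
proof -
  define z where "z = s - \<sigma>"
  define \<kappa> where "\<kappa> n = of_int (m n) / \<tau> n ^ d" for n
  have \<kappa>: "summable (\<lambda>n. norm (\<kappa> n))"
    using m_summable by (simp add: \<kappa>_def norm_divide norm_power)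
  have \<kappa>0: "Re (\<tau> n) \<le> c" if "\<kappa> n \<noteq> 0" for n using that c(1) by (auto simp: \<kappa>_def)
  define M where "M = (\<Sum>n. norm (\<kappa> n))"
  define E where "E t = (\<Sum>n. \<kappa> n * (exp (\<tau> n * of_real t) - 1))" for t :: real
  have exp_summable: "summable (\<lambda>n. norm (\<kappa> n * exp (\<tau> n * of_real t)))" if "t \<ge> 0" for t
    by (rule exp_minus_one_series(3)[OF \<kappa> _ c(2) that]) (rule \<kappa>0)
  have E_bound: "norm (E t) \<le> M * (2 * exp (c * t))" if "t \<ge> 0" for t
    unfolding E_def M_def by (rule exp_minus_one_series(4)[OF \<kappa> _ c(2) that]) (rule \<kappa>0)
  have K: "K_fun D d \<sigma> t = (\<Sum>n. \<kappa> n * exp (\<tau> n * of_real t))" if "t \<ge> 0" for t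
  proof -
    let ?g = "\<lambda>\<rho>. exp ((\<rho> - \<sigma>) * of_real t) / (\<rho> - \<sigma>) ^ d"
    have "(\<Sum>\<^sub>\<infinity>\<rho>\<in>div_supp D. of_int (D \<rho>) * ?g \<rho>) = (\<Sum>n. of_int (m n) * ?g (\<sigma> + \<tau> n))"
      by (rule infsum_eq) (use exp_summable[OF that] in \<open>simp add: \<kappa>_def\<close>)
    then show ?thesis using that by (simp add: K_fun_def \<kappa>_def)
  qed
  have KE: "(K_fun D d \<sigma> t - K_fun D d \<sigma> 0) * indicator {0..} t = E t * indicator {0..} t" for t
  proof (cases "t \<ge> 0")
    case True
    have "K_fun D d \<sigma> t - K_fun D d \<sigma> 0 = (\<Sum>n. \<kappa> n * exp (\<tau> n * of_real t) - \<kappa> n * exp (\<tau> n * of_real 0))"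
      unfolding K[OF True] K[OF order.refl]
      by (rule suminf_diff[OF summable_norm_cancel[OF exp_summable[OF True]] summable_norm_cancel[OF exp_summable[OF order.refl]]])
    then show ?thesis by (simp add: E_def algebra_simps)
  qed auto
  let ?f = "\<lambda>j t. E t * indicator {0..} t * nth_vderiv d (gauss_test (\<epsilon> j) z) t"
  have W: "W_distrib D d \<sigma> (gauss_test (\<epsilon> j) s) = (-1) ^ d * (LINT t|lborel. ?f j t)" for j
    unfolding W_distrib_def exp_times_def distrib_deriv_def distrib_of_def exp_times_gauss_test KE z_def ..
  have E_meas: "E \<in> borel_measurable borel" unfolding E_def[abs_def] by measurable
  obtain C where C: "C \<ge> 0" "\<And>j t. t \<ge> 0 \<Longrightarrow> norm (nth_vderiv d (gauss_test (\<epsilon> j) z) t) \<le> C * exp ((1 - Re z) * t)"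
    using nth_vderiv_gauss_test_bound[OF \<epsilon>, of d z] by blast
  let ?dom = "\<lambda>t. 2 * M * C * (exp (- 1 * t) * indicator {0..} t)"
  have M0: "M \<ge> 0" unfolding M_def by (intro suminf_nonneg \<kappa>) auto
  have "(\<lambda>j. LINT t|lborel. ?f j t) \<longlonglongrightarrow> (LINT t|lborel. E t * indicator {0..} t * ((- z) ^ d * exp (- z * of_real t)))"
  proof (rule integral_dominated_convergence)
    show "integrable lborel ?dom" by (intro integrable_mult_right integrable_exp_decay) simp
    show "AE t in lborel. (\<lambda>j. ?f j t) \<longlonglongrightarrow> E t * indicator {0..} t * ((- z) ^ d * exp (- z * of_real t))"
      by (intro AE_I2 tendsto_mult tendsto_const nth_vderiv_gauss_test_tendsto \<epsilon>)
    have "norm (?f j t) \<le> ?dom t" for j t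
    proof (cases "t \<ge> 0")
      case True
      have "norm (?f j t) \<le> (M * (2 * exp (c * t))) * (C * exp ((1 - Re z) * t))"
      proof -
        have "norm (?f j t) = norm (E t) * norm (nth_vderiv d (gauss_test (\<epsilon> j) z) t)"
          using True by (simp add: norm_mult)
        also have "\<dots> \<le> (M * (2 * exp (c * t))) * (C * exp ((1 - Re z) * t))"
          using M0 by (intro mult_mono E_bound[OF True] C(2)[OF True]) auto
        finally show ?thesis .
      qed
      also have "\<dots> = 2 * M * C * exp ((c + 1 - Re z) * t)"
        by (simp add: exp_add[symmetric] algebra_simps)
      also have "\<dots> \<le> 2 * M * C * exp (- 1 * t)"
      proof -
        have "(c + 1 - Re z) * t \<le> - 1 * t" using s True by (intro mult_right_mono) (auto simp: z_def)
        then show ?thesis using M0 C(1) by (intro mult_left_mono) auto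
      qed
      finally show ?thesis using True by simp
    qed auto
    then show "AE t in lborel. norm (?f j t) \<le> ?dom t" for j by simp
    have "nth_vderiv d (gauss_test (\<epsilon> j) z) \<in> borel_measurable borel" for j
      unfolding nth_vderiv_gauss_test gauss_test_def
      by (intro borel_measurable_continuous_onI continuous_intros)
    then show "?f j \<in> borel_measurable lborel" for j using E_meas by measurable
    show "(\<lambda>t. E t * indicator {0..} t * ((- z) ^ d * exp (- z * of_real t))) \<in> borel_measurable lborel"
      using E_meas by measurable
  qed
  then have "(\<lambda>j. W_distrib D d \<sigma> (gauss_test (\<epsilon> j) s)) \<longlonglongrightarrow>
      (-1) ^ d * (LINT t|lborel. E t * indicator {0..} t * ((- z) ^ d * exp (- z * of_real t)))"
    unfolding W by (intro tendsto_mult tendsto_const)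
  also have "(LINT t|lborel. E t * indicator {0..} t * ((- z) ^ d * exp (- z * of_real t)))
      = (- z) ^ d * (LINT t|lborel. E t * indicator {0..} t * exp (- z * of_real t))"
    by (simp add: mult.left_commute[of _ "(- z) ^ d"] mult.assoc flip: integral_mult_right_zero)
  also have "(LINT t|lborel. E t * indicator {0..} t * exp (- z * of_real t)) = (\<Sum>n. \<kappa> n * (1 / (z - \<tau> n) - 1 / z))"
    unfolding E_def by (rule laplace_exp_series[OF \<kappa> _ c(2)]) (use s \<kappa>0 in \<open>auto simp: z_def\<close>)
  also have "(-1) ^ d * ((- z) ^ d * (\<Sum>n. \<kappa> n * (1 / (z - \<tau> n) - 1 / z))) = z ^ d * (\<Sum>n. \<kappa> n * (1 / (z - \<tau> n) - 1 / z))"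
    by (simp add: mult.assoc[symmetric] flip: power_mult_distrib)
  also have "\<dots> = G_fun D d \<sigma> s"
  proof -
    have z0: "z \<noteq> 0" using s c(2) by (auto simp: z_def)
    have term_eq: "of_int (m n) * ((z / \<tau> n) ^ (d - 1) * (1 / (z - \<tau> n))) = z ^ d * (\<kappa> n * (1 / (z - \<tau> n) - 1 / z))" for n
    proof (cases "m n = 0")
      case False
      have "Re z > Re (\<tau> n)" using c(1)[OF False] s by (simp add: z_def)
      then have "z \<noteq> \<tau> n" by auto
      then have u: "z - \<tau> n \<noteq> 0" by simp
      then have 1: "1 / (z - \<tau> n) - 1 / z = \<tau> n / (z * (z - \<tau> n))" using z0 by (simp add: field_simps)
      obtain p where p: "d = Suc p" using d_pos by (cases d) auto
      have "of_int (m n) * ((z / \<tau> n) ^ p * (1 / u)) = z ^ Suc p * (of_int (m n) / \<tau> n ^ Suc p * (\<tau> n / (z * u)))"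
        if "u \<noteq> 0" for u
        using that z0 \<tau>_nonzero[of n] by (simp add: power_divide)
      from this[OF u] show ?thesis unfolding 1 by (simp add: \<kappa>_def p)
    qed (simp add: \<kappa>_def)
    obtain p where p: "d = Suc p" using d_pos by (cases d) auto
    have "summable (\<lambda>n. z ^ d * (\<kappa> n * (1 / (z - \<tau> n) - 1 / z)))"
      using summable_norm_cancel[OF summable_partial_fractions[OF \<tau>_nonzero m_summable[unfolded p], of z]]
      unfolding term_eq[symmetric] by (simp add: p)
    then have "z ^ d * (\<Sum>n. \<kappa> n * (1 / (z - \<tau> n) - 1 / z)) = (\<Sum>n. z ^ d * (\<kappa> n * (1 / (z - \<tau> n) - 1 / z)))"
      using z0 by (subst suminf_mult) (simp_all add: summable_cmult_iff)
    moreover have "G_fun D d \<sigma> s = (\<Sum>n. of_int (m n) * ((z / \<tau> n) ^ (d - 1) * (1 / (z - \<tau> n))))"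
      unfolding z_def by (rule G_fun_series)
    ultimately show ?thesis unfolding term_eq by simp
  qed
  finally show ?thesis .
qed

text \<open>Both sides of the distributional identity are evaluated at Gaussian test functions and the width parameter is
  sent to \<open>0\<close>. A derivative of \<open>\<delta>\<^sub>0\<close> of order \<open>j\<close> becomes \<open>s\<^sup>j\<close>.\<close>

lemma poisson_newton_laplace:
  fixes b c :: "nat \<Rightarrow> complex"
  assumes r: "\<And>n. m n \<noteq> 0 \<Longrightarrow> Re (\<tau> n) \<le> r" "r \<ge> 0" and s: "Re (s - \<sigma>) \<ge> r + 2"
    and fr: "frequencies N \<mu>" and smb: "(\<lambda>n. norm (b n) * exp (- \<mu> n * A)) summable_on idx N" and sA: "Re s \<ge> A"
    and PN: "eq_distrib (W_distrib D d \<sigma>)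
           (\<lambda>\<phi>. (\<Sum>\<^sub>\<infinity>n\<in>idx N. b n * delta (\<mu> n) \<phi>) +
                 (\<Sum>j<d - 1. c j * distrib_deriv j (delta 0) \<phi>))"
  shows "G_fun D d \<sigma> s = (\<Sum>\<^sub>\<infinity>n\<in>idx N. b n * exp (- of_real (\<mu> n) * s)) + (\<Sum>j<d - 1. c j * s ^ j)"
proof -
  define \<epsilon> where "\<epsilon> j = inverse (real (Suc j))" for j
  have \<epsilon>: "\<epsilon> \<longlonglongrightarrow> 0" "\<And>j. \<epsilon> j \<ge> 0" "\<And>j. \<epsilon> j > 0"
    unfolding \<epsilon>_def[abs_def] using LIMSEQ_inverse_real_of_nat by auto
  have W: "W_distrib D d \<sigma> (gauss_test (\<epsilon> j) s) = (\<Sum>\<^sub>\<infinity>n\<in>idx N. b n * gauss_test (\<epsilon> j) s (\<mu> n)) +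
       (\<Sum>i<d - 1. c i * ((-1) ^ i * nth_vderiv i (gauss_test (\<epsilon> j) s) 0))" for j
    using PN gauss_test_exp_test[OF \<epsilon>(3)] unfolding eq_distrib_def delta_def distrib_deriv_def by blast
  have "(\<lambda>j. (\<Sum>\<^sub>\<infinity>n\<in>idx N. b n * gauss_test (\<epsilon> j) s (\<mu> n)) +
       (\<Sum>i<d - 1. c i * ((-1) ^ i * nth_vderiv i (gauss_test (\<epsilon> j) s) 0)))
     \<longlonglongrightarrow> (\<Sum>\<^sub>\<infinity>n\<in>idx N. b n * exp (- of_real (\<mu> n) * s)) +
       (\<Sum>i<d - 1. c i * ((-1) ^ i * ((- s) ^ i * exp (- s * of_real 0))))"
    by (intro tendsto_add tendsto_sum tendsto_mult tendsto_const nth_vderiv_gauss_test_tendsto \<epsilon>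
        exp_decay_sum_gauss_tendsto[OF fr smb sA])
  moreover have "(\<Sum>i<d - 1. c i * ((-1) ^ i * ((- s) ^ i * exp (- s * of_real 0)))) = (\<Sum>j<d - 1. c j * s ^ j)"
    by (intro sum.cong refl) (simp flip: power_mult_distrib)
  ultimately have "(\<lambda>j. W_distrib D d \<sigma> (gauss_test (\<epsilon> j) s)) \<longlonglongrightarrow>
      (\<Sum>\<^sub>\<infinity>n\<in>idx N. b n * exp (- of_real (\<mu> n) * s)) + (\<Sum>j<d - 1. c j * s ^ j)"
    unfolding W by simp
  moreover have "(\<lambda>j. W_distrib D d \<sigma> (gauss_test (\<epsilon> j) s)) \<longlonglongrightarrow> G_fun D d \<sigma> s"
    by (rule regularized_distribution_laplace[OF _ r(2) s \<epsilon>(1,2)]) (rule r(1))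
  ultimately show ?thesis by (rule LIMSEQ_unique[symmetric])
qed

end

section \<open>Meromorphic functions with a prescribed divisor\<close>

text \<open>One more power of \<open>|z|\<close> absorbs the constant.\<close>

lemma entire_finite_orderI:
  assumes "g holomorphic_on UNIV" and bd: "\<And>z. norm z \<ge> 1 \<Longrightarrow> norm (g z) \<le> exp (K * norm z ^ d)"
  shows "entire_finite_order g"
  unfolding entire_finite_order_def
proof (intro conjI exI assms(1))
  show "eventually (\<lambda>z. norm (g z) \<le> exp (norm z powr real (Suc d))) at_infinity"
    unfolding eventually_at_infinity
  proof (intro exI allI impI)
    fix z :: complex assume z: "norm z \<ge> max 1 K"
    have "K * norm z ^ d \<le> norm z * norm z ^ d" using z by (intro mult_right_mono) auto
    also have "\<dots> = norm z powr real (Suc d)" using z by (subst powr_realpow) auto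
    finally have "exp (K * norm z ^ d) \<le> exp (norm z powr real (Suc d))" by (simp only: exp_le_cancel_iff)
    moreover have "norm (g z) \<le> exp (K * norm z ^ d)" using z by (intro bd) simp
    ultimately show "norm (g z) \<le> exp (norm z powr real (Suc d))" by linarith
  qed
qed

lemma holomorphic_on_translate:
  assumes "F holomorphic_on UNIV"
  shows "(\<lambda>z :: complex. F (z - a)) holomorphic_on UNIV"
proof -
  have "(\<lambda>z. z - a) holomorphic_on UNIV" by (intro holomorphic_intros)
  from holomorphic_on_compose_gen[OF this assms] show ?thesis by (simp add: o_def)
qed

lemma deriv_translate:
  assumes "F holomorphic_on UNIV"
  shows "((\<lambda>z :: complex. F (z - a)) has_field_derivative deriv F (s - a)) (at s)"
proof -
  have "(F has_field_derivative deriv F (s - a)) (at (s - a))"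
    by (rule holomorphic_derivI[OF assms open_UNIV]) simp
  moreover have "((\<lambda>z. z - a) has_field_derivative 1) (at s)"
    by (auto intro!: derivative_eq_intros)
  ultimately show ?thesis using DERIV_chain2[of F "deriv F (s - a)" "\<lambda>z. z - a" s 1 UNIV] by simp
qed

text \<open>As \<open>g\<close> and \<open>h\<close> have no common zero, the convention \<open>x / 0 = 0\<close> gives the quotient the value \<open>0\<close> at each of its
  poles, as \<^const>\<open>nicely_meromorphic_on\<close> requires.\<close>

lemma meromorphic_quotient:
  fixes g h :: "complex \<Rightarrow> complex" and D :: "complex \<Rightarrow> int"
  assumes g: "g holomorphic_on UNIV" and h: "h holomorphic_on UNIV"
    and gz: "\<And>z. D z \<le> 0 \<Longrightarrow> g z \<noteq> 0" and hz: "\<And>z. D z \<ge> 0 \<Longrightarrow> h z \<noteq> 0"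
    and gD: "\<And>z. D z > 0 \<Longrightarrow> \<exists>G. G holomorphic_on UNIV \<and> G z \<noteq> 0 \<and> (\<forall>u. g u = G u * (u - z) ^ nat (D z))"
    and hD: "\<And>z. D z < 0 \<Longrightarrow> \<exists>H. H holomorphic_on UNIV \<and> H z \<noteq> 0 \<and> (\<forall>u. h u = H u * (u - z) ^ nat (- D z))"
  shows "(\<lambda>z. g z / h z) nicely_meromorphic_on UNIV" and "zorder (\<lambda>z. g z / h z) z = D z"
proof -
  have openH: "open {u. H u \<noteq> 0}" if "H holomorphic_on UNIV" for H :: "complex \<Rightarrow> complex"
  proof -
    have "continuous_on UNIV H" by (rule holomorphic_on_imp_continuous_on[OF that])
    then have "open (H -` (- {0}))" by (intro open_vimage) auto
    then show ?thesis by (simp add: vimage_def)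
  qed
  have cont: "isCont F z" if "F holomorphic_on UNIV" for F :: "complex \<Rightarrow> complex" and z
    using holomorphic_on_imp_continuous_on[OF that] continuous_on_eq_continuous_at[OF open_UNIV] by blast
  show "zorder (\<lambda>z. g z / h z) z = D z" for z
  proof -
    consider "D z > 0" | "D z = 0" | "D z < 0" by linarith
    then show ?thesis
    proof cases
      case 1
      then obtain G where G: "G holomorphic_on UNIV" "G z \<noteq> 0" "\<And>u. g u = G u * (u - z) ^ nat (D z)"
        using gD by blast
      show ?thesis
      proof (rule zorder_eqI[OF openH[OF h]])
        show "(\<lambda>u. G u / h u) holomorphic_on {u. h u \<noteq> 0}"
          using G(1) h by (intro holomorphic_on_divide) (auto intro: holomorphic_on_subset)
        show "g u / h u = G u / h u * (u - z) powi D z" for u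
          using 1 by (simp add: G(3) power_int_def)
      qed (use hz[of z] G 1 in auto)
    next
      case 2
      show ?thesis
      proof (rule zorder_eqI[OF openH[OF h]])
        show "(\<lambda>u. g u / h u) holomorphic_on {u. h u \<noteq> 0}"
          using g h by (intro holomorphic_on_divide) (auto intro: holomorphic_on_subset)
      qed (use 2 hz[of z] gz[of z] in auto)
    next
      case 3
      then obtain H where H: "H holomorphic_on UNIV" "H z \<noteq> 0" "\<And>u. h u = H u * (u - z) ^ nat (- D z)"
        using hD by blast
      show ?thesis
      proof (rule zorder_eqI[OF openH[OF H(1)]])
        show "(\<lambda>u. g u / H u) holomorphic_on {u. H u \<noteq> 0}"
          using g H by (intro holomorphic_on_divide) (auto intro: holomorphic_on_subset)
        show "g u / h u = g u / H u * (u - z) powi D z" for u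
          using 3 by (simp add: H(3) power_int_def divide_inverse power_inverse)
      qed (use gz[of z] H 3 in auto)
    qed
  qed
  show "(\<lambda>z. g z / h z) nicely_meromorphic_on UNIV"
    unfolding nicely_meromorphic_on_def
  proof (intro conjI ballI)
    have an: "g analytic_on UNIV" "h analytic_on UNIV"
      using g h by (auto simp: analytic_on_holomorphic)
    show "(\<lambda>z. g z / h z) meromorphic_on UNIV"
      by (intro meromorphic_on_divide analytic_on_imp_meromorphic_on an)
    fix z
    show "is_pole (\<lambda>z. g z / h z) z \<and> g z / h z = 0 \<or> (\<lambda>z. g z / h z) \<midarrow>z\<rightarrow> g z / h z"
    proof (cases "D z \<ge> 0")
      case True
      show ?thesis using hz[OF True] cont[OF g, of z] cont[OF h, of z] by (auto simp: isCont_def intro!: tendsto_divide)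
    next
      case False
      then obtain H where H: "H holomorphic_on UNIV" "H z \<noteq> 0" "\<And>u. h u = H u * (u - z) ^ nat (- D z)"
        using hD[of z] by auto
      have "h z = 0" using H(3)[of z] False by simp
      moreover have "is_pole (\<lambda>z. g z / h z) z"
      proof (rule is_pole_divide)
        show "isCont g z" "g z \<noteq> 0" using cont[OF g] gz[of z] False by auto
        have "h \<midarrow>z\<rightarrow> 0" using cont[OF h, of z] \<open>h z = 0\<close> by (simp add: isCont_def)
        moreover have "eventually (\<lambda>u. h u \<noteq> 0) (at z)"
        proof -
          have "eventually (\<lambda>u. u \<in> {u. H u \<noteq> 0}) (at z)"
            by (intro eventually_at_in_open' openH H) (use H in auto)
          moreover have "eventually (\<lambda>u. u \<noteq> z) (at z)" by (rule eventually_neq_at_within)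
          ultimately show ?thesis by eventually_elim (simp add: H(3))
        qed
        ultimately show "filterlim h (at 0) (at z)" by (rule filterlim_atI)
      qed
      ultimately show ?thesis by simp
    qed
  qed
qed

context enumerated_divisor
begin

lemma dominated_multiplicities:
  assumes "\<And>n. real (k n) \<le> real_of_int \<bar>m n\<bar>"
  shows "summable (\<lambda>n. real (k n) / norm (\<tau> n) ^ Suc (d - 1))"
proof (rule summable_comparison_test[OF _ m_summable], intro exI allI impI)
  show "norm (real (k n) / norm (\<tau> n) ^ Suc (d - 1)) \<le> real_of_int \<bar>m n\<bar> / norm (\<tau> n) ^ d" for n
    using divide_right_mono[OF assms[of n], of "norm (\<tau> n) ^ d"] d_pos by simp
qed

sublocale zeros: canonical_product "d - 1" \<tau> "\<lambda>n. nat (m n)"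
  by unfold_locales (rule \<tau>_nonzero, rule dominated_multiplicities, simp)

sublocale poles: canonical_product "d - 1" \<tau> "\<lambda>n. nat (- m n)"
  by unfold_locales (rule \<tau>_nonzero, rule dominated_multiplicities, simp)

lemma zeros_product_eq_0_iff: "zeros.product (z - \<sigma>) = 0 \<longleftrightarrow> D z > 0"
proof
  assume "zeros.product (z - \<sigma>) = 0"
  then obtain n where n: "nat (m n) > 0" "z - \<sigma> = \<tau> n" using zeros.product_eq_0_iff by blast
  then have "m n > 0" by simp
  moreover have "\<sigma> + \<tau> n = z" unfolding n(2)[symmetric] by simp
  ultimately show "D z > 0" using D_at[of n] by simp
next
  assume "D z > 0"
  then obtain n where "m n = D z" "\<tau> n = z - \<sigma>" using D_enumerated[of z] by auto
  then show "zeros.product (z - \<sigma>) = 0"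
    using \<open>D z > 0\<close> unfolding zeros.product_eq_0_iff by (intro exI[of _ n]) simp
qed

lemma poles_product_eq_0_iff: "poles.product (z - \<sigma>) = 0 \<longleftrightarrow> D z < 0"
proof
  assume "poles.product (z - \<sigma>) = 0"
  then obtain n where n: "nat (- m n) > 0" "z - \<sigma> = \<tau> n" using poles.product_eq_0_iff by blast
  then have "m n < 0" by simp
  moreover have "\<sigma> + \<tau> n = z" unfolding n(2)[symmetric] by simp
  ultimately show "D z < 0" using D_at[of n] by simp
next
  assume "D z < 0"
  then obtain n where "m n = D z" "\<tau> n = z - \<sigma>" using D_enumerated[of z] by auto
  then show "poles.product (z - \<sigma>) = 0"
    using \<open>D z < 0\<close> unfolding poles.product_eq_0_iff by (intro exI[of _ n]) simp
qed

lemma zeros_product_factorization: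
  assumes Dz: "D z > 0"
  obtains H where "H holomorphic_on UNIV" "H (z - \<sigma>) \<noteq> 0"
    "\<And>u. zeros.product (u - \<sigma>) = H (u - \<sigma>) * (u - z) ^ nat (D z)"
proof -
  obtain n where n: "m n = D z" "\<tau> n = z - \<sigma>" using D_enumerated[of z] Dz by auto
  have "\<And>k. nat (m k) > 0 \<Longrightarrow> k \<noteq> n \<Longrightarrow> \<tau> k \<noteq> \<tau> n" using \<tau>_inj n Dz by force
  then obtain H where "H holomorphic_on UNIV" "H (\<tau> n) \<noteq> 0"
      "\<And>u. zeros.product u = H u * (u - \<tau> n) ^ nat (m n)"
    using zeros.product_at_zero[of n] by blast
  then show ?thesis by (intro that[of H]) (simp_all add: n)
qed

lemma poles_product_factorization:
  assumes Dz: "D z < 0"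
  obtains H where "H holomorphic_on UNIV" "H (z - \<sigma>) \<noteq> 0"
    "\<And>u. poles.product (u - \<sigma>) = H (u - \<sigma>) * (u - z) ^ nat (- D z)"
proof -
  obtain n where n: "m n = D z" "\<tau> n = z - \<sigma>" using D_enumerated[of z] Dz by auto
  have "\<And>k. nat (- m k) > 0 \<Longrightarrow> k \<noteq> n \<Longrightarrow> \<tau> k \<noteq> \<tau> n" using \<tau>_inj n Dz by force
  then obtain H where "H holomorphic_on UNIV" "H (\<tau> n) \<noteq> 0"
      "\<And>u. poles.product u = H u * (u - \<tau> n) ^ nat (- m n)"
    using poles.product_at_zero[of n] by blast
  then show ?thesis by (intro that[of H]) (simp_all add: n)
qed

lemma product_quotient_has_divisor:
  assumes e: "e holomorphic_on UNIV" and e0: "\<And>z. e z \<noteq> 0"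
  defines "f \<equiv> \<lambda>z. e z * zeros.product (z - \<sigma>) / poles.product (z - \<sigma>)"
  shows "f nicely_meromorphic_on UNIV" and "zorder f z = D z"
proof -
  let ?g = "\<lambda>z. e z * zeros.product (z - \<sigma>)" and ?h = "\<lambda>z. poles.product (z - \<sigma>)"
  have g: "?g holomorphic_on UNIV"
    by (intro holomorphic_intros e holomorphic_on_translate zeros.product_holomorphic)
  have h: "?h holomorphic_on UNIV"
    by (intro holomorphic_on_translate poles.product_holomorphic)
  have gz: "?g z \<noteq> 0" if "D z \<le> 0" for z using that zeros_product_eq_0_iff[of z] e0 by simp
  have hz: "?h z \<noteq> 0" if "D z \<ge> 0" for z using that poles_product_eq_0_iff[of z] by simp
  have gD: "\<exists>F. F holomorphic_on UNIV \<and> F z \<noteq> 0 \<and> (\<forall>u. ?g u = F u * (u - z) ^ nat (D z))"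
    if Dz: "D z > 0" for z
  proof -
    obtain H where H: "H holomorphic_on UNIV" "H (z - \<sigma>) \<noteq> 0"
        "\<And>u. zeros.product (u - \<sigma>) = H (u - \<sigma>) * (u - z) ^ nat (D z)"
      using zeros_product_factorization[OF Dz] by blast
    have "(\<lambda>u. e u * H (u - \<sigma>)) holomorphic_on UNIV"
      by (intro holomorphic_intros e holomorphic_on_translate H(1))
    then show ?thesis
      using H(2,3) e0 by (intro exI[of _ "\<lambda>u. e u * H (u - \<sigma>)"]) simp
  qed
  have hD: "\<exists>F. F holomorphic_on UNIV \<and> F z \<noteq> 0 \<and> (\<forall>u. ?h u = F u * (u - z) ^ nat (- D z))"
    if Dz: "D z < 0" for z
  proof -
    obtain H where H: "H holomorphic_on UNIV" "H (z - \<sigma>) \<noteq> 0"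
        "\<And>u. poles.product (u - \<sigma>) = H (u - \<sigma>) * (u - z) ^ nat (- D z)"
      using poles_product_factorization[OF Dz] by blast
    then show ?thesis
      by (intro exI[of _ "\<lambda>u. H (u - \<sigma>)"]) (simp add: holomorphic_on_translate)
  qed
  show "f nicely_meromorphic_on UNIV" "zorder f z = D z"
    unfolding f_def using meromorphic_quotient[OF g h gz hz gD hD] by auto
qed

text \<open>The logarithmic derivative of each Weierstrass factor is a summand of \<^const>\<open>G_fun\<close>, counted positively for zeros
  and negatively for poles.\<close>

lemma product_quotient_logderiv:
  assumes s: "D s = 0"
  defines "q \<equiv> \<lambda>z. zeros.product (z - \<sigma>) / poles.product (z - \<sigma>)"
  shows "(q has_field_derivative q s * G_fun D d \<sigma> s) (at s)"
proof -
  let ?Z = "zeros.product" and ?N = "poles.product" and ?z = "s - \<sigma>"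
  have nz: "?Z ?z \<noteq> 0" "?N ?z \<noteq> 0"
    using s zeros_product_eq_0_iff[of s] poles_product_eq_0_iff[of s] by auto
  let ?t = "\<lambda>k n. of_nat (k n) * (?z / \<tau> n) ^ (d - 1) / (?z - \<tau> n)"
  have "(\<lambda>n. ?t (\<lambda>n. nat (m n)) n - ?t (\<lambda>n. nat (- m n)) n) sums (deriv ?Z ?z / ?Z ?z - deriv ?N ?z / ?N ?z)"
    by (intro sums_diff zeros.logderiv_product poles.logderiv_product nz)
  also have "(\<lambda>n. ?t (\<lambda>n. nat (m n)) n - ?t (\<lambda>n. nat (- m n)) n)
      = (\<lambda>n. of_int (m n) * ((?z / \<tau> n) ^ (d - 1) * (1 / (?z - \<tau> n))))"
  proof
    fix n
    have "of_int (m n) = (of_nat (nat (m n)) - of_nat (nat (- m n)) :: complex)"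
      by (cases "m n \<ge> 0") simp_all
    then show "?t (\<lambda>n. nat (m n)) n - ?t (\<lambda>n. nat (- m n)) n
        = of_int (m n) * ((?z / \<tau> n) ^ (d - 1) * (1 / (?z - \<tau> n)))"
      by (simp add: left_diff_distrib diff_divide_distrib)
  qed
  finally have G: "G_fun D d \<sigma> s = deriv ?Z ?z / ?Z ?z - deriv ?N ?z / ?N ?z"
    by (simp add: G_fun_series sums_iff)
  note dZ = deriv_translate[OF zeros.product_holomorphic, of \<sigma> s]
  note dN = deriv_translate[OF poles.product_holomorphic, of \<sigma> s]
  have "(q has_field_derivative (deriv ?Z ?z * ?N ?z - ?Z ?z * deriv ?N ?z) / (?N ?z * ?N ?z)) (at s)"
    unfolding q_def by (rule DERIV_divide[OF dZ dN nz(2)])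
  also have "(deriv ?Z ?z * ?N ?z - ?Z ?z * deriv ?N ?z) / (?N ?z * ?N ?z) = q s * G_fun D d \<sigma> s"
    unfolding G q_def using nz by (simp add: field_simps)
  finally show ?thesis .
qed

text \<open>For \<open>|z| \<ge> 1\<close> the shift by \<open>\<sigma>\<close> costs only a constant factor in the exponent.\<close>

lemma translated_product_growth:
  obtains K where
    "\<And>z. norm z \<ge> 1 \<Longrightarrow> norm (zeros.product (z - \<sigma>)) \<le> exp (K * norm z ^ d)"
    "\<And>z. norm z \<ge> 1 \<Longrightarrow> norm (poles.product (z - \<sigma>)) \<le> exp (K * norm z ^ d)"
proof -
  have d: "Suc (d - 1) = d" using d_pos by simp
  obtain C1 where C1: "C1 \<ge> 0" "\<And>z. norm (zeros.product z) \<le> exp (C1 * norm z ^ d)"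
    using zeros.product_growth unfolding d by blast
  obtain C2 where C2: "C2 \<ge> 0" "\<And>z. norm (poles.product z) \<le> exp (C2 * norm z ^ d)"
    using poles.product_growth unfolding d by blast
  define K where "K = max C1 C2 * (1 + norm \<sigma>) ^ d"
  have shift: "C * norm (z - \<sigma>) ^ d \<le> K * norm z ^ d"
    if "norm z \<ge> 1" "0 \<le> C" "C \<le> max C1 C2" for z C
  proof -
    have "norm \<sigma> * 1 \<le> norm \<sigma> * norm z" using that by (intro mult_left_mono) auto
    then have "norm (z - \<sigma>) \<le> (1 + norm \<sigma>) * norm z"
      using norm_triangle_ineq4[of z \<sigma>] by (simp add: algebra_simps)
    then have "norm (z - \<sigma>) ^ d \<le> ((1 + norm \<sigma>) * norm z) ^ d" by (intro power_mono) auto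
    then have "C * norm (z - \<sigma>) ^ d \<le> max C1 C2 * ((1 + norm \<sigma>) * norm z) ^ d"
      using that by (intro mult_mono) auto
    then show ?thesis by (simp add: K_def power_mult_distrib mult.assoc)
  qed
  show ?thesis
  proof (rule that[of K])
    fix z :: complex assume z: "norm z \<ge> 1"
    show "norm (zeros.product (z - \<sigma>)) \<le> exp (K * norm z ^ d)"
      by (rule order.trans[OF C1(2)]) (use shift[OF z C1(1)] in simp)
    show "norm (poles.product (z - \<sigma>)) \<le> exp (K * norm z ^ d)"
      by (rule order.trans[OF C2(2)]) (use shift[OF z C2(1)] in simp)
  qed
qed

end

lemma exp_polynomial_growth:
  fixes c :: "nat \<Rightarrow> complex"
  assumes d: "d \<ge> 1" and z: "norm z \<ge> 1"
  shows "norm (exp (- (\<Sum>j<d - 1. c j * z ^ Suc j / of_nat (Suc j)))) \<le> exp ((\<Sum>j<d - 1. norm (c j)) * norm z ^ d)"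
proof -
  let ?Q = "\<Sum>j<d - 1. c j * z ^ Suc j / of_nat (Suc j)"
  have "norm ?Q \<le> (\<Sum>j<d - 1. norm (c j) * norm z ^ d)"
  proof (rule sum_norm_le)
    fix j assume j: "j \<in> {..<d - 1}"
    have "norm (c j * z ^ Suc j / of_nat (Suc j)) = norm (c j) * norm z ^ Suc j / real (Suc j)"
      by (simp only: norm_divide norm_mult norm_power norm_of_nat)
    also have "\<dots> \<le> norm (c j) * norm z ^ Suc j / 1"
      by (intro divide_left_mono) auto
    also have "\<dots> = norm (c j) * norm z ^ Suc j" by simp
    also have "\<dots> \<le> norm (c j) * norm z ^ d"
      using z j by (intro mult_left_mono power_increasing) auto
    finally show "norm (c j * z ^ Suc j / of_nat (Suc j)) \<le> norm (c j) * norm z ^ d" .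
  qed
  then have "norm (- ?Q) \<le> (\<Sum>j<d - 1. norm (c j)) * norm z ^ d" by (simp add: sum_distrib_right)
  then show ?thesis by (intro order.trans[OF norm_exp]) simp
qed

section \<open>The converse of the Poisson-Newton formula\<close>

text \<open>Termwise differentiation of holomorphic functions needs only a uniform majorant of the undifferentiated series.\<close>

lemma has_field_derivative_exp_sum:
  fixes b \<beta> :: "nat \<Rightarrow> complex"
  assumes fr: "frequencies N \<mu>" and sm: "(\<lambda>n. norm (\<beta> n) * exp (- \<mu> n * A)) summable_on idx N"
    and smb: "(\<lambda>n. norm (b n) * exp (- \<mu> n * A)) summable_on idx N"
    and b: "\<And>n. n \<in> idx N \<Longrightarrow> b n = of_real (\<mu> n) * \<beta> n" and s: "Re s > A"
  shows "((\<lambda>s. \<Sum>\<^sub>\<infinity>n\<in>idx N. \<beta> n * exp (- of_real (\<mu> n) * s)) has_field_derivative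
           - (\<Sum>\<^sub>\<infinity>n\<in>idx N. b n * exp (- of_real (\<mu> n) * s))) (at s)"
proof -
  let ?I = "\<lambda>f n. if n \<in> idx N then f n else (0::complex)"
  let ?S = "{s. Re s > A}"
  have bij: "bij_betw (\<lambda>n. n) (idx N) (idx N)" by (simp add: bij_betw_def)
  have pos: "\<mu> n \<ge> 0" if "n \<in> idx N" for n using fr that by (auto simp: frequencies_def intro: less_imp_le)
  have S: "open ?S" by (rule open_halfspace_Re_gt)
  have maj: "\<exists>h. summable h \<and> (\<forall>n. \<forall>s\<in>?S. norm (?I (\<lambda>n. a n * exp (- of_real (\<mu> n) * s)) n) \<le> h n)"
    if "(\<lambda>n. norm (a n) * exp (- \<mu> n * A)) summable_on idx N" for a
  proof (intro exI conjI allI ballI)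
    let ?h = "\<lambda>n. if n \<in> idx N then norm (a n) * exp (- \<mu> n * A) else 0"
    have "?h summable_on UNIV"
      by (rule summable_on_cong_neutral[THEN iffD1, OF _ _ _ that]) auto
    then show "summable ?h" by (rule summable_on_imp_summable)
    fix n s assume s: "s \<in> ?S"
    show "norm (?I (\<lambda>n. a n * exp (- of_real (\<mu> n) * s)) n) \<le> ?h n"
    proof (cases "n \<in> idx N")
      case True
      have "\<mu> n * A \<le> \<mu> n * Re s" using s pos[OF True] by (intro mult_left_mono) auto
      then show ?thesis using True by (auto simp: norm_mult intro!: mult_left_mono)
    qed auto
  qed
  have eq: "(\<Sum>\<^sub>\<infinity>n\<in>idx N. a n * exp (- of_real (\<mu> n) * s)) = (\<Sum>n. ?I (\<lambda>n. a n * exp (- of_real (\<mu> n) * s)) n)"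
    if a: "(\<lambda>n. norm (a n) * exp (- \<mu> n * A)) summable_on idx N" and s: "s \<in> ?S" for a s
  proof (rule infsum_enumerate[OF bij])
    obtain h where h: "summable h" "\<forall>n. \<forall>s\<in>?S. norm (?I (\<lambda>n. a n * exp (- of_real (\<mu> n) * s)) n) \<le> h n"
      using maj[OF a] by (elim exE conjE) (rule that)
    show "summable (\<lambda>n. norm (?I (\<lambda>n. a n * exp (- of_real (\<mu> n) * s)) n))"
      by (rule summable_comparison_test[OF _ h(1)]) (use s h(2) in auto)
  qed
  obtain h where h: "summable h" "\<forall>n. \<forall>s\<in>?S. norm (?I (\<lambda>n. \<beta> n * exp (- of_real (\<mu> n) * s)) n) \<le> h n"
    using maj[OF sm] by (elim exE conjE) (rule that)
  have der: "((\<lambda>s. ?I (\<lambda>n. \<beta> n * exp (- of_real (\<mu> n) * s)) n) has_field_derivative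
      ?I (\<lambda>n. - b n * exp (- of_real (\<mu> n) * s)) n) (at s)" for n s
    by (cases "n \<in> idx N") (auto intro!: derivative_eq_intros simp: b)
  obtain g g' where g: "\<forall>s\<in>?S. (\<lambda>n. ?I (\<lambda>n. \<beta> n * exp (- of_real (\<mu> n) * s)) n) sums g s \<and>
      (\<lambda>n. ?I (\<lambda>n. - b n * exp (- of_real (\<mu> n) * s)) n) sums g' s \<and> (g has_field_derivative g' s) (at s)"
    by (rule series_and_derivative_comparison[OF S h(1) der, of "\<lambda>n. n"]) (use h(2) in auto)
  have sS: "s \<in> ?S" using s by simp
  have "g' s = - (\<Sum>\<^sub>\<infinity>n\<in>idx N. b n * exp (- of_real (\<mu> n) * s))"
  proof -
    have "(\<lambda>n. - ?I (\<lambda>n. - b n * exp (- of_real (\<mu> n) * s)) n) sums - g' s"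
      using g sS by (intro sums_minus) auto
    also have "(\<lambda>n. - ?I (\<lambda>n. - b n * exp (- of_real (\<mu> n) * s)) n) = ?I (\<lambda>n. b n * exp (- of_real (\<mu> n) * s))"
      by auto
    finally show ?thesis unfolding eq[OF smb sS] by (simp add: sums_iff)
  qed
  moreover have "((\<lambda>s. \<Sum>\<^sub>\<infinity>n\<in>idx N. \<beta> n * exp (- of_real (\<mu> n) * s)) has_field_derivative g' s) (at s)"
  proof (rule has_field_derivative_transform_within_open[OF _ S sS])
    show "(g has_field_derivative g' s) (at s)" using g sS by blast
    fix x assume x: "x \<in> ?S"
    then have "(\<lambda>n. ?I (\<lambda>n. \<beta> n * exp (- of_real (\<mu> n) * x)) n) sums g x" using g by blast
    then show "g x = (\<Sum>\<^sub>\<infinity>n\<in>idx N. \<beta> n * exp (- of_real (\<mu> n) * x))"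
      unfolding eq[OF sm x] by (rule sums_unique)
  qed
  ultimately show ?thesis by simp
qed

theorem proposition3p20:
  fixes D :: "complex \<Rightarrow> int" and d :: nat and \<sigma>\<^sub>1 :: real and \<sigma> :: complex
    and N :: enat and \<mu> :: "nat \<Rightarrow> real" and b c :: "nat \<Rightarrow> complex"
  assumes "is_divisor D"
    and "convergence_exponent D d" and "d \<ge> 1"
    and "\<forall>\<rho>\<in>div_supp D. Re \<rho> \<le> \<sigma>\<^sub>1"
    and "\<sigma> \<notin> div_supp D"
    and "frequencies N \<mu>"
    and "\<exists>\<sigma>' :: real. (\<lambda>n. norm (b n) * exp (- \<mu> n * \<sigma>')) summable_on idx N"
    and "eq_distrib (W_distrib D d \<sigma>)
           (\<lambda>\<phi>. (\<Sum>\<^sub>\<infinity>n\<in>idx N. b n * delta (\<mu> n) \<phi>) +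
                 (\<Sum>j<d - 1. c j * distrib_deriv j (delta 0) \<phi>))"
  shows "\<exists>f N' l a P. dirichlet_series N' l a f \<and> meromorphic_finite_order f \<and>
           (\<forall>z. zorder f z = D z) \<and>
           discrepancy_poly f D d \<sigma> P \<and>
           eq_distrib (discrepancy_term P) (\<lambda>\<phi>. \<Sum>j<d - 1. c j * distrib_deriv j (delta 0) \<phi>) \<and>
           eq_distrib (frequency_term N' l a) (\<lambda>\<phi>. \<Sum>\<^sub>\<infinity>n\<in>idx N. b n * delta (\<mu> n) \<phi>)"
proof -
  note fr = assms(6)
  have "div_summable D d" using assms(2) by (simp add: convergence_exponent_def)
  then obtain \<tau> m where "enumerated_divisor D d \<sigma> \<tau> m"
    using enumerated_divisor_exists[OF assms(1) _ assms(3,5)] by blast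
  then interpret enumerated_divisor D d \<sigma> \<tau> m .
  have offD: "D s = 0" if "s \<notin> div_supp D" for s using that by (simp add: div_supp_def)

  define P where "P = (\<Sum>j<d - 1. monom (c j) j)"
  have polyP: "poly P z = (\<Sum>j<d - 1. c j * z ^ j)" for z by (simp add: P_def poly_sum poly_monom)
  have coeffP: "coeff P j = (if j < d - 1 then c j else 0)" for j by (simp add: P_def coeff_sum)
  define Q where "Q z = (\<Sum>j<d - 1. c j * z ^ Suc j / of_nat (Suc j))" for z
  have dQ: "(Q has_field_derivative poly P z) (at z)" for z
  proof -
    have "((\<lambda>z. c j * z ^ Suc j / of_nat (Suc j)) has_field_derivative c j * z ^ j) (at z)" for j
      by (auto intro!: derivative_eq_intros simp del: power_Suc of_nat_Suc)
    then show ?thesis unfolding Q_def polyP by (rule DERIV_sum)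
  qed
  have Qhol: "Q holomorphic_on UNIV" using dQ by (auto simp: holomorphic_on_open)

  \<comment> \<open>The exponential removes the polynomial from the logarithmic derivative \<open>G\<close> of the product quotient.\<close>
  define f0 where "f0 z = exp (- Q z) * (zeros.product (z - \<sigma>) / poles.product (z - \<sigma>))" for z
  have f0_nz: "f0 s \<noteq> 0" if "s \<notin> div_supp D" for s
    using offD[OF that] zeros_product_eq_0_iff[of s] poles_product_eq_0_iff[of s] by (simp add: f0_def)
  have df0: "(f0 has_field_derivative f0 s * (G_fun D d \<sigma> s - poly P s)) (at s)"
    if s: "s \<notin> div_supp D" for s
  proof -
    have "((\<lambda>z. exp (- Q z)) has_field_derivative exp (- Q s) * (- poly P s)) (at s)"
      by (rule DERIV_fun_exp[OF DERIV_minus[OF dQ]])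
    note * = DERIV_mult[OF this product_quotient_logderiv[OF offD[OF s]]]
    have "exp (- Q s) * (- poly P s) * q + q * G * exp (- Q s) = exp (- Q s) * q * (G - poly P s)" for q G
      by (simp add: algebra_simps)
    from DERIV_cong[OF * this] show ?thesis unfolding f0_def[abs_def] .
  qed

  define r where "r = max 0 (\<sigma>\<^sub>1 - Re \<sigma>)"
  have r: "Re (\<tau> n) \<le> r" if "m n \<noteq> 0" for n
  proof -
    have "\<sigma> + \<tau> n \<in> div_supp D" using D_at[OF that] that by (simp add: div_supp_def)
    then have "Re (\<sigma> + \<tau> n) \<le> \<sigma>\<^sub>1" using assms(4) by blast
    then show ?thesis by (simp add: r_def)
  qed
  obtain \<sigma>' where \<sigma>': "(\<lambda>n. norm (b n) * exp (- \<mu> n * \<sigma>')) summable_on idx N" using assms(7) by blast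
  \<comment> \<open>Of the margin \<open>2\<close>, one unit pays for the growth of the polynomial factors of the test functions,
    the other leaves an integrable majorant.\<close>
  define A where "A = max \<sigma>' (Re \<sigma> + r + 2)"
  have smb: "(\<lambda>n. norm (b n) * exp (- \<mu> n * A)) summable_on idx N"
    by (rule exp_sum_decay(1)[OF \<sigma>', of 0]) (use fr in \<open>auto simp: frequencies_def A_def intro: less_imp_le\<close>)
  define \<beta> where "\<beta> n = b n / of_real (\<mu> n)" for n
  have b\<beta>: "b n = of_real (\<mu> n) * \<beta> n" if "n \<in> idx N" for n
    using fr that by (auto simp: \<beta>_def frequencies_def)
  obtain \<delta> where \<delta>: "\<delta> > 0" "\<And>n. n \<in> idx N \<Longrightarrow> \<mu> n \<ge> \<delta>"
    using frequencies_lower_bound[OF fr] by blast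
  have sm\<beta>: "(\<lambda>n. norm (\<beta> n) * exp (- \<mu> n * A)) summable_on idx N"
  proof (rule summable_on_comparison_test)
    show "(\<lambda>n. 1 / \<delta> * (norm (b n) * exp (- \<mu> n * A))) summable_on idx N"
      by (rule summable_on_cmult_right[OF smb])
    show "norm (\<beta> n) * exp (- \<mu> n * A) \<le> 1 / \<delta> * (norm (b n) * exp (- \<mu> n * A))" if "n \<in> idx N" for n
    proof -
      have "norm (b n) / \<bar>\<mu> n\<bar> \<le> norm (b n) / \<delta>"
        using \<delta>(1) \<delta>(2)[OF that] by (intro divide_left_mono) auto
      then have "norm (b n) / \<bar>\<mu> n\<bar> * exp (- \<mu> n * A) \<le> norm (b n) / \<delta> * exp (- \<mu> n * A)"
        by (intro mult_right_mono) auto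
      then show ?thesis by (simp add: \<beta>_def norm_divide)
    qed
  qed auto
  define \<Phi> where "\<Phi> s = (\<Sum>\<^sub>\<infinity>n\<in>idx N. \<beta> n * exp (- of_real (\<mu> n) * s))" for s
  let ?U = "{s. Re s > A}"
  have U: "s \<notin> div_supp D" if "s \<in> ?U" for s
    using that assms(4) by (fastforce simp: A_def r_def)
  have const: "((\<lambda>z. f0 z * exp (\<Phi> z)) has_field_derivative 0) (at s within ?U)" if s: "s \<in> ?U" for s
  proof -
    let ?B = "\<Sum>\<^sub>\<infinity>n\<in>idx N. b n * exp (- of_real (\<mu> n) * s)"
    have "G_fun D d \<sigma> s = ?B + (\<Sum>j<d - 1. c j * s ^ j)"
      by (rule poisson_newton_laplace[OF _ _ _ fr smb _ assms(8), of r])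
         (erule r, use s in \<open>auto simp: A_def r_def\<close>)
    then have G: "G_fun D d \<sigma> s - poly P s = ?B" by (simp add: polyP)
    have d\<Phi>: "(\<Phi> has_field_derivative - ?B) (at s)"
      unfolding \<Phi>_def by (rule has_field_derivative_exp_sum[OF fr sm\<beta> smb b\<beta>]) (use s in auto)
    have "((\<lambda>z. f0 z * exp (\<Phi> z)) has_field_derivative
        f0 s * ?B * exp (\<Phi> s) + exp (\<Phi> s) * (- ?B) * f0 s) (at s)"
      by (rule DERIV_mult[OF df0[OF U[OF s], unfolded G] DERIV_fun_exp[OF d\<Phi>]])
    then have "((\<lambda>z. f0 z * exp (\<Phi> z)) has_field_derivative 0) (at s)"
      by (rule DERIV_cong) (simp add: mult_ac)
    then show ?thesis by (rule has_field_derivative_at_within)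
  qed
  have "\<exists>C. \<forall>s\<in>?U. f0 s * exp (\<Phi> s) = C"
    by (rule has_field_derivative_zero_constant[OF convex_halfspace_Re_gt const])
  then obtain C where C: "\<And>s. s \<in> ?U \<Longrightarrow> f0 s * exp (\<Phi> s) = C" by auto
  have "of_real (A + 1) \<in> ?U" by simp
  then have "C \<noteq> 0" using C[of "of_real (A + 1)"] f0_nz[OF U[of "of_real (A + 1)"]] by auto

  \<comment> \<open>Dividing by \<open>C\<close> normalizes the constant term of the Dirichlet series to \<open>1\<close>.\<close>
  define e where "e z = exp (- Q z) / C" for z
  define f where "f z = e z * zeros.product (z - \<sigma>) / poles.product (z - \<sigma>)" for z
  have f_f0: "f z = f0 z / C" for z by (simp add: f_def e_def f0_def)
  have ehol: "e holomorphic_on UNIV" unfolding e_def[abs_def]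
    by (intro holomorphic_intros Qhol) (use \<open>C \<noteq> 0\<close> in auto)
  have e0: "e z \<noteq> 0" for z using \<open>C \<noteq> 0\<close> by (simp add: e_def)
  have fU: "f s = exp (- (\<Sum>\<^sub>\<infinity>n\<in>idx N. \<beta> n * exp (- of_real (\<mu> n) * s)))" if "Re s \<ge> A + 1" for s
  proof -
    have "f s * exp (\<Phi> s) = 1" using C[of s] that \<open>C \<noteq> 0\<close> by (simp add: f_f0)
    then show ?thesis unfolding exp_minus \<Phi>_def by (simp add: field_simps)
  qed
  have sm\<beta>': "(\<lambda>n. norm (\<beta> n) * exp (- \<mu> n * (A + 1))) summable_on idx N"
    by (rule exp_sum_decay(1)[OF sm\<beta>, of 0]) (use fr in \<open>auto simp: frequencies_def intro: less_imp_le\<close>)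
  obtain N' l a where ds: "dirichlet_series N' l a f"
    using exp_minus_dirichlet_series[OF fr sm\<beta>' fU] by blast
  have "eq_distrib (frequency_term N' l a) (\<lambda>\<phi>. \<Sum>\<^sub>\<infinity>n\<in>idx N. of_real (\<mu> n) * \<beta> n * delta (\<mu> n) \<phi>)"
    by (rule frequency_term_of_logarithm[OF ds fr sm\<beta>' fU])
  also have "(\<lambda>\<phi>. \<Sum>\<^sub>\<infinity>n\<in>idx N. of_real (\<mu> n) * \<beta> n * delta (\<mu> n) \<phi>) = (\<lambda>\<phi>. \<Sum>\<^sub>\<infinity>n\<in>idx N. b n * delta (\<mu> n) \<phi>)"
    by (intro ext infsum_cong) (simp add: b\<beta>)
  finally have freq: "eq_distrib (frequency_term N' l a) (\<lambda>\<phi>. \<Sum>\<^sub>\<infinity>n\<in>idx N. b n * delta (\<mu> n) \<phi>)" .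

  have disc: "discrepancy_poly f D d \<sigma> P"
    unfolding discrepancy_poly_def
  proof (intro allI impI)
    fix s assume s: "s \<notin> div_supp D"
    have "(f has_field_derivative f s * (G_fun D d \<sigma> s - poly P s)) (at s)"
      using DERIV_cdivide[OF df0[OF s], of C] by (simp add: f_f0[abs_def])
    then have "deriv f s = f s * (G_fun D d \<sigma> s - poly P s)" by (rule DERIV_imp_deriv)
    moreover have "f s \<noteq> 0" using f0_nz[OF s] \<open>C \<noteq> 0\<close> by (simp add: f_f0)
    ultimately show "poly P s = G_fun D d \<sigma> s - deriv f s / f s" by simp
  qed
  have disc_term: "discrepancy_term P = (\<lambda>\<phi>. \<Sum>j<d - 1. c j * distrib_deriv j (delta 0) \<phi>)"
  proof
    fix \<phi>
    have "discrepancy_term P \<phi> = (\<Sum>j\<in>{..degree P} \<union> {..<d - 1}. coeff P j * distrib_deriv j (delta 0) \<phi>)"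
      unfolding discrepancy_term_def by (rule sum.mono_neutral_left) (auto simp: coeff_eq_0)
    also have "\<dots> = (\<Sum>j<d - 1. c j * distrib_deriv j (delta 0) \<phi>)"
      by (rule sum.mono_neutral_cong_right) (auto simp: coeffP)
    finally show "discrepancy_term P \<phi> = (\<Sum>j<d - 1. c j * distrib_deriv j (delta 0) \<phi>)" .
  qed

  have nice: "f nicely_meromorphic_on UNIV" and ord: "\<And>z. zorder f z = D z"
    using product_quotient_has_divisor[OF ehol e0] by (simp_all add: f_def[abs_def])
  obtain K where K:
      "\<And>z. norm z \<ge> 1 \<Longrightarrow> norm (zeros.product (z - \<sigma>)) \<le> exp (K * norm z ^ d)"
      "\<And>z. norm z \<ge> 1 \<Longrightarrow> norm (poles.product (z - \<sigma>)) \<le> exp (K * norm z ^ d)"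
    using translated_product_growth by blast
  have num: "entire_finite_order (\<lambda>z. e z * zeros.product (z - \<sigma>))"
  proof (rule entire_finite_orderI)
    show "(\<lambda>z. e z * zeros.product (z - \<sigma>)) holomorphic_on UNIV"
      by (intro holomorphic_intros ehol holomorphic_on_translate zeros.product_holomorphic)
    fix z :: complex assume z: "norm z \<ge> 1"
    have "norm (1 / C) * 1 \<le> norm (1 / C) * norm z ^ d"
      using z by (intro mult_left_mono one_le_power) auto
    then have Cb: "norm (1 / C) \<le> exp (norm (1 / C) * norm z ^ d)"
      using exp_ge_add_one_self[of "norm (1 / C) * norm z ^ d"] by linarith
    have "norm (e z * zeros.product (z - \<sigma>)) = norm (1 / C) * norm (exp (- Q z)) * norm (zeros.product (z - \<sigma>))"
      by (simp add: e_def norm_mult norm_divide)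
    also have "\<dots> \<le> exp (norm (1 / C) * norm z ^ d) * exp ((\<Sum>j<d - 1. norm (c j)) * norm z ^ d)
        * exp (K * norm z ^ d)"
      unfolding Q_def by (intro mult_mono Cb exp_polynomial_growth assms(3) z K(1)) auto
    also have "\<dots> = exp ((norm (1 / C) + (\<Sum>j<d - 1. norm (c j)) + K) * norm z ^ d)"
      by (simp add: exp_add[symmetric] algebra_simps)
    finally show "norm (e z * zeros.product (z - \<sigma>)) \<le> exp ((norm (1 / C) + (\<Sum>j<d - 1. norm (c j)) + K) * norm z ^ d)" .
  qed
  have den: "entire_finite_order (\<lambda>z. poles.product (z - \<sigma>))"
    by (rule entire_finite_orderI[OF holomorphic_on_translate[OF poles.product_holomorphic] K(2)])
  have nz: "poles.product (\<sigma> - \<sigma>) \<noteq> 0"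
    using poles_product_eq_0_iff[of \<sigma>] offD[OF assms(5)] by linarith
  have quot: "\<forall>z. poles.product (z - \<sigma>) \<noteq> 0 \<longrightarrow> f z = e z * zeros.product (z - \<sigma>) / poles.product (z - \<sigma>)"
    by (simp add: f_def)
  have "meromorphic_finite_order f"
    unfolding meromorphic_finite_order_def
    by (intro conjI exI) (rule nice, rule num, rule den, rule nz, rule quot)
  moreover have "eq_distrib (discrepancy_term P) (\<lambda>\<phi>. \<Sum>j<d - 1. c j * distrib_deriv j (delta 0) \<phi>)"
    unfolding disc_term by (simp add: eq_distrib_def)
  ultimately show ?thesis using ds ord disc freq by blast
qed

end
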